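(* Let $n$ be an integer greater than $2$. Let $\Gamma$ be a connected Jacobi diagram of degree $n$ on the oriented one-manifold $\{1,2\}\times\mathbb{R}$. Set $$I(\Gamma)=\int_{C(\Gamma)}\Psi^{\ast}\bigl(\Lambda^{E(\Gamma)}\omega\bigr).$$ If $\Gamma$ has fewer than three univalent vertices on some strand (that is, on $\{1\}\times\mathbb{R}$ or on $\{2\}\times\mathbb{R}$), then $I(\Gamma)=0$. In particular, the degree $n$ part $\tilde{\alpha}_n\in\mathcal{A}_n(\{1,2\}\times\mathbb{R})$ of the two-strand anomaly $\tilde{\alpha}$ is a linear combination of classes of connected Jacobi diagrams with at least $3$ univalent vertices on each of the two strands.
   Context: **Jacobi diagrams.** Let $M$ be an oriented one-manifold. A Jacobi diagram $\Gamma$ on $M$ is a finite uni-trivalent graph $\Gamma$ (every vertex has valence 1 or 3; multiple edges are allowed, but no edge joins a vertex to itself) such that every connected component of $\Gamma$ has at least one univalent vertex, equipped with: (1) an isotopy class $[i]$ of injections $i$ of the set $U=U(\Gamma)$ of univalent vertices into the interior of $M$; (2) an orientation of every trivalent vertex, i.e. a cyclic order on the three half-edges meeting at this vertex. $\Gamma$ is connected if the graph $\Gamma$ (without $M$) is connected. A univalent vertex is said to be on a component of $M$ (a strand) if $i$ sends it there. $T=T(\Gamma)$ is the set of trivalent vertices and $E=E(\Gamma)$ the set of edges of the graph $\Gamma$. The degree of $\Gamma$ is half the total number of its vertices (univalent and trivalent). **Spaces of diagrams.** $\mathcal{A}_n(M)$ is the real vector space generated by the degree $n$ Jacobi diagrams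 on $M$, modulo the following relations. AS: the sum of two diagrams that differ only by the orientation at one trivalent vertex is zero. STU: if a trivalent vertex $t$ of a diagram $D$ is adjacent to a univalent vertex $u$ lying on $M$, then $D=D'-D''$, where $D'$ and $D''$ are obtained from $D$ by removing $t$, $u$ and the edge between them, and attaching the two remaining half-edges of $t$ to two consecutive points of $M$ near the image of $u$, in one order for $D'$ and in the other for $D''$. Precisely, if the cyclic order at $t$ is (half-edge toward $u$, $h_1$, $h_2$), then in $D'$ the leg of $h_2$ precedes the leg of $h_1$ along the orientation of $M$, and in $D''$ the leg of $h_1$ precedes that of $h_2$ (here the edge from $u$ points up from $M$, $M$ is drawn oriented left to right, the cyclic orders are counterclockwise, $h_1$ is the right and $h_2$ the left upper half-edge). $\mathcal{A}(M)=\prod_{n\in\mathbb{N}}\mathcal{A}_n(M)$; the class of $\Gamma$ is denoted $[\Gamma]$, and the degree $n$ part of $\beta \in \mathcal{A}(M)$ is denoted $\beta_n$. **Configuration spaces and the map $\Psi$.** Let $L:M\to\mathbb{R}^3$ be a smooth embedding, or one of the maps $f_{(x,y)}$ below with $(x,y)\neq(0,0)$, and $\Gamma$ a Jacobi diagram on $M$. Set $$C(L;\Gamma)=\{c:U\cup T\hookrightarrow\mathbb{R}^3 \text{ injective}\;;\;\exists\, j\in[i],\ c_{|U}=L\circ j\},$$ an open submanifold of $M^U\times(\mathbb{R}^3)^T$. Fix an orientation of every edge of $\Gamma$. The map $\Psi:C(L;\Gamma)\to(S^2)^{E}$ is the map whose component indexed by an edge from $v_1$ to $v_2$ is the unit vector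 $\overrightarrow{c(v_1)c(v_2)}/\|\overrightarrow{c(v_1)c(v_2)}\|$. Let $\omega$ be the homogeneous (rotation-invariant) volume form on $S^2$ with $\int_{S^2}\omega=1$, where $S^2$ has its standard orientation; $\Lambda^{E}\omega$ denotes the product volume form on $(S^2)^E$ (the wedge product over $e\in E$ of the pull-backs of $\omega$ by the projections to the factors). Orientation of $C(L;\Gamma)$: the natural coordinates of $M^U\times(\mathbb{R}^3)^T$ are put in bijection with the half-edges of $\Gamma$: the half-edge at a univalent vertex corresponds to its coordinate in the oriented manifold $M$, and the three half-edges at a trivalent vertex correspond, in the given cyclic order, to the three standard coordinates of $\mathbb{R}^3$ (well defined up to cyclic, hence even, permutations). Choose a total order on $E$; the half-edges are ordered as (origin of first edge, endpoint of first edge, origin of second edge, ..., endpoint of last edge), and the corresponding order of coordinates orients $C(L;\Gamma)$. **The spaces $C(\Gamma)$ for $M=\{1,2\}\times\mathbb{R}$.** For $(x,y)\in\mathbb{R}^2$, let $f_{(x,y)}:\{1,2\}\times\mathbb{R}\to\mathbb{R}^3$ be given by $f_{(x,y)}(1,t)=(0,0,t)$ and $f_{(x,y)}(2,t)=(x,y,-t)$. Let $\Gamma$ be a Jacobi diagram on $\{1,2\}\times\mathbb{R}$ (each strand oriented by $\mathbb{R}$). For $\theta\in[0,2\pi[$, let $C_\theta(\Gamma)$ be the quotient of $C(f_{(\cos\theta,\sin\theta)};\Gamma)$ by the translations of $\mathbb{R}^3$ by the vectors $(0,0,z)$, $z\in\mathbb{R}$ (acting by composition on configurations), oriented so that $C(f_{(\cos\theta,\sin\theta)};\Gamma)$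 has the orientation (fiber $\oplus$ base), with base $C_\theta(\Gamma)$ and fiber the oriented vertical translation factor $\mathbb{R}$. Let $C(\Gamma)=\bigcup_{\theta\in[0,2\pi[}C_\theta(\Gamma)$, oriented by (base $[0,2\pi[$ $\oplus$ fiber $C_\theta(\Gamma)$). It has the same dimension $2\,\sharp E(\Gamma)$ as $(S^2)^{E(\Gamma)}$. The map $\Psi$ is invariant under the translations and induces a map $\Psi:C(\Gamma)\to(S^2)^{E(\Gamma)}$. The integrals $\int_{C(\Gamma)}\Psi^{\ast}(\Lambda^{E(\Gamma)}\omega)$ converge, and the product of this integral with $[\Gamma]$ does not depend on the choices made nor on the vertex orientation of $\Gamma$. **The two-strand anomaly.** $$\tilde{\alpha}=\sum_{\Gamma}\frac{1}{\sharp\mathrm{Aut}(\Gamma)}\left(\int_{C(\Gamma)}\Psi^{\ast}(\Lambda^{E(\Gamma)}\omega)\right)[\Gamma]\in\mathcal{A}(\{1,2\}\times\mathbb{R}),$$ where the sum runs over all connected Jacobi diagrams $\Gamma$ on $\{1,2\}\times\mathbb{R}$, two diagrams being identified if they coincide except possibly for their vertex orientations, and $\sharp\mathrm{Aut}(\Gamma)$ is the number of automorphisms of $\Gamma$ as a uni-trivalent graph with a given isotopy class of injections of $U$ into $\{1,2\}\times\mathbb{R}$, without vertex orientation. *)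

theory Defs
  imports "HOL-Analysis.Analysis" "HOL-Analysis.Finite_Function_Topology" "HOL-Combinatorics.Permutations"
begin

section \<open>Jacobi diagrams on two strands\<close>

text \<open>The oriented one-manifold \<open>{1,2} \<times> \<real>\<close>; every strand is oriented by \<open>\<real>\<close>. The topology
  of \<^typ>\<open>nat\<close> is discrete, so the subspace topology is that of two disjoint lines.\<close>

definition strands :: "(nat \<times> real) set"
  where "strands = {1, 2} \<times> UNIV"

text \<open>Injections of a vertex set \<open>U\<close> are extensional functions, and an isotopy is a homotopy
  through injections.\<close>

definition isotopy_class :: "nat set \<Rightarrow> (nat \<Rightarrow> nat \<times> real) \<Rightarrow> (nat \<Rightarrow> nat \<times> real) set"
  where "isotopy_class U i =
    {j \<in> U \<rightarrow>\<^sub>E strands. inj_on j U \<and>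
       homotopic_with (\<lambda>k. inj_on k U) (discrete_topology U) (top_of_set strands) i j}"

text \<open>A graph is given by its half-edges: \<open>vtx h\<close> is the vertex at which the half-edge \<open>h\<close> sits,
  \<open>opp h\<close> is the other half of the edge that contains \<open>h\<close>, and \<open>nxt h\<close> is the successor of \<open>h\<close> in
  the cyclic order at a trivalent vertex. The values of \<open>vtx\<close> and \<open>opp\<close> off the half-edges, and of
  \<open>nxt\<close> off the half-edges at trivalent vertices, carry no meaning. The field \<open>legs\<close> is the whole
  isotopy class of injections of the univalent vertices.\<close>

record jdiag =
  halves :: "nat set"
  vtx :: "nat \<Rightarrow> nat"
  opp :: "nat \<Rightarrow> nat"
  nxt :: "nat \<Rightarrow> nat"
  legs :: "(nat \<Rightarrow> nat \<times> real) set"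

definition verts :: "jdiag \<Rightarrow> nat set"
  where "verts \<Gamma> = vtx \<Gamma> ` halves \<Gamma>"

definition valence :: "jdiag \<Rightarrow> nat \<Rightarrow> nat"
  where "valence \<Gamma> v = card {h \<in> halves \<Gamma>. vtx \<Gamma> h = v}"

definition univalent :: "jdiag \<Rightarrow> nat set"
  where "univalent \<Gamma> = {v \<in> verts \<Gamma>. valence \<Gamma> v = 1}"

definition trivalent :: "jdiag \<Rightarrow> nat set"
  where "trivalent \<Gamma> = {v \<in> verts \<Gamma>. valence \<Gamma> v = 3}"

definition adjacency :: "jdiag \<Rightarrow> (nat \<times> nat) set"
  where "adjacency \<Gamma> = {(vtx \<Gamma> h, vtx \<Gamma> (opp \<Gamma> h)) | h. h \<in> halves \<Gamma>}"

text \<open>On the three half-edges at a trivalent vertex, a map without fixed points whose cube is the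
  identity is a cyclic permutation.\<close>

definition jacobi_diagram :: "jdiag \<Rightarrow> bool"
  where "jacobi_diagram \<Gamma> \<longleftrightarrow>
    finite (halves \<Gamma>) \<and>
    (\<forall>h\<in>halves \<Gamma>. opp \<Gamma> h \<in> halves \<Gamma> \<and> opp \<Gamma> (opp \<Gamma> h) = h \<and> vtx \<Gamma> (opp \<Gamma> h) \<noteq> vtx \<Gamma> h) \<and>
    verts \<Gamma> = univalent \<Gamma> \<union> trivalent \<Gamma> \<and>
    (\<forall>v\<in>verts \<Gamma>. \<exists>u\<in>univalent \<Gamma>. (v, u) \<in> (adjacency \<Gamma>)\<^sup>*) \<and>
    (\<exists>i\<in>univalent \<Gamma> \<rightarrow>\<^sub>E strands. inj_on i (univalent \<Gamma>) \<and> legs \<Gamma> = isotopy_class (univalent \<Gamma>) i) \<and>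
    (\<forall>h\<in>halves \<Gamma>. vtx \<Gamma> h \<in> trivalent \<Gamma> \<longrightarrow>
       nxt \<Gamma> h \<in> halves \<Gamma> \<and> vtx \<Gamma> (nxt \<Gamma> h) = vtx \<Gamma> h \<and>
       nxt \<Gamma> h \<noteq> h \<and> nxt \<Gamma> (nxt \<Gamma> (nxt \<Gamma> h)) = h)"

definition jconnected :: "jdiag \<Rightarrow> bool"
  where "jconnected \<Gamma> \<longleftrightarrow>
    verts \<Gamma> \<noteq> {} \<and> (\<forall>v\<in>verts \<Gamma>. \<forall>w\<in>verts \<Gamma>. (v, w) \<in> (adjacency \<Gamma>)\<^sup>*)"

text \<open>The number of vertices of a uni-trivalent graph is even, so the division is exact.\<close>

definition jdegree :: "jdiag \<Rightarrow> nat"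
  where "jdegree \<Gamma> = card (verts \<Gamma>) div 2"

text \<open>An isotopy keeps every univalent vertex on its strand, so any member of the class may be used.\<close>

definition strand_of :: "jdiag \<Rightarrow> nat \<Rightarrow> nat"
  where "strand_of \<Gamma> u = (THE s. \<exists>i\<in>legs \<Gamma>. fst (i u) = s)"

definition legs_on :: "jdiag \<Rightarrow> nat \<Rightarrow> nat set"
  where "legs_on \<Gamma> s = {u \<in> univalent \<Gamma>. strand_of \<Gamma> u = s}"

definition connected_diagrams :: "nat \<Rightarrow> jdiag set"
  where "connected_diagrams n = {\<Gamma>. jacobi_diagram \<Gamma> \<and> jconnected \<Gamma> \<and> jdegree \<Gamma> = n}"

text \<open>\<open>unoriented_iso\<close> disregards the vertex orientations.\<close>

definition unoriented_iso :: "jdiag \<Rightarrow> jdiag \<Rightarrow> (nat \<Rightarrow> nat) \<Rightarrow> bool"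
  where "unoriented_iso \<Gamma> \<Gamma>' \<phi> \<longleftrightarrow>
    bij_betw \<phi> (halves \<Gamma>) (halves \<Gamma>') \<and>
    (\<forall>h\<in>halves \<Gamma>. opp \<Gamma>' (\<phi> h) = \<phi> (opp \<Gamma> h)) \<and>
    (\<exists>\<psi>. bij_betw \<psi> (verts \<Gamma>) (verts \<Gamma>') \<and>
         (\<forall>h\<in>halves \<Gamma>. vtx \<Gamma>' (\<phi> h) = \<psi> (vtx \<Gamma> h)) \<and>
         legs \<Gamma> = (\<lambda>i. \<lambda>u\<in>univalent \<Gamma>. i (\<psi> u)) ` legs \<Gamma>')"

definition oriented_iso :: "jdiag \<Rightarrow> jdiag \<Rightarrow> (nat \<Rightarrow> nat) \<Rightarrow> bool"
  where "oriented_iso \<Gamma> \<Gamma>' \<phi> \<longleftrightarrow>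
    unoriented_iso \<Gamma> \<Gamma>' \<phi> \<and>
    (\<forall>h\<in>halves \<Gamma>. vtx \<Gamma> h \<in> trivalent \<Gamma> \<longrightarrow> \<phi> (nxt \<Gamma> h) = nxt \<Gamma>' (\<phi> h))"

text \<open>Automorphisms act on half-edges, so they may permute parallel edges.\<close>

definition automorphism_count :: "jdiag \<Rightarrow> nat"
  where "automorphism_count \<Gamma> = card {\<phi> \<in> extensional (halves \<Gamma>). unoriented_iso \<Gamma> \<Gamma> \<phi>}"


section \<open>Spaces of diagrams\<close>

abbreviation gen :: "jdiag \<Rightarrow> jdiag \<Rightarrow>\<^sub>0 real"
  where "gen \<Gamma> \<equiv> Poly_Mapping.single \<Gamma> 1"

text \<open>Diagrams are labelled by natural numbers; the first family of relators forgets the labels.\<close>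

definition iso_relators :: "(jdiag \<Rightarrow>\<^sub>0 real) set"
  where "iso_relators =
    {gen \<Gamma> - gen \<Gamma>' | \<Gamma> \<Gamma>'. jacobi_diagram \<Gamma> \<and> jacobi_diagram \<Gamma>' \<and> (\<exists>\<phi>. oriented_iso \<Gamma> \<Gamma>' \<phi>)}"

definition flip_vertex :: "nat \<Rightarrow> jdiag \<Rightarrow> jdiag"
  where "flip_vertex t \<Gamma> =
    \<Gamma>\<lparr>nxt := \<lambda>h. if vtx \<Gamma> h = t then nxt \<Gamma> (nxt \<Gamma> h) else nxt \<Gamma> h\<rparr>"

definition AS_relators :: "(jdiag \<Rightarrow>\<^sub>0 real) set"
  where "AS_relators =
    {gen \<Gamma> + gen (flip_vertex t \<Gamma>) | \<Gamma> t. jacobi_diagram \<Gamma> \<and> t \<in> trivalent \<Gamma>}"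

text \<open>Here \<open>k\<close> is the half-edge at the trivalent vertex \<open>t\<close> whose edge leads to the univalent vertex
  \<open>u\<close>. After removal of that edge the half-edge \<open>nxt k\<close> stays at \<open>t\<close> and \<open>nxt (nxt k)\<close> is moved to
  \<open>u\<close>, where the labels \<open>t\<close> and \<open>u\<close> are now reused for the two new univalent vertices, placed
  by the injection \<open>j\<close>.\<close>

definition stu_resolution :: "jdiag \<Rightarrow> nat \<Rightarrow> (nat \<Rightarrow> nat \<times> real) \<Rightarrow> jdiag"
  where "stu_resolution \<Gamma> k j =
    (let t = vtx \<Gamma> k; u = vtx \<Gamma> (opp \<Gamma> k) in
     \<Gamma>\<lparr>halves := halves \<Gamma> - {k, opp \<Gamma> k},
       vtx := (vtx \<Gamma>)(nxt \<Gamma> k := t, nxt \<Gamma> (nxt \<Gamma> k) := u),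
       legs := isotopy_class (insert t (univalent \<Gamma>)) j\<rparr>)"

text \<open>The positions \<open>a < b\<close> are consecutive and near the image \<open>p\<close> of \<open>u\<close>. In the first
  resolution the leg of \<open>nxt (nxt k)\<close> comes first, in the second one the leg of \<open>nxt k\<close>.\<close>

definition STU_relators :: "(jdiag \<Rightarrow>\<^sub>0 real) set"
  where "STU_relators =
    {gen \<Gamma> - (gen (stu_resolution \<Gamma> k (i(u := (s, a), t := (s, b))))
              - gen (stu_resolution \<Gamma> k (i(u := (s, b), t := (s, a))))) | \<Gamma> k t u i s p a b.
       jacobi_diagram \<Gamma> \<and> k \<in> halves \<Gamma> \<and>
       t = vtx \<Gamma> k \<and> t \<in> trivalent \<Gamma> \<and> u = vtx \<Gamma> (opp \<Gamma> k) \<and> u \<in> univalent \<Gamma> \<and>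
       i \<in> legs \<Gamma> \<and> i u = (s, p) \<and> a < b \<and> a \<le> p \<and> p \<le> b \<and>
       (\<forall>w\<in>univalent \<Gamma> - {u}. i w \<notin> {s} \<times> {a..b})}"

definition relators :: "(jdiag \<Rightarrow>\<^sub>0 real) set"
  where "relators = iso_relators \<union> AS_relators \<union> STU_relators"

text \<open>All degrees share one quotient space. The relators are homogeneous, so
  the classes of the degree \<open>n\<close> diagrams span a copy of \<open>\<A>\<^sub>n\<close> in it.\<close>

quotient_type jspace = "jdiag \<Rightarrow>\<^sub>0 real" / "\<lambda>x y. x - y \<in> span relators"
proof (rule equivpI)
  show "reflp (\<lambda>x y. x - y \<in> span relators)"
    by (simp add: reflp_def span_zero)
  show "symp (\<lambda>x y. x - y \<in> span relators)"
    by (rule sympI) (metis minus_diff_eq span_neg)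
  show "transp (\<lambda>x y. x - y \<in> span relators)"
  proof (rule transpI)
    fix x y z assume "x - y \<in> span relators" "y - z \<in> span relators"
    from span_add[OF this] show "x - z \<in> span relators" by simp
  qed
qed

instantiation jspace :: real_vector
begin

lift_definition zero_jspace :: jspace is "0" .

lift_definition plus_jspace :: "jspace \<Rightarrow> jspace \<Rightarrow> jspace" is "(+)"
proof -
  fix x x' y y' assume "x - x' \<in> span relators" "y - y' \<in> span relators"
  from span_add[OF this] show "x + y - (x' + y') \<in> span relators"
    by (simp only: add_diff_add)
qed

lift_definition uminus_jspace :: "jspace \<Rightarrow> jspace" is "uminus"
proof -
  fix x x' assume "x - x' \<in> span relators"
  from span_neg[OF this] show "- x - - x' \<in> span relators" by simp
qed

lift_definition minus_jspace :: "jspace \<Rightarrow> jspace \<Rightarrow> jspace" is "(-)"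
proof -
  fix x x' y y' assume *: "x - x' \<in> span relators" "y - y' \<in> span relators"
  have swap: "(a - c) - (b - d) = (a - b) - (c - d)" for a b c d :: "jdiag \<Rightarrow>\<^sub>0 real"
    by (simp only: diff_conv_add_uminus minus_add_distrib minus_minus ac_simps)
  from span_diff[OF *] show "x - y - (x' - y') \<in> span relators"
    by (simp only: swap)
qed

lift_definition scaleR_jspace :: "real \<Rightarrow> jspace \<Rightarrow> jspace" is "scaleR"
proof -
  fix r :: real and x x' assume "x - x' \<in> span relators"
  from span_scale[OF this, of r] show "r *\<^sub>R x - r *\<^sub>R x' \<in> span relators"
    by (simp only: scaleR_diff_right)
qed

instance
proof
  fix a b c :: jspace and r s :: real
  show "a + b + c = a + (b + c)" by transfer (simp add: add.assoc span_zero)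
  show "a + b = b + a" by transfer (simp add: add.commute span_zero)
  show "0 + a = a" by transfer (simp add: span_zero)
  show "- a + a = 0" by transfer (simp add: span_zero)
  show "a - b = a + - b" by transfer (simp add: span_zero)
  show "r *\<^sub>R (a + b) = r *\<^sub>R a + r *\<^sub>R b" by transfer (simp add: scaleR_add_right span_zero)
  show "(r + s) *\<^sub>R a = r *\<^sub>R a + s *\<^sub>R a" by transfer (simp add: scaleR_add_left span_zero)
  show "r *\<^sub>R s *\<^sub>R a = (r * s) *\<^sub>R a" by transfer (simp add: span_zero)
  show "1 *\<^sub>R a = a" by transfer (simp add: span_zero)
qed

end

lift_definition jclass :: "jdiag \<Rightarrow> jspace" is gen .

definition diagram_space :: "nat \<Rightarrow> jspace set"
  where "diagram_space n = span (jclass ` {\<Gamma>. jacobi_diagram \<Gamma> \<and> jdegree \<Gamma> = n})"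


section \<open>Configuration spaces\<close>

definition config_space :: "(nat \<times> real \<Rightarrow> real^3) \<Rightarrow> jdiag \<Rightarrow> (nat \<Rightarrow> real^3) set"
  where "config_space L \<Gamma> =
    {c \<in> extensional (verts \<Gamma>). inj_on c (verts \<Gamma>) \<and> (\<exists>j\<in>legs \<Gamma>. \<forall>u\<in>univalent \<Gamma>. c u = L (j u))}"

definition two_lines :: "real \<times> real \<Rightarrow> nat \<times> real \<Rightarrow> real^3"
  where "two_lines = (\<lambda>(x, y) (s, t). if s = 1 then vector [0, 0, t] else vector [x, y, - t])"

definition vertical_orbit :: "jdiag \<Rightarrow> (nat \<Rightarrow> real^3) \<Rightarrow> (nat \<Rightarrow> real^3) set"
  where "vertical_orbit \<Gamma> c = (\<lambda>z. \<lambda>v\<in>verts \<Gamma>. c v + vector [0, 0, z]) ` UNIV"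

definition C_theta :: "jdiag \<Rightarrow> real \<Rightarrow> (nat \<Rightarrow> real^3) set set"
  where "C_theta \<Gamma> \<theta> = vertical_orbit \<Gamma> ` config_space (two_lines (cos \<theta>, sin \<theta>)) \<Gamma>"

definition C_space :: "jdiag \<Rightarrow> (real \<times> (nat \<Rightarrow> real^3) set) set"
  where "C_space \<Gamma> = (SIGMA \<theta>:{0..<2 * pi}. C_theta \<Gamma> \<theta>)"

text \<open>The natural coordinates of a configuration are indexed by the half-edges. At a trivalent
  vertex the three coordinates follow the cyclic order from the least half-edge on.\<close>

definition first_half :: "jdiag \<Rightarrow> nat \<Rightarrow> nat"
  where "first_half \<Gamma> v = Min {h \<in> halves \<Gamma>. vtx \<Gamma> h = v}"

definition conf :: "jdiag \<Rightarrow> real \<Rightarrow> (nat \<Rightarrow> real) \<Rightarrow> nat \<Rightarrow> real^3"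
  where "conf \<Gamma> \<theta> x = (\<lambda>v\<in>verts \<Gamma>. let h = first_half \<Gamma> v in
     if v \<in> univalent \<Gamma> then two_lines (cos \<theta>, sin \<theta>) (strand_of \<Gamma> v, x h)
     else vector [x h, x (nxt \<Gamma> h), x (nxt \<Gamma> (nxt \<Gamma> h))])"

text \<open>A translation orbit contains exactly one configuration in which a given leg has coordinate
  zero. With \<open>base_half\<close> as that leg, \<open>\<theta>\<close> and the remaining coordinates give the global chart
  \<open>C_chart\<close> of \<open>C(\<Gamma>)\<close> (see \<open>bij_betw_C_chart\<close> below).\<close>

definition base_half :: "jdiag \<Rightarrow> nat"
  where "base_half \<Gamma> = Min {h \<in> halves \<Gamma>. vtx \<Gamma> h \<in> univalent \<Gamma>}"

definition slice_conf :: "jdiag \<Rightarrow> real \<times> (nat \<Rightarrow> real) \<Rightarrow> nat \<Rightarrow> real^3"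
  where "slice_conf \<Gamma> = (\<lambda>(\<theta>, x). conf \<Gamma> \<theta> (x(base_half \<Gamma> := 0)))"

definition C_chart :: "jdiag \<Rightarrow> real \<times> (nat \<Rightarrow> real) \<Rightarrow> real \<times> (nat \<Rightarrow> real^3) set"
  where "C_chart \<Gamma> y = (fst y, vertical_orbit \<Gamma> (slice_conf \<Gamma> y))"

definition chart_measure :: "jdiag \<Rightarrow> (real \<times> (nat \<Rightarrow> real)) measure"
  where "chart_measure \<Gamma> = lborel \<Otimes>\<^sub>M Pi\<^sub>M (halves \<Gamma> - {base_half \<Gamma>}) (\<lambda>_. lborel)"

definition chart_domain :: "jdiag \<Rightarrow> (real \<times> (nat \<Rightarrow> real)) set"
  where "chart_domain \<Gamma> = {y \<in> space (chart_measure \<Gamma>). C_chart \<Gamma> y \<in> C_space \<Gamma>}"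


lemma strand_of_eq:
  assumes "jacobi_diagram \<Gamma>" "j \<in> legs \<Gamma>" "u \<in> univalent \<Gamma>"
  shows "strand_of \<Gamma> u = fst (j u)"
proof -
  obtain i where i: "legs \<Gamma> = isotopy_class (univalent \<Gamma>) i"
    using assms(1) by (auto simp: jacobi_diagram_def)
  have *: "fst (k u) = fst (i u)" if k: "k \<in> legs \<Gamma>" for k
  proof -
    obtain F where F: "continuous_map (prod_topology (top_of_set {0..1::real})
          (discrete_topology (univalent \<Gamma>))) (top_of_set strands) F"
        and F0: "\<forall>x. F (0, x) = i x" and F1: "\<forall>x. F (1, x) = k x"
      using k unfolding i isotopy_class_def homotopic_with_def by auto
    have "continuous_map (top_of_set {0..1::real})
        (prod_topology (top_of_set {0..1}) (discrete_topology (univalent \<Gamma>))) (\<lambda>r. (r, u))"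
      using assms(3) by (intro continuous_map_pairedI) auto
    from continuous_map_compose[OF this F]
    have "continuous_on {0..1::real} (\<lambda>r. F (r, u))"
      by (simp add: o_def continuous_map_in_subtopology)
    then have "continuous_on {0..1::real} (\<lambda>r. fst (F (r, u)))"
      by (rule continuous_on_fst)
    then have "connected ((\<lambda>r. fst (F (r, u))) ` {0..1::real})" (is "connected ?I")
      by (rule connected_continuous_image) simp
    moreover have "fst (F (0, u)) \<in> ?I" "fst (F (1, u)) \<in> ?I"
      by (rule image_eqI[of _ _ 0] image_eqI[of _ _ 1]; simp)+
    moreover have "m = m'" if "connected I" "m \<in> I" "m' \<in> I" for m m' and I :: "nat set"
      using connectedD[OF that(1), of "{m}" "- {m}"] that(2,3) by (auto simp: open_discrete)
    ultimately have "fst (F (0, u)) = fst (F (1, u))"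
      by blast
    then show ?thesis using F0 F1 by simp
  qed
  show ?thesis
    unfolding strand_of_def
  proof (rule the_equality)
    show "\<exists>i\<in>legs \<Gamma>. fst (i u) = fst (j u)" using assms(2) by blast
  qed (use * assms(2) in auto)
qed

lemma jacobi_diagram_half:
  assumes "jacobi_diagram \<Gamma>" "h \<in> halves \<Gamma>"
  defines "a \<equiv> first_half \<Gamma> (vtx \<Gamma> h)"
  shows "a \<in> halves \<Gamma>" "vtx \<Gamma> a = vtx \<Gamma> h"
    and "vtx \<Gamma> h \<in> univalent \<Gamma> \<Longrightarrow> h = a"
    and "vtx \<Gamma> h \<notin> univalent \<Gamma> \<Longrightarrow> h \<in> {a, nxt \<Gamma> a, nxt \<Gamma> (nxt \<Gamma> a)}
           \<and> distinct [a, nxt \<Gamma> a, nxt \<Gamma> (nxt \<Gamma> a)]"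
proof -
  let ?S = "{k \<in> halves \<Gamma>. vtx \<Gamma> k = vtx \<Gamma> h}"
  have fin: "finite ?S" using assms(1) by (simp add: jacobi_diagram_def)
  have hS: "h \<in> ?S" using assms(2) by simp
  have aS: "a \<in> ?S" unfolding a_def first_half_def using fin hS by (metis (no_types, lifting) Min_in empty_iff)
  then show "a \<in> halves \<Gamma>" "vtx \<Gamma> a = vtx \<Gamma> h" by auto
  show "h = a" if "vtx \<Gamma> h \<in> univalent \<Gamma>"
  proof -
    have "card ?S = 1" using that by (simp add: univalent_def valence_def)
    then obtain k where "?S = {k}" by (rule card_1_singletonE)
    then show ?thesis using hS aS by (metis singletonD)
  qed
  show "h \<in> {a, nxt \<Gamma> a, nxt \<Gamma> (nxt \<Gamma> a)} \<and> distinct [a, nxt \<Gamma> a, nxt \<Gamma> (nxt \<Gamma> a)]"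
    if "vtx \<Gamma> h \<notin> univalent \<Gamma>"
  proof -
    have t: "vtx \<Gamma> h \<in> trivalent \<Gamma>"
      using that assms(1,2) by (auto simp: jacobi_diagram_def verts_def)
    have nx: "nxt \<Gamma> k \<in> ?S \<and> nxt \<Gamma> k \<noteq> k \<and> nxt \<Gamma> (nxt \<Gamma> (nxt \<Gamma> k)) = k" if "k \<in> ?S" for k
      using that t assms(1) unfolding jacobi_diagram_def by simp
    have sub: "{a, nxt \<Gamma> a, nxt \<Gamma> (nxt \<Gamma> a)} \<subseteq> ?S" using aS nx by blast
    have d: "distinct [a, nxt \<Gamma> a, nxt \<Gamma> (nxt \<Gamma> a)]" using aS nx by (metis distinct_length_2_or_more distinct_singleton)
    then have "card {a, nxt \<Gamma> a, nxt \<Gamma> (nxt \<Gamma> a)} = 3" by simp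
    then have "{a, nxt \<Gamma> a, nxt \<Gamma> (nxt \<Gamma> a)} = ?S"
      using card_subset_eq[OF fin sub] t by (simp add: trivalent_def valence_def)
    then show ?thesis using hS d by blast
  qed
qed

lemma conf_inject:
  assumes "jacobi_diagram \<Gamma>" "h \<in> halves \<Gamma>" "conf \<Gamma> \<theta> x = conf \<Gamma> \<theta> x'"
  shows "x h = x' h"
proof -
  have v: "vtx \<Gamma> h \<in> verts \<Gamma>" using assms(2) by (simp add: verts_def)
  have eq: "conf \<Gamma> \<theta> x (vtx \<Gamma> h) = conf \<Gamma> \<theta> x' (vtx \<Gamma> h)" by (simp add: assms(3))
  show ?thesis
  proof (cases "vtx \<Gamma> h \<in> univalent \<Gamma>")
    case True
    then show ?thesis
      using eq v jacobi_diagram_half(3)[OF assms(1,2)]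
      by (auto simp: conf_def Let_def two_lines_def vec_eq_iff forall_3 split: if_splits)
  next
    case False
    then show ?thesis
      using eq v jacobi_diagram_half(4)[OF assms(1,2)]
      by (auto simp: conf_def Let_def vec_eq_iff forall_3)
  qed
qed

lemma conf_surj:
  assumes "jacobi_diagram \<Gamma>" "c \<in> extensional (verts \<Gamma>)"
    and "\<And>u. u \<in> univalent \<Gamma> \<Longrightarrow> \<exists>t. c u = two_lines (cos \<theta>, sin \<theta>) (strand_of \<Gamma> u, t)"
  shows "\<exists>x. conf \<Gamma> \<theta> x = c"
proof -
  obtain \<tau> where \<tau>: "\<And>u. u \<in> univalent \<Gamma> \<Longrightarrow> c u = two_lines (cos \<theta>, sin \<theta>) (strand_of \<Gamma> u, \<tau> u)"
    using assms(3) by metis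
  define x where "x h = (let v = vtx \<Gamma> h; a = first_half \<Gamma> v in
     if v \<in> univalent \<Gamma> then \<tau> v else if h = a then c v $ 1 else if h = nxt \<Gamma> a then c v $ 2 else c v $ 3)" for h
  have "conf \<Gamma> \<theta> x v = c v" for v
  proof (cases "v \<in> verts \<Gamma>")
    case True
    then obtain h where h: "h \<in> halves \<Gamma>" "v = vtx \<Gamma> h" by (auto simp: verts_def)
    note H = jacobi_diagram_half[OF assms(1) h(1), folded h(2)]
    show ?thesis
    proof (cases "v \<in> univalent \<Gamma>")
      case True
      then show ?thesis using \<open>v \<in> verts \<Gamma>\<close> H(2) \<tau>
        by (simp add: conf_def x_def Let_def)
    next
      case False
      then have "v \<in> trivalent \<Gamma>" using \<open>v \<in> verts \<Gamma>\<close> assms(1) by (auto simp: jacobi_diagram_def)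
      then have "vtx \<Gamma> (nxt \<Gamma> k) = v \<and> nxt \<Gamma> k \<in> halves \<Gamma>" if "k \<in> halves \<Gamma>" "vtx \<Gamma> k = v" for k
        using that assms(1) unfolding jacobi_diagram_def by blast
      then have "vtx \<Gamma> (nxt \<Gamma> (first_half \<Gamma> v)) = v" "vtx \<Gamma> (nxt \<Gamma> (nxt \<Gamma> (first_half \<Gamma> v))) = v"
        using H(1,2) by blast+
      then show ?thesis using False \<open>v \<in> verts \<Gamma>\<close> H(2) H(4)
        by (auto simp: conf_def x_def Let_def vec_eq_iff forall_3)
    qed
  next
    case False
    then show ?thesis using assms(2) by (simp add: conf_def extensional_def)
  qed
  then show ?thesis by blast
qed

lemma base_half:
  assumes "jacobi_diagram \<Gamma>" "halves \<Gamma> \<noteq> {}"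
  shows "base_half \<Gamma> \<in> halves \<Gamma>" "vtx \<Gamma> (base_half \<Gamma>) \<in> univalent \<Gamma>"
    "first_half \<Gamma> (vtx \<Gamma> (base_half \<Gamma>)) = base_half \<Gamma>"
proof -
  have "univalent \<Gamma> \<noteq> {}"
    using assms by (auto simp: jacobi_diagram_def verts_def)
  then have "{h \<in> halves \<Gamma>. vtx \<Gamma> h \<in> univalent \<Gamma>} \<noteq> {}"
    by (auto simp: univalent_def verts_def)
  moreover have "finite {h \<in> halves \<Gamma>. vtx \<Gamma> h \<in> univalent \<Gamma>}"
    using assms(1) by (simp add: jacobi_diagram_def)
  ultimately have "base_half \<Gamma> \<in> {h \<in> halves \<Gamma>. vtx \<Gamma> h \<in> univalent \<Gamma>}"
    unfolding base_half_def by (metis (no_types, lifting) Min_in)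
  then show *: "base_half \<Gamma> \<in> halves \<Gamma>" "vtx \<Gamma> (base_half \<Gamma>) \<in> univalent \<Gamma>" by auto
  show "first_half \<Gamma> (vtx \<Gamma> (base_half \<Gamma>)) = base_half \<Gamma>"
    using jacobi_diagram_half(3)[OF assms(1) *] by simp
qed

lemma conf_base_height:
  assumes "jacobi_diagram \<Gamma>" "halves \<Gamma> \<noteq> {}"
  shows "conf \<Gamma> \<theta> x (vtx \<Gamma> (base_half \<Gamma>)) $ 3 = 0 \<longleftrightarrow> x (base_half \<Gamma>) = 0"
  using base_half[OF assms] by (simp add: conf_def two_lines_def verts_def Let_def)

lemma vector_00z [simp]: "vector [0, 0, 0] = (0 :: real^3)"
  by (simp add: vec_eq_iff forall_3)

lemma vertical_orbit_translate:
  "vertical_orbit \<Gamma> (\<lambda>v\<in>verts \<Gamma>. c v + vector [0, 0, z]) = vertical_orbit \<Gamma> c"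
proof -
  have add: "vector [0, 0, z] + vector [0, 0, w] = (vector [0, 0, z + w] :: real^3)" for z w :: real
    by (simp add: vec_eq_iff forall_3)
  have "vertical_orbit \<Gamma> (\<lambda>v\<in>verts \<Gamma>. c v + vector [0, 0, z])
      = (\<lambda>w. \<lambda>v\<in>verts \<Gamma>. c v + vector [0, 0, z + w]) ` UNIV"
    unfolding vertical_orbit_def
    by (intro image_cong refl) (auto simp: restrict_def add.assoc add fun_eq_iff)
  also have "\<dots> = (\<lambda>w. \<lambda>v\<in>verts \<Gamma>. c v + vector [0, 0, w]) ` range ((+) z)"
    by (simp only: image_image)
  also have "\<dots> = vertical_orbit \<Gamma> c"
    by (simp add: vertical_orbit_def surj_plus)
  finally show ?thesis .
qed

theorem bij_betw_C_chart:
  assumes "jacobi_diagram \<Gamma>" "halves \<Gamma> \<noteq> {}"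
  shows "bij_betw (C_chart \<Gamma>) (chart_domain \<Gamma>) (C_space \<Gamma>)"
proof -
  define h0 where "h0 = base_half \<Gamma>"
  note h0 = base_half[OF assms, folded h0_def]
  have v0: "vtx \<Gamma> h0 \<in> verts \<Gamma>" using h0(1) by (simp add: verts_def)
  have space: "space (chart_measure \<Gamma>) = UNIV \<times> (halves \<Gamma> - {h0} \<rightarrow>\<^sub>E UNIV)"
    by (simp add: chart_measure_def space_pair_measure space_PiM h0_def)
  have height0: "conf \<Gamma> \<theta> (x(h0 := 0)) (vtx \<Gamma> h0) $ 3 = 0" for \<theta> x
    using conf_base_height[OF assms] by (simp add: h0_def)
  have conf_ext: "conf \<Gamma> \<theta> x = (\<lambda>v\<in>verts \<Gamma>. conf \<Gamma> \<theta> x v)" for \<theta> x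
    unfolding conf_def by (rule ext) simp
  have inj: "inj_on (C_chart \<Gamma>) (space (chart_measure \<Gamma>))"
  proof (rule inj_onI)
    fix y y' assume y: "y \<in> space (chart_measure \<Gamma>)" "y' \<in> space (chart_measure \<Gamma>)"
      and eq: "C_chart \<Gamma> y = C_chart \<Gamma> y'"
    obtain \<theta> x where yx: "y = (\<theta>, x)" by fastforce
    obtain x' where yx': "y' = (\<theta>, x')" using eq yx by (cases y') (simp add: C_chart_def)
    have "conf \<Gamma> \<theta> (x'(h0 := 0)) \<in> vertical_orbit \<Gamma> (conf \<Gamma> \<theta> (x'(h0 := 0)))"
      unfolding vertical_orbit_def
      by (rule image_eqI[of _ _ 0]) (simp_all only: vector_00z add_0_right conf_ext[symmetric] UNIV_I)
    also have "\<dots> = vertical_orbit \<Gamma> (conf \<Gamma> \<theta> (x(h0 := 0)))"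
      using eq by (simp add: yx yx' C_chart_def slice_conf_def h0_def)
    finally obtain z where z: "conf \<Gamma> \<theta> (x'(h0 := 0))
        = (\<lambda>v\<in>verts \<Gamma>. conf \<Gamma> \<theta> (x(h0 := 0)) v + vector [0, 0, z])"
      unfolding vertical_orbit_def by (rule imageE)
    from fun_cong[OF this, of "vtx \<Gamma> h0"] have "z = 0"
      using height0[of \<theta> x] height0[of \<theta> x'] v0 by simp
    with z have "conf \<Gamma> \<theta> (x'(h0 := 0)) = conf \<Gamma> \<theta> (x(h0 := 0))"
      by (simp only: vector_00z add_0_right conf_ext[symmetric])
    then have "(x'(h0 := 0)) h = (x(h0 := 0)) h" if "h \<in> halves \<Gamma>" for h
      using conf_inject[OF assms(1) that] by blast
    then have "x h = x' h" if "h \<in> halves \<Gamma> - {h0}" for h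
      using that by (metis DiffE fun_upd_other insertI1)
    then have "x = x'" using y by (auto simp: space yx yx' intro: PiE_ext)
    then show "y = y'" by (simp add: yx yx')
  qed
  have surj: "C_space \<Gamma> \<subseteq> C_chart \<Gamma> ` space (chart_measure \<Gamma>)"
  proof
    fix q assume "q \<in> C_space \<Gamma>"
    then obtain \<theta> c where q: "q = (\<theta>, vertical_orbit \<Gamma> c)"
        and c: "c \<in> config_space (two_lines (cos \<theta>, sin \<theta>)) \<Gamma>"
      by (auto simp: C_space_def C_theta_def)
    define z where "z = - (c (vtx \<Gamma> h0) $ 3)"
    define c' where "c' = (\<lambda>v\<in>verts \<Gamma>. c v + vector [0, 0, z])"
    have "\<exists>t. c' u = two_lines (cos \<theta>, sin \<theta>) (strand_of \<Gamma> u, t)" if u: "u \<in> univalent \<Gamma>" for u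
    proof -
      obtain j where j: "j \<in> legs \<Gamma>" "\<forall>u\<in>univalent \<Gamma>. c u = two_lines (cos \<theta>, sin \<theta>) (j u)"
        using c by (auto simp: config_space_def)
      have "c u = two_lines (cos \<theta>, sin \<theta>) (strand_of \<Gamma> u, snd (j u))"
        using j u strand_of_eq[OF assms(1) j(1) u] by simp
      moreover have "u \<in> verts \<Gamma>" using u by (simp add: univalent_def)
      ultimately have "c' u = two_lines (cos \<theta>, sin \<theta>)
          (strand_of \<Gamma> u, if strand_of \<Gamma> u = 1 then snd (j u) + z else snd (j u) - z)"
        by (simp add: c'_def two_lines_def vec_eq_iff forall_3)
      then show ?thesis by blast
    qed
    then obtain x where x: "conf \<Gamma> \<theta> x = c'"
      using conf_surj[OF assms(1), of c' \<theta>] by (auto simp: c'_def)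
    have "c' (vtx \<Gamma> h0) $ 3 = 0" using v0 by (simp add: c'_def z_def)
    then have x0: "x h0 = 0" using conf_base_height[OF assms, of \<theta> x] by (simp add: x h0_def)
    define x' where "x' = restrict x (halves \<Gamma> - {h0})"
    have "conf \<Gamma> \<theta> (x'(h0 := 0)) = conf \<Gamma> \<theta> x"
    proof -
      have *: "(x'(h0 := 0)) h = x h" if "h \<in> halves \<Gamma>" for h using that x0 by (simp add: x'_def)
      have "conf \<Gamma> \<theta> (x'(h0 := 0)) v = conf \<Gamma> \<theta> x v" for v
      proof (cases "v \<in> verts \<Gamma>")
        case True
        then obtain h where h: "h \<in> halves \<Gamma>" "v = vtx \<Gamma> h" by (auto simp: verts_def)
        note H = jacobi_diagram_half[OF assms(1) h(1), folded h(2)]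
        show ?thesis
        proof (cases "v \<in> univalent \<Gamma>")
          case True
          then show ?thesis using * H(1) by (simp add: conf_def Let_def)
        next
          case False
          then have "v \<in> trivalent \<Gamma>" using \<open>v \<in> verts \<Gamma>\<close> assms(1) by (auto simp: jacobi_diagram_def)
          then have "vtx \<Gamma> (nxt \<Gamma> k) = v \<and> nxt \<Gamma> k \<in> halves \<Gamma>" if "k \<in> halves \<Gamma>" "vtx \<Gamma> k = v" for k
            using that assms(1) unfolding jacobi_diagram_def by blast
          then show ?thesis using H(1,2) * False by (simp add: conf_def Let_def del: fun_upd_apply)
        qed
      qed (simp add: conf_def)
      then show ?thesis by blast
    qed
    then have "C_chart \<Gamma> (\<theta>, x') = q"
      using x vertical_orbit_translate[of \<Gamma> c z]
      by (simp add: C_chart_def slice_conf_def q c'_def h0_def)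
    moreover have "(\<theta>, x') \<in> space (chart_measure \<Gamma>)" by (simp add: space x'_def)
    ultimately show "q \<in> C_chart \<Gamma> ` space (chart_measure \<Gamma>)" by blast
  qed
  show ?thesis
    unfolding bij_betw_def
  proof
    show "inj_on (C_chart \<Gamma>) (chart_domain \<Gamma>)"
      using inj by (rule inj_on_subset) (auto simp: chart_domain_def)
    show "C_chart \<Gamma> ` chart_domain \<Gamma> = C_space \<Gamma>"
      using surj by (auto simp: chart_domain_def)
  qed
qed


section \<open>The configuration space integral\<close>

text \<open>A list with one half-edge of every edge encodes a total order on the edges and an
  orientation of each edge, the listed half-edge being the origin.\<close>

definition edge_enumeration :: "jdiag \<Rightarrow> nat list \<Rightarrow> bool"
  where "edge_enumeration \<Gamma> es \<longleftrightarrow>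
    distinct es \<and> set es \<inter> opp \<Gamma> ` set es = {} \<and> set es \<union> opp \<Gamma> ` set es = halves \<Gamma>"

definition half_edge_order :: "jdiag \<Rightarrow> nat list \<Rightarrow> nat list"
  where "half_edge_order \<Gamma> es = concat (map (\<lambda>h. [h, opp \<Gamma> h]) es)"

text \<open>\<open>Psi \<Gamma> es c k\<close> is the component of \<open>\<Psi>(c)\<close> at the \<open>k\<close>-th edge. It is invariant under
  vertical translations, so \<open>Psi \<Gamma> es (slice_conf \<Gamma> y)\<close> is the induced map on \<open>C(\<Gamma>)\<close> in the chart.\<close>

definition Psi :: "jdiag \<Rightarrow> nat list \<Rightarrow> (nat \<Rightarrow> real^3) \<Rightarrow> nat \<Rightarrow> real^3"
  where "Psi \<Gamma> es c k = sgn (c (vtx \<Gamma> (opp \<Gamma> (es ! k))) - c (vtx \<Gamma> (es ! k)))"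

text \<open>The form \<open>\<omega>\<close> on the unit sphere (oriented with the outward normal first) at the point \<open>p\<close>.\<close>

definition sphere_form :: "real^3 \<Rightarrow> real^3 \<Rightarrow> real^3 \<Rightarrow> real"
  where "sphere_form p v w = (p \<bullet> cross3 v w) / (4 * pi)"

text \<open>The wedge product of the two-forms \<open>\<eta> 0, \<dots>, \<eta> (m - 1)\<close>, evaluated at \<open>w 0, \<dots>, w (2 m - 1)\<close>.\<close>

definition wedge_two_forms :: "nat \<Rightarrow> (nat \<Rightarrow> 'v \<Rightarrow> 'v \<Rightarrow> real) \<Rightarrow> (nat \<Rightarrow> 'v) \<Rightarrow> real"
  where "wedge_two_forms m \<eta> w =
    (\<Sum>\<pi> | \<pi> permutes {..<2 * m}.
       of_int (sign \<pi>) * (\<Prod>k<m. \<eta> k (w (\<pi> (2 * k))) (w (\<pi> (2 * k + 1))))) / 2 ^ m"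

text \<open>The product volume form on \<open>(S\<^sup>2)\<^sup>m\<close> at the point \<open>p\<close>; tangent vectors are families indexed
  by the factors.\<close>

definition product_sphere_form :: "nat \<Rightarrow> (nat \<Rightarrow> real^3) \<Rightarrow> (nat \<Rightarrow> nat \<Rightarrow> real^3) \<Rightarrow> real"
  where "product_sphere_form m p = wedge_two_forms m (\<lambda>k v w. sphere_form (p k) (v k) (w k))"

definition chart_coordinates :: "jdiag \<Rightarrow> nat list \<Rightarrow> nat list"
  where "chart_coordinates \<Gamma> es = remove1 (base_half \<Gamma>) (half_edge_order \<Gamma> es)"

text \<open>The image under the differential of \<open>\<Psi>\<close> of the chart's coordinate frame: \<open>\<partial>/\<partial>\<theta>\<close> first,
  then the coordinate vectors of the half-edges other than \<open>base_half\<close> in the order of the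
  half-edges.\<close>

definition dPsi :: "jdiag \<Rightarrow> nat list \<Rightarrow> real \<times> (nat \<Rightarrow> real) \<Rightarrow> nat \<Rightarrow> nat \<Rightarrow> real^3"
  where "dPsi \<Gamma> es = (\<lambda>(\<theta>, x) j k. case j of
      0 \<Rightarrow> vector_derivative (\<lambda>r. Psi \<Gamma> es (slice_conf \<Gamma> (r, x)) k) (at \<theta>)
    | Suc j' \<Rightarrow> (let h = chart_coordinates \<Gamma> es ! j' in
        vector_derivative (\<lambda>r. Psi \<Gamma> es (slice_conf \<Gamma> (\<theta>, x(h := r))) k) (at (x h))))"

text \<open>The sign of the frame above for the orientation of \<open>C(\<Gamma>)\<close>. Let \<open>h\<^sub>0\<close> be \<open>base_half\<close>, at
  position \<open>q\<close> (from 0) in the order of the half-edges. The vertical translations act on the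
  coordinate of \<open>h\<^sub>0\<close> with the velocity \<open>\<epsilon> = 1\<close> if \<open>h\<^sub>0\<close> is on strand 1 and \<open>\<epsilon> = -1\<close> if it is on
  strand 2. Hence the frame (translation direction, \<open>\<partial>/\<partial>h\<close> for \<open>h \<noteq> h\<^sub>0\<close> in order) of the space of
  configurations has determinant \<open>\<epsilon> (-1)\<^sup>q\<close>; by (fiber, base) this is the sign of the frame
  (\<open>\<partial>/\<partial>h\<close> for \<open>h \<noteq> h\<^sub>0\<close>) of \<open>C\<^sub>\<theta>(\<Gamma>)\<close>, and by (base, fiber) that of the frame of \<open>C(\<Gamma>)\<close> with \<open>\<partial>/\<partial>\<theta>\<close>
  in front.\<close>

definition chart_sign :: "jdiag \<Rightarrow> nat list \<Rightarrow> real"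
  where "chart_sign \<Gamma> es =
    (if strand_of \<Gamma> (vtx \<Gamma> (base_half \<Gamma>)) = 1 then 1 else - 1)
    * (- 1) ^ length (takeWhile (\<lambda>h. h \<noteq> base_half \<Gamma>) (half_edge_order \<Gamma> es))"

text \<open>The integrals are known to converge absolutely, so the convention that the Lebesgue integral
  of a non-integrable function is 0 never applies.\<close>

definition config_integral :: "jdiag \<Rightarrow> nat list \<Rightarrow> real"
  where "config_integral \<Gamma> es =
    chart_sign \<Gamma> es *
    (LINT y:chart_domain \<Gamma>|chart_measure \<Gamma>.
       product_sphere_form (length es) (Psi \<Gamma> es (slice_conf \<Gamma> y)) (dPsi \<Gamma> es y))"


section \<open>The two-strand anomaly\<close>

text \<open>The product of the integral with the class of the diagram depends neither on the edge
  enumeration nor on the vertex orientation nor on the labels, so arbitrary choices are made here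
  and in the choice of a representative of an isomorphism class below.\<close>

definition anomaly_term :: "jdiag \<Rightarrow> jspace"
  where "anomaly_term \<Gamma> =
    (1 / real (automorphism_count \<Gamma>) * config_integral \<Gamma> (SOME es. edge_enumeration \<Gamma> es))
    *\<^sub>R jclass \<Gamma>"

definition unoriented_iso_rel :: "nat \<Rightarrow> (jdiag \<times> jdiag) set"
  where "unoriented_iso_rel n =
    {(\<Gamma>, \<Gamma>'). \<Gamma> \<in> connected_diagrams n \<and> \<Gamma>' \<in> connected_diagrams n \<and> (\<exists>\<phi>. unoriented_iso \<Gamma> \<Gamma>' \<phi>)}"

text \<open>An element of the product \<open>\<A>({1,2} \<times> \<real>)\<close> of the \<open>\<A>\<^sub>n({1,2} \<times> \<real>)\<close> is given by the sequence
  of its homogeneous parts. There are finitely many isomorphism classes of each degree.\<close>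

definition two_strand_anomaly :: "nat \<Rightarrow> jspace"
  where "two_strand_anomaly n =
    (\<Sum>K \<in> connected_diagrams n // unoriented_iso_rel n. anomaly_term (SOME \<Gamma>. \<Gamma> \<in> K))"

lemma unoriented_iso_rel_refl:
  assumes "\<Gamma> \<in> connected_diagrams n"
  shows "(\<Gamma>, \<Gamma>) \<in> unoriented_iso_rel n"
proof -
  obtain i where "legs \<Gamma> = isotopy_class (univalent \<Gamma>) i"
    using assms by (auto simp: connected_diagrams_def jacobi_diagram_def)
  then have "(\<lambda>u\<in>univalent \<Gamma>. j u) = j" if "j \<in> legs \<Gamma>" for j
    using that by (auto simp: isotopy_class_def PiE_restrict)
  then have "(\<lambda>j. \<lambda>u\<in>univalent \<Gamma>. j (id u)) ` legs \<Gamma> = legs \<Gamma>"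
    by (simp add: image_cong[where g = "\<lambda>j. j"])
  then have "unoriented_iso \<Gamma> \<Gamma> id"
    unfolding unoriented_iso_def
    by (intro conjI exI[of _ id]) simp_all
  then show ?thesis
    using assms by (auto simp: unoriented_iso_rel_def)
qed

lemma two_strand_anomaly_in_diagram_space: "two_strand_anomaly n \<in> diagram_space n"
  unfolding two_strand_anomaly_def diagram_space_def
proof (rule span_sum)
  fix K assume "K \<in> connected_diagrams n // unoriented_iso_rel n"
  then obtain \<Gamma> where \<Gamma>: "\<Gamma> \<in> connected_diagrams n" "K = unoriented_iso_rel n `` {\<Gamma>}"
    by (rule quotientE)
  then have "\<Gamma> \<in> K" using unoriented_iso_rel_refl by blast
  then have "(SOME \<Gamma>. \<Gamma> \<in> K) \<in> K" by (rule someI)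
  then have "(SOME \<Gamma>. \<Gamma> \<in> K) \<in> connected_diagrams n"
    using \<Gamma>(2) by (auto simp: unoriented_iso_rel_def)
  then show "anomaly_term (SOME \<Gamma>. \<Gamma> \<in> K) \<in> span (jclass ` {\<Gamma>. jacobi_diagram \<Gamma> \<and> jdegree \<Gamma> = n})"
    unfolding anomaly_term_def
    by (intro span_scale span_base imageI) (simp add: connected_diagrams_def)
qed

end

theory Submission
  imports Defs
begin


text \<open>Let \<open>s\<close> be a strand with at most two legs. Let the other strand be the vertical axis and let \<open>s\<close>
  pass through the horizontal point \<open>p\<close>. With one coordinate \<open>x h\<close> for every half-edge \<open>h\<close>, the
  vectors along the edges are linear in \<open>(p, x)\<close>, and the form \<open>\<Psi>\<^sup>*(\<Lambda>\<omega>)\<close> sees them only through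
  their directions. Its radical therefore contains the dilations and the vertical translations. For
  \<open>p\<close> on the unit circle its coefficient is the integrand; \<open>config_density\<close> extends this coefficient
  to all \<open>p\<close> homogeneously.

  If \<open>s\<close> carries no leg, the form does not depend on \<open>p\<close>. If it carries one leg, this leg can slide
  along its edge without changing any direction. Either way the radical contains one more direction
  and the form vanishes identically (\<open>config_density_few_legs\<close>).

  If \<open>s\<close> carries the two legs \<open>u\<^sub>1\<close>, \<open>u\<^sub>2\<close>, with neighbours \<open>v\<^sub>1\<close>, \<open>v\<^sub>2\<close>, which are trivalent because
  the diagram is connected and has more than two vertices, replace \<open>u\<^sub>1\<close> by \<open>v\<^sub>1 + v\<^sub>2 - u\<^sub>2\<close> and \<open>u\<^sub>2\<close> by
  \<open>v\<^sub>1 + v\<^sub>2 - u\<^sub>1\<close>. The new legs are again on a vertical line and in the same order. The two edge vectors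
  \<open>v\<^sub>1 - u\<^sub>1\<close> and \<open>v\<^sub>2 - u\<^sub>2\<close> are exchanged and change sign, which does not affect \<open>\<Lambda>\<omega>\<close>: exchanging two
  factors \<open>S\<^sup>2\<close> is even, and the two antipodal maps contribute two signs. On the configurations, however,
  the map reverses the orientation: it is a half-turn in \<open>p\<close> and a reflection in the two heights. So
  the integral is equal to its opposite (\<open>config_density_reflect\<close>, \<open>reflection_integral\<close>).

  The map moves \<open>p\<close> away from the unit circle, so it acts on configurations only up to
  dilation. The integral is therefore rewritten as one over the pairs \<open>(p, x)\<close> with \<open>p\<close> in an annulus
  (\<open>nn_integral_annulus\<close>), and the annulus may be replaced by any other fundamental domain of the
  dilations, by homogeneity (\<open>size_function_irrelevant\<close>). All this is done for the integrals
  of the positive and of the negative part of the integrand, which make sense in \<open>[0, \<infinity>]\<close> without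
  any convergence; they turn out to be equal.

  The statement on the anomaly follows by discarding from the sum the terms with vanishing coefficient.\<close>

section \<open>Wedge products of two-forms\<close>

lemma wedge_two_forms_cong:
  assumes "\<And>k i j. k < m \<Longrightarrow> i < 2 * m \<Longrightarrow> j < 2 * m \<Longrightarrow> \<eta> k (w i) (w j) = \<eta>' k (w' i) (w' j)"
  shows "wedge_two_forms m \<eta> w = wedge_two_forms m \<eta>' w'"
proof -
  have "\<pi> (2 * k) < 2 * m \<and> \<pi> (2 * k + 1) < 2 * m"
    if "\<pi> permutes {..<2 * m}" "k < m" for \<pi> and k :: nat
    using permutes_in_image[OF that(1)] that(2) by simp
  then show ?thesis
    unfolding wedge_two_forms_def using assms
    by (intro arg_cong2[where f = "(/)"] sum.cong prod.cong refl arg_cong2[where f = "(*)"]) auto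
qed

lemma wedge_two_forms_smult:
  "wedge_two_forms m (\<lambda>k v w. c k * \<eta> k v w) f = (\<Prod>k<m. c k) * wedge_two_forms m \<eta> f"
  by (simp add: wedge_two_forms_def prod.distrib sum_distrib_left mult_ac)

lemma wedge_two_forms_comp_permutation:
  assumes \<tau>: "\<tau> permutes {..<2 * m}"
  shows "wedge_two_forms m \<eta> (w \<circ> \<tau>) = of_int (sign \<tau>) * wedge_two_forms m \<eta> w"
proof -
  let ?S = "{\<pi>. \<pi> permutes {..<2 * m}}"
  let ?P = "\<lambda>\<pi>. \<Prod>k<m. \<eta> k (w (\<pi> (2 * k))) (w (\<pi> (2 * k + 1)))"
  have b: "bij_betw ((\<circ>) \<tau>) ?S ?S"
    by (rule bij_betwI[where g = "(\<circ>) (inv \<tau>)"])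
      (use \<tau> in \<open>auto simp: o_assoc permutes_inv_o simp del: fun.map_comp
        intro: permutes_compose permutes_inv\<close>)
  have perm: "permutation \<pi>" if "\<pi> \<in> ?S" for \<pi>
    using that permutation_permutes by blast
  have "(\<Sum>\<pi>\<in>?S. of_int (sign \<pi>) * ?P (\<tau> \<circ> \<pi>))
      = (\<Sum>\<pi>\<in>?S. of_int (sign \<tau>) * (of_int (sign (\<tau> \<circ> \<pi>)) * ?P (\<tau> \<circ> \<pi>)))"
  proof (intro sum.cong refl)
    fix \<pi> assume \<pi>: "\<pi> \<in> ?S"
    have "sign \<tau> * sign (\<tau> \<circ> \<pi>) = sign \<pi>"
      using sign_compose[of \<tau> \<pi>] perm[OF \<pi>] perm[of \<tau>] \<tau> sign_idempotent[of \<tau>]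
      by (simp flip: mult.assoc)
    then have "(of_int (sign \<pi>) :: real) = of_int (sign \<tau>) * of_int (sign (\<tau> \<circ> \<pi>))"
      by (simp flip: of_int_mult)
    then show "of_int (sign \<pi>) * ?P (\<tau> \<circ> \<pi>)
        = of_int (sign \<tau>) * (of_int (sign (\<tau> \<circ> \<pi>)) * ?P (\<tau> \<circ> \<pi>))"
      by simp
  qed
  also have "\<dots> = (\<Sum>\<pi>\<in>?S. of_int (sign \<tau>) * (of_int (sign \<pi>) * ?P \<pi>))"
    using sum.reindex_bij_betw[OF b, of "\<lambda>\<pi>. of_int (sign \<tau>) * (of_int (sign \<pi>) * ?P \<pi>)"]
    by simp
  finally show ?thesis
    by (simp add: wedge_two_forms_def flip: sum_distrib_left)
qed

lemma wedge_two_forms_swap: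
  assumes "i < 2 * m" "j < 2 * m" "i \<noteq> j"
  shows "wedge_two_forms m \<eta> (w(i := w j, j := w i)) = - wedge_two_forms m \<eta> w"
proof -
  have "w(i := w j, j := w i) = w \<circ> Transposition.transpose i j"
    using assms(3) by (auto simp: fun_eq_iff Transposition.transpose_def)
  moreover have "Transposition.transpose i j permutes {..<2 * m}"
    using assms by (intro permutes_swap_id) auto
  ultimately show ?thesis
    using wedge_two_forms_comp_permutation[of "Transposition.transpose i j" m \<eta> w] assms(3)
    by (simp add: sign_swap_id)
qed

text \<open>A repeated argument kills the form because exchanging the two equal arguments both preserves the
  value and changes its sign. It suffices that the two-forms cannot tell the two arguments apart.\<close>

lemma wedge_two_forms_repeated:
  assumes "i < 2 * m" "j < 2 * m" "i \<noteq> j" "\<And>k v. k < m \<Longrightarrow> \<eta> k (w i) v = \<eta> k (w j) v"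
    "\<And>k v. k < m \<Longrightarrow> \<eta> k v (w i) = \<eta> k v (w j)"
  shows "wedge_two_forms m \<eta> w = 0"
proof -
  have "wedge_two_forms m \<eta> w = wedge_two_forms m \<eta> (w(i := w j, j := w i))"
    by (rule wedge_two_forms_cong) (simp add: assms(4,5))
  then show ?thesis
    using wedge_two_forms_swap[OF assms(1-3), of \<eta> w] by simp
qed

text \<open>Relabelling the factors permutes the arguments in blocks of two, and such a permutation is even.\<close>

lemma wedge_two_forms_swap_factors:
  assumes "a < m" "b < m"
  shows "wedge_two_forms m (\<lambda>k. \<eta> (Transposition.transpose a b k)) w = wedge_two_forms m \<eta> w"
proof (cases "a = b")
  case False
  define \<sigma> where "\<sigma> = Transposition.transpose (2 * a) (2 * b) \<circ> Transposition.transpose (2 * a + 1) (2 * b + 1)"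
  have p: "Transposition.transpose (2 * a) (2 * b) permutes {..<2 * m}"
    "Transposition.transpose (2 * a + 1) (2 * b + 1) permutes {..<2 * m}"
    using assms by (auto intro!: permutes_swap_id)
  have \<sigma>: "\<sigma> permutes {..<2 * m}"
    unfolding \<sigma>_def by (rule permutes_compose[OF p(2,1)])
  have "sign \<sigma> = 1"
    unfolding \<sigma>_def using False
    by (subst sign_compose) (auto simp: sign_swap_id permutation_swap_id)
  have \<sigma>k: "\<sigma> (2 * k) = 2 * Transposition.transpose a b k" "\<sigma> (2 * k + 1) = 2 * Transposition.transpose a b k + 1" for k
    using False by (auto simp: \<sigma>_def Transposition.transpose_def dest: arg_cong[where f = even])
  have \<sigma>\<sigma>: "\<sigma> (\<sigma> x) = x" for x
    by (auto simp: \<sigma>_def Transposition.transpose_def split: if_splits dest: arg_cong[where f = even])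
  have \<sigma>\<sigma>': "\<sigma> \<circ> \<sigma> = id" by (simp add: fun_eq_iff \<sigma>\<sigma>)
  let ?S = "{\<pi>. \<pi> permutes {..<2 * m}}"
  let ?P = "\<lambda>\<pi>. \<Prod>k<m. \<eta> k (w (\<pi> (2 * k))) (w (\<pi> (2 * k + 1)))"
  have b: "bij_betw (\<lambda>\<pi>. \<pi> \<circ> \<sigma>) ?S ?S"
    by (rule bij_betwI[where g = "\<lambda>\<pi>. \<pi> \<circ> \<sigma>"])
      (use \<sigma> in \<open>auto simp: o_assoc[symmetric] \<sigma>\<sigma>' simp del: fun.map_comp
        intro: permutes_compose\<close>)
  have tp: "Transposition.transpose a b permutes {..<m}" using assms by (intro permutes_swap_id) auto
  have "(\<Prod>k<m. \<eta> (Transposition.transpose a b k) (w (\<pi> (2 * k))) (w (\<pi> (2 * k + 1)))) = ?P (\<pi> \<circ> \<sigma>)" for \<pi>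
  proof -
    have "?P (\<pi> \<circ> \<sigma>) = (\<Prod>k<m. \<eta> (Transposition.transpose a b k)
        (w ((\<pi> \<circ> \<sigma>) (2 * Transposition.transpose a b k))) (w ((\<pi> \<circ> \<sigma>) (2 * Transposition.transpose a b k + 1))))"
      using prod.permute[OF tp, of "\<lambda>k. \<eta> k (w ((\<pi> \<circ> \<sigma>) (2 * k))) (w ((\<pi> \<circ> \<sigma>) (2 * k + 1)))"]
      by (simp add: o_def)
    then show ?thesis
      using \<sigma>k[of "Transposition.transpose a b _"] by (simp add: o_def)
  qed
  then have "(\<Sum>\<pi>\<in>?S. of_int (sign \<pi>) * (\<Prod>k<m. \<eta> (Transposition.transpose a b k) (w (\<pi> (2 * k))) (w (\<pi> (2 * k + 1)))))
      = (\<Sum>\<pi>\<in>?S. of_int (sign \<pi>) * ?P (\<pi> \<circ> \<sigma>))" by simp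
  also have "\<dots> = (\<Sum>\<pi>\<in>?S. of_int (sign (\<pi> \<circ> \<sigma>)) * ?P (\<pi> \<circ> \<sigma>))"
  proof (intro sum.cong refl)
    fix \<pi> assume "\<pi> \<in> ?S"
    then have "sign (\<pi> \<circ> \<sigma>) = sign \<pi>"
      using sign_compose[of \<pi> \<sigma>] \<sigma> \<open>sign \<sigma> = 1\<close> permutation_permutes by auto
    then show "of_int (sign \<pi>) * ?P (\<pi> \<circ> \<sigma>) = of_int (sign (\<pi> \<circ> \<sigma>)) * ?P (\<pi> \<circ> \<sigma>)" by simp
  qed
  also have "\<dots> = (\<Sum>\<pi>\<in>?S. of_int (sign \<pi>) * ?P \<pi>)"
    using sum.reindex_bij_betw[OF b, of "\<lambda>\<pi>. of_int (sign \<pi>) * ?P \<pi>"] by simp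
  finally show ?thesis
    by (simp add: wedge_two_forms_def)
qed simp

text \<open>Tangent vectors carry no vector space structure here; a vector \<open>z\<close> counts as
  the linear combination \<open>\<Sum>i. a i \<cdot> u i\<close> when all the two-forms treat it as such.\<close>

lemma wedge_two_forms_lincomb:
  assumes j: "j < 2 * m"
    and l: "\<And>k v. k < m \<Longrightarrow> \<eta> k z v = (\<Sum>i\<in>I. a i * \<eta> k (u i) v)"
    and r: "\<And>k v. k < m \<Longrightarrow> \<eta> k v z = (\<Sum>i\<in>I. a i * \<eta> k v (u i))"
  shows "wedge_two_forms m \<eta> (w(j := z)) = (\<Sum>i\<in>I. a i * wedge_two_forms m \<eta> (w(j := u i)))"
proof -
  let ?S = "{\<pi>. \<pi> permutes {..<2 * m}}"
  define P where "P y \<pi> = (\<Prod>k<m. \<eta> k ((w(j := y)) (\<pi> (2 * k))) ((w(j := y)) (\<pi> (2 * k + 1))))" for y \<pi>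
  have *: "P z \<pi> = (\<Sum>i\<in>I. a i * P (u i) \<pi>)" if \<pi>: "\<pi> \<in> ?S" for \<pi>
  proof -
    have inj: "inj \<pi>" using \<pi> permutes_inj by blast
    obtain l where l2: "\<pi> l = j" "l < 2 * m"
      using \<pi> j permutes_inv[of \<pi>] permutes_in_image[of "inv \<pi>" "{..<2*m}" j] permutes_inverses(1)
      by (metis lessThan_iff mem_Collect_eq)
    define k0 where "k0 = l div 2"
    have k0: "k0 < m" using l2 by (simp add: k0_def)
    have l_eq: "l = 2 * k0 \<or> l = 2 * k0 + 1" unfolding k0_def by presburger
    define R where "R = (\<Prod>k\<in>{..<m}-{k0}. \<eta> k (w (\<pi> (2 * k))) (w (\<pi> (2 * k + 1))))"
    have ne: "\<pi> q \<noteq> j" if "q \<noteq> l" for q using inj l2(1) that by (metis injD)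
    have P_eq: "P y \<pi> = \<eta> k0 ((w(j := y)) (\<pi> (2 * k0))) ((w(j := y)) (\<pi> (2 * k0 + 1))) * R" for y
    proof -
      have "\<eta> k ((w(j := y)) (\<pi> (2 * k))) ((w(j := y)) (\<pi> (2 * k + 1)))
          = \<eta> k (w (\<pi> (2 * k))) (w (\<pi> (2 * k + 1)))" if "k \<noteq> k0" for k
        using that l_eq ne[of "2 * k"] ne[of "2 * k + 1"] by (auto simp: k0_def)
      then show ?thesis unfolding P_def R_def
        using k0 by (subst prod.remove[of _ k0]) auto
    qed
    show ?thesis
    proof (cases "l = 2 * k0")
      case True
      then have "\<pi> (2 * k0) = j" "\<pi> (2 * k0 + 1) \<noteq> j" using l2 ne by auto
      then show ?thesis unfolding P_eq using l[OF k0] by (simp add: sum_distrib_right mult.assoc)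
    next
      case False
      then have "\<pi> (2 * k0) \<noteq> j" "\<pi> (2 * k0 + 1) = j" using l2 ne l_eq by auto
      then show ?thesis unfolding P_eq using r[OF k0] by (simp add: sum_distrib_right mult.assoc)
    qed
  qed
  have "(\<Sum>\<pi>\<in>?S. of_int (sign \<pi>) * P z \<pi>) = (\<Sum>\<pi>\<in>?S. \<Sum>i\<in>I. a i * (of_int (sign \<pi>) * P (u i) \<pi>))"
    by (intro sum.cong refl) (simp add: * sum_distrib_left mult_ac)
  also have "\<dots> = (\<Sum>i\<in>I. a i * (\<Sum>\<pi>\<in>?S. of_int (sign \<pi>) * P (u i) \<pi>))"
    by (subst sum.swap) (simp add: sum_distrib_left)
  finally have *: "(\<Sum>\<pi>\<in>?S. of_int (sign \<pi>) * P z \<pi>)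
      = (\<Sum>i\<in>I. a i * (\<Sum>\<pi>\<in>?S. of_int (sign \<pi>) * P (u i) \<pi>))" .
  have W: "wedge_two_forms m \<eta> (w(j := y)) = (\<Sum>\<pi>\<in>?S. of_int (sign \<pi>) * P y \<pi>) / 2 ^ m" for y
    by (simp only: wedge_two_forms_def P_def)
  show ?thesis
    unfolding W * by (simp only: sum_divide_distrib[of _ I] times_divide_eq_right)
qed


section \<open>The pull-back of the sphere form\<close>

text \<open>The pull-back of \<open>sphere_form\<close> under \<open>d \<mapsto> d / norm d\<close>, a two-form on the space of vectors \<open>d\<close>.\<close>

definition dir_form :: "real^3 \<Rightarrow> real^3 \<Rightarrow> real^3 \<Rightarrow> real"
  where "dir_form d v w = (d \<bullet> cross3 v w) / (4 * pi * norm d ^ 3)"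

lemma linear_dir_form: "linear (\<lambda>v. dir_form d v w)" "linear (dir_form d v)"
  by (rule linearI; simp add: dir_form_def cross_add_left cross_add_right cross_mult_left
      cross_mult_right inner_add_right add_divide_distrib)+

lemma dir_form_self [simp]: "dir_form d (c *\<^sub>R d) w = 0" "dir_form d w (c *\<^sub>R d) = 0"
  by (simp_all add: dir_form_def cross_mult_left cross_mult_right dot_cross_self)

lemma dir_form_minus: "dir_form (- d) v w = - dir_form d v w"
  by (simp add: dir_form_def)

lemma dir_form_scale: "c > 0 \<Longrightarrow> dir_form (c *\<^sub>R d) v w = dir_form d v w / c\<^sup>2"
  by (simp add: dir_form_def power_mult_distrib power2_eq_square power3_eq_cube)

text \<open>The vector \<open>T v\<close> is the derivative of \<open>sgn\<close> at \<open>d\<close> in the direction \<open>v\<close>: the component of \<open>v\<close>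
  orthogonal to \<open>d\<close>, divided by the length. The triple product ignores the component that is
  subtracted.\<close>

lemma sphere_form_tangent_part:
  assumes "d \<noteq> 0"
  defines "T \<equiv> \<lambda>v. (v - (sgn d \<bullet> v) *\<^sub>R sgn d) /\<^sub>R norm d"
  shows "sphere_form (sgn d) (T v) (T w) = dir_form d v w"
proof -
  have *: "s \<bullet> cross3 (r *\<^sub>R (v - a *\<^sub>R s)) (r *\<^sub>R (w - b *\<^sub>R s)) = r * r * (s \<bullet> cross3 v w)"
    for a b r and s :: "real^3"
    by (simp add: Cross3.left_diff_distrib Cross3.right_diff_distrib cross_mult_left cross_mult_right
        dot_cross_self inner_diff_right algebra_simps)
  show ?thesis
    unfolding sphere_form_def T_def * dir_form_def
    using assms(1) by (simp add: sgn_div_norm power3_eq_cube field_simps)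
qed

lemma has_vector_derivative_sgn:
  fixes f :: "real \<Rightarrow> real^3"
  assumes f: "(f has_vector_derivative v) (at r)" and nz: "f r \<noteq> 0"
  shows "((\<lambda>r. sgn (f r)) has_vector_derivative (v - (sgn (f r) \<bullet> v) *\<^sub>R sgn (f r)) /\<^sub>R norm (f r)) (at r)"
proof -
  have "((\<lambda>r. norm (f r)) has_derivative (\<lambda>t. (t *\<^sub>R v) \<bullet> sgn (f r))) (at r)"
    using has_derivative_compose[OF f[unfolded has_vector_derivative_def] has_derivative_norm[OF nz]]
    by simp
  moreover have e: "(\<lambda>t. (t *\<^sub>R v) \<bullet> sgn (f r)) = (*) (sgn (f r) \<bullet> v)"
    by (auto simp: fun_eq_iff inner_commute)
  ultimately have n: "((\<lambda>r. norm (f r)) has_real_derivative (sgn (f r) \<bullet> v)) (at r)"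
    by (simp add: has_field_derivative_def e)
  have i: "((\<lambda>r. inverse (norm (f r))) has_real_derivative - ((sgn (f r) \<bullet> v) / (norm (f r))\<^sup>2)) (at r)"
    using DERIV_inverse_fun[OF n] nz by (simp add: field_simps power2_eq_square)
  have "((\<lambda>r. inverse (norm (f r)) *\<^sub>R f r) has_vector_derivative
      inverse (norm (f r)) *\<^sub>R v + (- ((sgn (f r) \<bullet> v) / (norm (f r))\<^sup>2)) *\<^sub>R f r) (at r)"
    by (rule has_vector_derivative_scaleR[OF i f])
  moreover have "inverse (norm (f r)) *\<^sub>R v + (- ((sgn (f r) \<bullet> v) / (norm (f r))\<^sup>2)) *\<^sub>R f r
      = (v - (sgn (f r) \<bullet> v) *\<^sub>R sgn (f r)) /\<^sub>R norm (f r)"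
    by (simp add: sgn_div_norm algebra_simps power2_eq_square divide_inverse)
  moreover have "(\<lambda>r. sgn (f r)) = (\<lambda>r. inverse (norm (f r)) *\<^sub>R f r)"
    by (simp add: sgn_div_norm)
  ultimately show ?thesis by simp
qed


section \<open>Linear coordinates on configurations\<close>

text \<open>The first component is the horizontal position of one strand relative to the other, the second
  one assigns a coordinate to every half-edge.\<close>

type_synonym param = "(real \<times> real) \<times> (nat \<Rightarrow> real)"

definition horizontal :: "real \<times> real \<Rightarrow> real^3"
  where "horizontal p = fst p *\<^sub>R axis 1 1 + snd p *\<^sub>R axis 2 1"

text \<open>The standard basis of the space of parameters. Linear combinations of parameters are written
  out componentwise.\<close>

abbreviation unit_x :: param where "unit_x \<equiv> ((1, 0), \<lambda>_. 0)"
abbreviation unit_y :: param where "unit_y \<equiv> ((0, 1), \<lambda>_. 0)"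
abbreviation unit_half :: "nat \<Rightarrow> param" where "unit_half h \<equiv> ((0, 0), \<lambda>i. if i = h then 1 else 0)"

lemma axis_3_nth [simp]:
  "axis 1 c $ 1 = (c :: real)" "axis 1 c $ (2::3) = 0" "axis 1 c $ (3::3) = 0"
  "axis 2 c $ 2 = c" "axis 2 c $ (1::3) = 0" "axis 2 c $ (3::3) = 0"
  "axis 3 c $ 3 = c" "axis 3 c $ (1::3) = 0" "axis 3 c $ (2::3) = 0"
  by (simp_all add: axis_def)

lemma vec3_eqI: "v $ 1 = w $ 1 \<Longrightarrow> v $ 2 = w $ 2 \<Longrightarrow> v $ 3 = w $ 3 \<Longrightarrow> v = (w :: real^3)"
  by (simp add: vec_eq_iff forall_3)

lemma horizontal_nth [simp]:
  "horizontal p $ 1 = fst p" "horizontal p $ 2 = snd p" "horizontal p $ 3 = 0"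
  by (simp_all add: horizontal_def)

lemma horizontal_0 [simp]: "horizontal (0, 0) = 0"
  by (simp add: horizontal_def)

locale diagram =
  fixes \<Gamma> :: jdiag
  assumes jd: "jacobi_diagram \<Gamma>" and ne: "halves \<Gamma> \<noteq> {}"
begin

abbreviation "H \<equiv> halves \<Gamma>"
abbreviation "U \<equiv> univalent \<Gamma>"
abbreviation "h0 \<equiv> base_half \<Gamma>"
abbreviation "star v \<equiv> {h. h \<in> halves \<Gamma> \<and> vtx \<Gamma> h = v}"

text \<open>The displacement of the vertex of \<open>h\<close> when the coordinate of \<open>h\<close> grows by one.\<close>

definition dirn :: "nat \<Rightarrow> real^3"
  where "dirn h = (let v = vtx \<Gamma> h; a = first_half \<Gamma> v in
     if v \<in> univalent \<Gamma> then (if strand_of \<Gamma> v = 1 then axis 3 1 else - axis 3 1)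
     else if h = a then axis 1 1 else if h = nxt \<Gamma> a then axis 2 1 else axis 3 1)"

text \<open>The strand \<open>s\<close> stands over the point \<open>fst y\<close> and the other strand over the origin, so \<open>s = 2\<close> gives
  the configurations \<open>conf\<close>. Both choices of \<open>s\<close> are kept because a position of the moving strand is
  a coordinate, and the legs to be moved may be on either strand.\<close>

definition place :: "nat \<Rightarrow> param \<Rightarrow> nat \<Rightarrow> real^3"
  where "place s y v = (if v \<in> legs_on \<Gamma> s then horizontal (fst y) else 0)
     + (\<Sum>h | h \<in> halves \<Gamma> \<and> vtx \<Gamma> h = v. snd y h *\<^sub>R dirn h)"

lemma finite_H [simp, intro]: "finite H"
  using jd by (simp add: jacobi_diagram_def)

lemma finite_star [simp, intro]: "finite (star v)"
  using finite_H by (rule finite_subset[rotated]) auto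

lemma verts_cases: "verts \<Gamma> = U \<union> trivalent \<Gamma>" "U \<inter> trivalent \<Gamma> = {}"
  using jd by (auto simp: jacobi_diagram_def univalent_def trivalent_def)

lemma finite_verts [simp, intro]: "finite (verts \<Gamma>)" "finite U"
  by (simp_all add: verts_def univalent_def)

lemma opp_H: "h \<in> H \<Longrightarrow> opp \<Gamma> h \<in> H" "h \<in> H \<Longrightarrow> opp \<Gamma> (opp \<Gamma> h) = h"
    "h \<in> H \<Longrightarrow> vtx \<Gamma> (opp \<Gamma> h) \<noteq> vtx \<Gamma> h"
  using jd by (auto simp: jacobi_diagram_def)

lemma vtx_verts: "h \<in> H \<Longrightarrow> vtx \<Gamma> h \<in> verts \<Gamma>"
  by (simp add: verts_def)

lemma star_univalent:
  assumes "h \<in> H" "vtx \<Gamma> h \<in> U"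
  shows "star (vtx \<Gamma> h) = {h}"
proof -
  have "k = h" if "k \<in> H" "vtx \<Gamma> k = vtx \<Gamma> h" for k
    using jacobi_diagram_half(3)[OF jd that(1)] jacobi_diagram_half(3)[OF jd assms(1)] that(2) assms(2)
    by simp
  then show ?thesis using assms(1) by auto
qed

lemma star_first_half:
  assumes "u \<in> U"
  shows "first_half \<Gamma> u \<in> H" "vtx \<Gamma> (first_half \<Gamma> u) = u" "star u = {first_half \<Gamma> u}"
proof -
  obtain h where h: "h \<in> H" "u = vtx \<Gamma> h" using assms by (auto simp: univalent_def verts_def)
  show "first_half \<Gamma> u \<in> H" "vtx \<Gamma> (first_half \<Gamma> u) = u"
    using jacobi_diagram_half(1,2)[OF jd h(1)] h(2) by auto
  then show "star u = {first_half \<Gamma> u}" using star_univalent[of "first_half \<Gamma> u"] assms by simp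
qed

lemma strand_of_cases:
  assumes "u \<in> U"
  shows "strand_of \<Gamma> u \<in> {1, 2}"
proof -
  obtain i where i: "i \<in> U \<rightarrow>\<^sub>E strands" "legs \<Gamma> = isotopy_class U i" "inj_on i U"
    using jd by (auto simp: jacobi_diagram_def)
  have "homotopic_with (\<lambda>k. inj_on k U) (discrete_topology U) (top_of_set strands) i i"
    using i by (intro homotopic_with_refl[THEN iffD2]) (auto simp: continuous_map_in_subtopology)
  then have "i \<in> legs \<Gamma>" using i by (simp add: isotopy_class_def)
  then show ?thesis
    using strand_of_eq[OF jd _ assms, of i] i(1) assms by (auto simp: strands_def PiE_def Pi_def)
qed

lemma dirn_univalent:
  "vtx \<Gamma> h \<in> U \<Longrightarrow> dirn h = (if strand_of \<Gamma> (vtx \<Gamma> h) = 1 then axis 3 1 else - axis 3 1)"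
  by (simp add: dirn_def Let_def)

lemma trivalent_halves:
  assumes "v \<in> trivalent \<Gamma>"
  obtains a b c where "a = first_half \<Gamma> v" "b = nxt \<Gamma> a" "c = nxt \<Gamma> b"
    "star v = {a, b, c}" "distinct [a, b, c]"
    "dirn a = axis 1 1" "dirn b = axis 2 1" "dirn c = axis 3 1"
proof -
  define a b c where "a = first_half \<Gamma> v" "b = nxt \<Gamma> a" "c = nxt \<Gamma> b"
  note abc = this
  have v: "v \<notin> U" "v \<in> verts \<Gamma>" using assms verts_cases by auto
  then obtain h where h: "h \<in> H" "v = vtx \<Gamma> h" by (auto simp: verts_def)
  note A = jacobi_diagram_half[OF jd h(1), folded h(2)]
  have nx: "nxt \<Gamma> k \<in> star v" if "k \<in> star v" for k
    using that assms jd by (auto simp: jacobi_diagram_def)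
  have "a \<in> star v" using A(1,2) by (simp add: abc)
  then have sub: "{a, b, c} \<subseteq> star v" using nx by (auto simp: abc)
  have sup: "star v \<subseteq> {a, b, c}" using jacobi_diagram_half(4)[OF jd] v by (auto simp: abc)
  have d: "distinct [a, b, c]" using A(4) v by (simp add: abc)
  have "dirn a = axis 1 1" "dirn b = axis 2 1" "dirn c = axis 3 1"
    using sub d v abc by (auto simp: dirn_def Let_def)
  then show thesis using that[OF abc subset_antisym[OF sup sub] d] by blast
qed

text \<open>The displacements at a trivalent vertex form an orthonormal basis, so this is the expansion of
  \<open>q\<close> in that basis.\<close>

lemma sum_dirn_trivalent:
  assumes "v \<in> trivalent \<Gamma>"
  shows "(\<Sum>h\<in>star v. (q \<bullet> dirn h) *\<^sub>R dirn h) = q"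
proof -
  obtain a b c where "star v = {a, b, c}" "distinct [a, b, c]"
    "dirn a = axis 1 1" "dirn b = axis 2 1" "dirn c = axis 3 1"
    by (rule trivalent_halves[OF assms])
  then show ?thesis by (intro vec3_eqI) (simp_all add: inner_axis)
qed

lemma place_univalent:
  assumes "h \<in> H" "vtx \<Gamma> h \<in> U"
  shows "place s y (vtx \<Gamma> h)
    = (if vtx \<Gamma> h \<in> legs_on \<Gamma> s then horizontal (fst y) else 0) + snd y h *\<^sub>R dirn h"
  by (simp add: place_def star_univalent[OF assms])

lemma place_trivalent:
  "v \<in> trivalent \<Gamma> \<Longrightarrow> place s y v = (\<Sum>h\<in>star v. snd y h *\<^sub>R dirn h)"
  using verts_cases by (auto simp: place_def legs_on_def)

text \<open>Adding to every coordinate the component of \<open>q\<close> along its displacement translates the trivalent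
  vertices by \<open>q\<close>, but the legs, which stay on their strands, only by the vertical part of \<open>q\<close>.\<close>

lemma place_shift:
  "place s (p, \<lambda>h. x h + q \<bullet> dirn h) v = place s (p, x) v
    + (if v \<in> trivalent \<Gamma> then q else if v \<in> U then (q $ 3) *\<^sub>R axis 3 1 else 0)"
proof -
  consider "v \<in> trivalent \<Gamma>" | "v \<in> U" "v \<notin> trivalent \<Gamma>" | "v \<notin> verts \<Gamma>" "star v = {}"
    using verts_cases by (auto simp: verts_def)
  then show ?thesis
  proof cases
    case 1
    then show ?thesis
      using sum_dirn_trivalent[OF 1, of q] by (simp add: place_trivalent scaleR_add_left sum.distrib)
  next
    case 2
    note F = star_first_half[OF 2(1)]
    show ?thesis
      using 2 F place_univalent[OF F(1), unfolded F(2)] dirn_univalent[of "first_half \<Gamma> v"]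
      by (simp add: algebra_simps inner_axis)
  next
    case 3
    then show ?thesis using verts_cases unfolding place_def 3(2) by auto
  qed
qed

lemma place_cong: "(\<And>h. h \<in> H \<Longrightarrow> x h = x' h) \<Longrightarrow> place s (p, x) = place s (p, x')"
  by (auto simp: place_def fun_eq_iff intro!: sum.cong)

lemma conf_eq_place:
  assumes "v \<in> verts \<Gamma>"
  shows "conf \<Gamma> \<theta> x v = place 2 ((cos \<theta>, sin \<theta>), x) v"
proof (cases "v \<in> U")
  case True
  note F = star_first_half[OF True]
  show ?thesis
    using assms True F strand_of_cases[OF True] place_univalent[OF F(1), unfolded F(2)]
      dirn_univalent[of "first_half \<Gamma> v"]
    by (intro vec3_eqI) (auto simp: conf_def Let_def two_lines_def legs_on_def)
next
  case False
  then have v: "v \<in> trivalent \<Gamma>" using assms verts_cases by auto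
  obtain a b c where abc: "a = first_half \<Gamma> v" "b = nxt \<Gamma> a" "c = nxt \<Gamma> b"
    "star v = {a, b, c}" "distinct [a, b, c]"
    "dirn a = axis 1 1" "dirn b = axis 2 1" "dirn c = axis 3 1"
    by (rule trivalent_halves[OF v])
  then show ?thesis using assms False
    by (intro vec3_eqI) (simp_all add: place_trivalent[OF v] conf_def Let_def)
qed

lemma place_linear:
  "place s (p, x) v = fst p *\<^sub>R place s unit_x v + snd p *\<^sub>R place s unit_y v
    + (\<Sum>h\<in>H. x h *\<^sub>R place s (unit_half h) v)"
proof -
  have "place s (unit_half h) v = (if h \<in> star v then dirn h else 0)" for h
    by (simp add: place_def if_distrib[of "\<lambda>c. c *\<^sub>R _"] sum.delta if_distribR cong: if_cong)
  then have "(\<Sum>h\<in>H. x h *\<^sub>R place s (unit_half h) v) = (\<Sum>h\<in>H. if h \<in> star v then x h *\<^sub>R dirn h else 0)"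
    by (intro sum.cong refl) auto
  also have "\<dots> = (\<Sum>h\<in>star v. x h *\<^sub>R dirn h)"
    by (simp add: sum.inter_filter[symmetric] flip: sum.inter_filter)
  finally show ?thesis by (simp add: place_def horizontal_def)
qed

end


section \<open>The density of the configuration space integral\<close>

locale enumerated = diagram +
  fixes es :: "nat list"
  assumes en: "edge_enumeration \<Gamma> es"
begin

abbreviation "m \<equiv> length es"
abbreviation "cc \<equiv> chart_coordinates \<Gamma> es"
definition edge_vec :: "nat \<Rightarrow> nat \<Rightarrow> param \<Rightarrow> real^3"
  where "edge_vec s k y =
    place s y (vtx \<Gamma> (opp \<Gamma> (es ! k))) - place s y (vtx \<Gamma> (es ! k))"

text \<open>The form \<open>\<Psi>\<^sup>*(\<Lambda>\<omega>)\<close> at the configuration \<open>y\<close>.\<close>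

definition edge_wedge :: "nat \<Rightarrow> param \<Rightarrow> (nat \<Rightarrow> param) \<Rightarrow> real"
  where "edge_wedge s y = wedge_two_forms (length es)
    (\<lambda>k v w. dir_form (edge_vec s k y) (edge_vec s k v) (edge_vec s k w))"

text \<open>The coordinate frame of the chart of \<open>C(\<Gamma>)\<close>. Its first vector is the rotation of \<open>p\<close> by a right
  angle, which for \<open>p = (cos \<theta>, sin \<theta>)\<close> is the derivative of \<open>p\<close> with respect to \<open>\<theta>\<close>.\<close>

definition chart_frame :: "real \<times> real \<Rightarrow> nat \<Rightarrow> param"
  where "chart_frame p j =
    (case j of 0 \<Rightarrow> ((- snd p, fst p), \<lambda>_. 0) | Suc i \<Rightarrow> unit_half (chart_coordinates \<Gamma> es ! i))"

text \<open>On the space of the pairs \<open>(p, x)\<close> in which the coordinate of \<open>base_half\<close> is zero, the form has one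
  degree less than the volume form and the dilations in its radical, so it is a multiple of the
  contraction of the volume form with the dilation field. On the frame that contraction is
  \<open>(norm p)\<^sup>2\<close>, up to sign. Hence the quotient is the multiple, up to sign, and it makes sense for every
  position of the strand.\<close>

definition config_density :: "nat \<Rightarrow> param \<Rightarrow> real"
  where "config_density s y =
    edge_wedge s y (chart_frame (fst y)) / ((fst (fst y))\<^sup>2 + (snd (fst y))\<^sup>2)"

abbreviation "ev \<equiv> edge_vec"
abbreviation "W \<equiv> edge_wedge"

lemma edge_vec_linear:
  "edge_vec s k (p, x) = fst p *\<^sub>R edge_vec s k unit_x + snd p *\<^sub>R edge_vec s k unit_y
    + (\<Sum>h\<in>H. x h *\<^sub>R edge_vec s k (unit_half h))"
proof -
  have "edge_vec s k (p, x) =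
      (fst p *\<^sub>R place s unit_x (vtx \<Gamma> (opp \<Gamma> (es ! k))) + snd p *\<^sub>R place s unit_y (vtx \<Gamma> (opp \<Gamma> (es ! k)))
        + (\<Sum>h\<in>H. x h *\<^sub>R place s (unit_half h) (vtx \<Gamma> (opp \<Gamma> (es ! k)))))
      - (fst p *\<^sub>R place s unit_x (vtx \<Gamma> (es ! k)) + snd p *\<^sub>R place s unit_y (vtx \<Gamma> (es ! k))
        + (\<Sum>h\<in>H. x h *\<^sub>R place s (unit_half h) (vtx \<Gamma> (es ! k))))"
    unfolding edge_vec_def by (simp only: place_linear[of s p x])
  then show ?thesis
    unfolding edge_vec_def by (simp add: scaleR_diff_right sum_subtractf)
qed

lemma half_edge_order: "distinct (half_edge_order \<Gamma> es)" "set (half_edge_order \<Gamma> es) = H"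
    "length (half_edge_order \<Gamma> es) = 2 * m"
proof -
  have es: "distinct es" "set es \<inter> opp \<Gamma> ` set es = {}" "set es \<union> opp \<Gamma> ` set es = H"
    using en by (auto simp: edge_enumeration_def)
  show s: "set (half_edge_order \<Gamma> es) = H" using es(3) by (auto simp: half_edge_order_def)
  show l: "length (half_edge_order \<Gamma> es) = 2 * m"
    by (simp add: half_edge_order_def length_concat o_def sum_list_triv)
  have "inj_on (opp \<Gamma>) (set es)"
    by (rule inj_on_inverseI[where g = "opp \<Gamma>"]) (use es(3) opp_H in auto)
  then have "card H = 2 * m"
    using card_Un_disjoint[of "set es" "opp \<Gamma> ` set es"] es by (simp add: card_image distinct_card)
  then show "distinct (half_edge_order \<Gamma> es)" using s l by (intro card_distinct) simp
qed

lemma chart_coordinates: "distinct cc" "set cc = H - {h0}" "length cc = 2 * m - 1" "m > 0"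
proof -
  have h: "h0 \<in> H" using base_half[OF jd ne] by simp
  show "distinct cc" "set cc = H - {h0}" "length cc = 2 * m - 1"
    using half_edge_order h
    by (simp_all add: chart_coordinates_def set_remove1_eq distinct_remove1 length_remove1)
  show "m > 0" using half_edge_order h by (cases es) (auto simp: half_edge_order_def)
qed

lemma sum_chart_coordinates: "(\<Sum>h\<in>H - {h0}. f h) = (\<Sum>i<2 * m - 1. f (cc ! i))"
  using sum.reindex_bij_betw[OF bij_betw_nth[OF chart_coordinates(1) refl refl], of f]
    chart_coordinates by simp

lemma frame_0: "chart_frame p 0 = ((- snd p, fst p), \<lambda>_. 0)"
  and frame_Suc: "chart_frame p (Suc i) = unit_half (cc ! i)"
  by (simp_all add: chart_frame_def)

lemma chart_index:
  assumes "h \<in> H - {h0}"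
  shows "\<exists>j. 0 < j \<and> j < 2 * m \<and> cc ! (j - 1) = h"
proof -
  obtain i where "i < length cc" "cc ! i = h"
    using assms chart_coordinates(2) by (metis in_set_conv_nth)
  then show ?thesis using chart_coordinates(3) by (intro exI[of _ "Suc i"]) simp
qed

lemma W_lincomb:
  assumes "j < 2 * m" "\<And>k. k < m \<Longrightarrow> ev s k z = (\<Sum>i\<in>I. a i *\<^sub>R ev s k (u i))"
  shows "W s y (f(j := z)) = (\<Sum>i\<in>I. a i * W s y (f(j := u i)))"
  unfolding edge_wedge_def using assms
  by (intro wedge_two_forms_lincomb)
    (simp_all add: linear_sum[OF linear_dir_form(1)] linear_sum[OF linear_dir_form(2)]
      linear_scale[OF linear_dir_form(1)] linear_scale[OF linear_dir_form(2)])

lemma W_neg: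
  assumes "j < 2 * m" "\<And>k. k < m \<Longrightarrow> ev s k z = - ev s k u"
  shows "W s y (f(j := z)) = - W s y (f(j := u))"
  using W_lincomb[where I = "{()}" and a = "\<lambda>_. - 1" and u = "\<lambda>_. u" and j = j and s = s and z = z] assms by simp

lemma W_two:
  assumes "j < 2 * m" "\<And>k. k < m \<Longrightarrow> ev s k z = a *\<^sub>R ev s k u + b *\<^sub>R ev s k v"
  shows "W s y (f(j := z)) = a * W s y (f(j := u)) + b * W s y (f(j := v))"
  using W_lincomb[where I = "{True, False}" and a = "\<lambda>c. if c then a else b"
      and u = "\<lambda>c. if c then u else v" and j = j and s = s and z = z] assms
  by simp

text \<open>The directions along which no component of \<open>\<Psi>\<close> moves are in the radical of the form.\<close>

lemma W_radical:
  assumes "j < 2 * m" "\<And>k. k < m \<Longrightarrow> \<exists>c. ev s k z = c *\<^sub>R ev s k y"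
  shows "W s y (f(j := z)) = 0"
proof -
  have "dir_form (ev s k y) (ev s k z) v = 0" "dir_form (ev s k y) v (ev s k z) = 0" if "k < m" for k v
    using assms(2)[OF that] by auto
  then show ?thesis
    unfolding edge_wedge_def
    using wedge_two_forms_lincomb[OF assms(1), where z = z and I = "{}"] by simp
qed

lemma W_repeated:
  assumes "i < 2 * m" "j < 2 * m" "i \<noteq> j" "f i = f j"
  shows "W s y f = 0"
  unfolding edge_wedge_def by (rule wedge_two_forms_repeated[OF assms(1-3)]) (simp_all add: assms(4))

text \<open>If \<open>z\<close> is in the radical and is a combination of members of the frame and of one more vector \<open>v\<close>,
  then \<open>v\<close> can replace a member of the frame at the cost of a factor.\<close>

lemma W_exchange:
  assumes j: "j < 2 * m" and I: "I \<subseteq> {..<2 * m} - {j}" and W0: "W s y (f(j := z)) = 0"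
    and z: "\<And>k. k < m \<Longrightarrow> ev s k z = a *\<^sub>R ev s k (f j) + b *\<^sub>R ev s k v + (\<Sum>i\<in>I. c i *\<^sub>R ev s k (f i))"
  shows "a * W s y f = - b * W s y (f(j := v))"
proof -
  have fin: "finite I" using I finite_subset by blast
  define J where "J = insert (2 * m) (insert j I)"
  define u where "u i = (if i = 2 * m then v else f i)" for i
  define d where "d i = (if i = 2 * m then b else if i = j then a else c i)" for i
  have ne: "2 * m \<noteq> j" "2 * m \<notin> I" "j \<notin> I" using j I by auto
  have J: "(\<Sum>i\<in>J. g i) = g (2 * m) + (g j + (\<Sum>i\<in>I. g i))" for g :: "nat \<Rightarrow> 'z::comm_monoid_add"
    unfolding J_def using ne fin by simp
  have "(\<Sum>i\<in>I. d i *\<^sub>R ev s k (u i)) = (\<Sum>i\<in>I. c i *\<^sub>R ev s k (f i))" for k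
    using ne by (intro sum.cong) (auto simp: d_def u_def)
  then have "ev s k z = (\<Sum>i\<in>J. d i *\<^sub>R ev s k (u i))" if "k < m" for k
    using z[OF that] ne by (simp add: J) (simp add: d_def u_def)
  from W_lincomb[OF j this] have "0 = (\<Sum>i\<in>J. d i * W s y (f(j := u i)))"
    using W0 by simp
  moreover have "(\<Sum>i\<in>I. d i * W s y (f(j := u i))) = 0"
  proof (rule sum.neutral, rule ballI)
    fix i assume i: "i \<in> I"
    then have "W s y (f(j := u i)) = 0"
      using I j ne by (intro W_repeated[of i j]) (auto simp: u_def)
    then show "d i * W s y (f(j := u i)) = 0" by simp
  qed
  ultimately have "0 = d (2 * m) * W s y (f(j := u (2 * m))) + d j * W s y (f(j := u j))"
    by (simp only: J add_0_right)
  then show ?thesis using ne by (simp add: d_def u_def)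
qed

text \<open>Adding combinations of a fixed part \<open>Q\<close> of the frame to the other members is a unimodular change
  of frame.\<close>

lemma W_shear:
  assumes Q: "Q \<subseteq> {..<2 * m}" and eq: "\<And>i. i \<in> Q \<Longrightarrow> g i = f i"
    and g: "\<And>j k. j < 2 * m \<Longrightarrow> j \<notin> Q \<Longrightarrow> k < m \<Longrightarrow>
      ev s k (g j) = ev s k (f j) + (\<Sum>i\<in>Q. a j i *\<^sub>R ev s k (f i))"
  shows "W s y g = W s y f"
proof -
  have finQ: "finite Q" using Q finite_subset by blast
  have "W s y (\<lambda>j. if j \<in> J then g j else f j) = W s y f" if "J \<subseteq> {..<2 * m} - Q" for J
    using finite_subset[OF that, simplified] that
  proof (induction J rule: finite_induct)
    case (insert j J)
    let ?f = "\<lambda>j. if j \<in> J then g j else f j"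
    have j: "j < 2 * m" "j \<notin> Q" using insert.prems by auto
    have eqf: "(\<lambda>i. if i \<in> insert j J then g i else f i) = ?f(j := g j)" by auto
    define d where "d i = (if i = j then 1 else a j i)" for i
    have "(\<Sum>i\<in>Q. d i *\<^sub>R ev s k (f i)) = (\<Sum>i\<in>Q. a j i *\<^sub>R ev s k (f i))" for k
      using j by (intro sum.cong) (auto simp: d_def)
    then have "ev s k (g j) = (\<Sum>i\<in>insert j Q. d i *\<^sub>R ev s k (f i))" if "k < m" for k
      using g[OF j that] j finQ by (simp add: d_def)
    from W_lincomb[OF j(1) this]
    have "W s y (?f(j := g j)) = (\<Sum>i\<in>insert j Q. d i * W s y (?f(j := f i)))" .
    also have "\<dots> = W s y (?f(j := f j)) + (\<Sum>i\<in>Q. d i * W s y (?f(j := f i)))"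
      using j finQ by (simp add: d_def)
    also have "(\<Sum>i\<in>Q. d i * W s y (?f(j := f i))) = 0"
    proof (rule sum.neutral, rule ballI)
      fix i assume i: "i \<in> Q"
      then have "i \<notin> J" "i \<noteq> j" "i < 2 * m" using insert.prems j Q by auto
      then have "W s y (?f(j := f i)) = 0" using j by (intro W_repeated[of i j]) auto
      then show "d i * W s y (?f(j := f i)) = 0" by simp
    qed
    also have "?f(j := f j) = ?f" using insert.hyps by auto
    finally show ?case
      using insert.IH insert.prems by (simp only: eqf add_0_right insert_subset)
  qed simp
  from this[of "{..<2 * m} - Q"]
  have "W s y f = W s y (\<lambda>j. if j \<in> {..<2 * m} - Q then g j else f j)" by simp
  also have "\<dots> = W s y g"
    unfolding edge_wedge_def by (rule wedge_two_forms_cong) (auto simp: eq)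
  finally show ?thesis by simp
qed

lemma ev_frame_sum:
  assumes "\<rho> h0 = 0"
  shows "ev s k ((- c * snd p, c * fst p), \<rho>)
    = (\<Sum>j<2 * m. (case j of 0 \<Rightarrow> c | Suc i \<Rightarrow> \<rho> (cc ! i)) *\<^sub>R ev s k (chart_frame p j))"
proof -
  have "{..<2 * m} = {..<Suc (2 * m - 1)}" using chart_coordinates(4) by auto
  then have "(\<Sum>j<2 * m. (case j of 0 \<Rightarrow> c | Suc i \<Rightarrow> \<rho> (cc ! i)) *\<^sub>R ev s k (chart_frame p j))
      = c *\<^sub>R ev s k (chart_frame p 0) + (\<Sum>i<2 * m - 1. \<rho> (cc ! i) *\<^sub>R ev s k (unit_half (cc ! i)))"
    by (simp only: sum.lessThan_Suc_shift frame_Suc nat.case)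
  also have "(\<Sum>i<2 * m - 1. \<rho> (cc ! i) *\<^sub>R ev s k (unit_half (cc ! i)))
      = (\<Sum>h\<in>H - {h0}. \<rho> h *\<^sub>R ev s k (unit_half h))"
    by (rule sum_chart_coordinates[symmetric])
  also have "\<dots> = (\<Sum>h\<in>H. \<rho> h *\<^sub>R ev s k (unit_half h))"
    using base_half(1)[OF jd ne] assms by (simp add: sum.remove[of H h0])
  finally have f: "(\<Sum>j<2 * m. (case j of 0 \<Rightarrow> c | Suc i \<Rightarrow> \<rho> (cc ! i)) *\<^sub>R ev s k (chart_frame p j))
      = c *\<^sub>R ev s k (chart_frame p 0) + (\<Sum>h\<in>H. \<rho> h *\<^sub>R ev s k (unit_half h))" .
  have e1: "ev s k ((- c * snd p, c * fst p), \<rho>) = (- c * snd p) *\<^sub>R ev s k unit_x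
      + (c * fst p) *\<^sub>R ev s k unit_y + (\<Sum>h\<in>H. \<rho> h *\<^sub>R ev s k (unit_half h))"
    using edge_vec_linear[of s k "(- c * snd p, c * fst p)" \<rho>] by simp
  have e2: "ev s k (chart_frame p 0) = (- snd p) *\<^sub>R ev s k unit_x + fst p *\<^sub>R ev s k unit_y"
    using edge_vec_linear[of s k "(- snd p, fst p)" "\<lambda>_. 0"] by (simp add: frame_0)
  show ?thesis unfolding f e1 e2 by (simp add: scaleR_add_right scaleR_diff_right)
qed

lemma ev_scale: "ev s k ((c * a, c * b), \<lambda>h. c * x h) = c *\<^sub>R ev s k ((a, b), x)"
  by (simp add: edge_vec_linear[of s k _ "\<lambda>h. c * x h"] edge_vec_linear[of s k _ x]
      scaleR_add_right scaleR_sum_right)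

lemma ev_add: "ev s k ((a + a', b + b'), \<lambda>h. x h + x' h) = ev s k ((a, b), x) + ev s k ((a', b'), x')"
  by (simp add: edge_vec_linear[of s k _ "\<lambda>h. x h + x' h"] edge_vec_linear[of s k _ x]
      edge_vec_linear[of s k _ x'] scaleR_add_left sum.distrib)

lemma es_nth_H: "k < m \<Longrightarrow> es ! k \<in> H" "k < m \<Longrightarrow> opp \<Gamma> (es ! k) \<in> H"
  using en by (auto simp: edge_enumeration_def)

lemma edge_index:
  assumes "h \<in> H"
  obtains k where "k < m" "es ! k = h \<or> es ! k = opp \<Gamma> h \<and> es ! k \<noteq> h"
proof -
  have "h \<in> set es \<or> h \<in> opp \<Gamma> ` set es" using en assms by (auto simp: edge_enumeration_def)
  then show thesis
  proof
    assume "h \<in> set es"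
    then show thesis using that by (metis in_set_conv_nth)
  next
    assume "h \<in> opp \<Gamma> ` set es"
    then obtain g where g: "g \<in> set es" "h = opp \<Gamma> g" by auto
    then obtain k where k: "k < m" "es ! k = g" by (metis in_set_conv_nth)
    have "g = opp \<Gamma> h" "g \<noteq> h" using g k es_nth_H(1)[OF k(1)] opp_H(2)[of g] opp_H(3)[of g] by auto
    then show thesis using that k by auto
  qed
qed

text \<open>Each of the \<open>m\<close> two-forms is homogeneous of degree \<open>-2\<close> in the configuration, the first vector of
  the frame has degree 1, and the denominator has degree 2.\<close>

lemma config_density_scale:
  assumes r: "r > 0"
  shows "config_density s ((r * a, r * b), \<lambda>h. r * x h) = config_density s ((a, b), x) / r ^ (2 * m + 1)"
proof -
  let ?y = "((r * a, r * b), \<lambda>h. r * x h)" and ?fr = "chart_frame (a, b)"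
  have e: "W s ?y f = (\<Prod>k<m. 1 / r\<^sup>2) * W s ((a, b), x) f" for f
    unfolding edge_wedge_def ev_scale dir_form_scale[OF r] wedge_two_forms_smult[symmetric] by simp
  have "chart_frame (r * a, r * b) = ?fr(0 := ((r * - b, r * a), \<lambda>_. r * 0))"
    by (auto simp: chart_frame_def fun_eq_iff split: nat.split)
  then have "W s ?y (chart_frame (r * a, r * b))
      = (\<Sum>i\<in>{()}. r * W s ?y (?fr(0 := ((- b, a), \<lambda>_. 0))))"
    using chart_coordinates(4) by (simp only:, intro W_lincomb) (simp_all only: ev_scale, simp_all)
  also have "?fr(0 := ((- b, a), \<lambda>_. 0)) = ?fr"
    by (auto simp: chart_frame_def fun_eq_iff split: nat.split)
  finally have W: "W s ?y (chart_frame (r * a, r * b)) = r * ((\<Prod>k<m. 1 / r\<^sup>2) * W s ((a, b), x) ?fr)"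
    by (simp only: e) simp
  have "r * ((1 / r\<^sup>2) ^ m * w) / (r\<^sup>2 * d) = w / d / r ^ (2 * m + 1)" for w d
    using r by (cases "d = 0") (simp_all add: field_simps power_mult power2_eq_square)
  from this[of "W s ((a, b), x) ?fr" "a\<^sup>2 + b\<^sup>2"] show ?thesis
    by (simp add: config_density_def W power_mult_distrib distrib_left)
qed

lemma config_density_translate:
  "config_density s (p, \<lambda>h. x h + \<tau> * (axis 3 1 \<bullet> dirn h)) = config_density s (p, x)"
proof -
  have pl: "place s (p, \<lambda>h. x h + \<tau> * (axis 3 1 \<bullet> dirn h)) v = place s (p, x) v + \<tau> *\<^sub>R axis 3 1"
    if "v \<in> verts \<Gamma>" for v
    using place_shift[of s p x "\<tau> *\<^sub>R axis 3 1" v] that verts_cases by auto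
  have "ev s k (p, \<lambda>h. x h + \<tau> * (axis 3 1 \<bullet> dirn h)) = ev s k (p, x)" if "k < m" for k
    using es_nth_H[OF that] by (simp add: edge_vec_def pl vtx_verts)
  then have "W s (p, \<lambda>h. x h + \<tau> * (axis 3 1 \<bullet> dirn h)) f = W s (p, x) f" for f
    unfolding edge_wedge_def by (intro wedge_two_forms_cong) simp
  then show ?thesis by (simp add: config_density_def)
qed

lemma config_density_cong: "(\<And>h. h \<in> H \<Longrightarrow> x h = x' h) \<Longrightarrow> config_density s (p, x) = config_density s (p, x')"
  using place_cong[of x x' s p] by (simp add: config_density_def edge_wedge_def edge_vec_def)

lemma place_other_strand:
  assumes "v \<in> verts \<Gamma>"
  shows "place 2 ((a, b), x) v
    = place 1 ((- a, - b), \<lambda>h. x h - horizontal (a, b) \<bullet> dirn h) v + horizontal (a, b)"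
proof -
  have *: "place 1 ((- a, - b), \<lambda>h. x h - horizontal (a, b) \<bullet> dirn h) v = place 1 ((- a, - b), x) v
      + (if v \<in> trivalent \<Gamma> then - horizontal (a, b) else 0)"
    using place_shift[of 1 "(- a, - b)" x "- horizontal (a, b)" v] by simp
  have m: "horizontal (- a, - b) = - horizontal (a, b)" by (simp add: horizontal_def)
  have "v \<in> U \<Longrightarrow> v \<in> legs_on \<Gamma> 1 \<longleftrightarrow> v \<notin> legs_on \<Gamma> 2"
    using strand_of_cases[of v] by (auto simp: legs_on_def)
  moreover have "v \<in> legs_on \<Gamma> s \<Longrightarrow> v \<in> U" for s by (simp add: legs_on_def)
  ultimately show ?thesis
    unfolding * using verts_cases assms by (auto simp: place_def m)
qed

text \<open>The two descriptions differ by the horizontal translation that brings the strand 2 back to the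
  origin. It carries the motion of the strand 2 to the opposite motion of the strand 1, up to a
  motion of trivalent vertices, which the other vectors of the frame absorb.\<close>

lemma config_density_other_strand:
  "config_density 2 ((a, b), x) = config_density 1 ((- a, - b), \<lambda>h. x h - horizontal (a, b) \<bullet> dirn h)"
proof -
  let ?y = "((a, b), x)" and ?y' = "((- a, - b), \<lambda>h. x h - horizontal (a, b) \<bullet> dirn h)"
  let ?fr = "chart_frame (a, b)" and ?fr' = "chart_frame (- a, - b)"
  have e: "ev 2 k ((a, b), x) = ev 1 k ((- a, - b), \<lambda>h. x h - horizontal (a, b) \<bullet> dirn h)"
    if "k < m" for k a b x
    using es_nth_H[OF that] by (simp add: edge_vec_def place_other_strand[OF vtx_verts])
  define z :: param where "z = ((b, - a), \<lambda>h. 0 - horizontal (- b, a) \<bullet> dirn h)"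
  have ez: "ev 2 k (?fr 0) = ev 1 k z" if "k < m" for k
    using e[OF that, of "- b" a "\<lambda>_. 0"] by (simp add: frame_0 z_def)
  have eS: "ev 2 k (?fr (Suc i)) = ev 1 k (?fr' (Suc i))" if "k < m" for k i
    using e[OF that, of 0 0] by (simp add: frame_Suc)
  have "W 2 ?y ?fr = W 1 ?y' (?fr'(0 := z))"
    unfolding edge_wedge_def
  proof (rule wedge_two_forms_cong)
    fix k i j assume "k < m"
    have *: "ev 2 k (?fr i) = ev 1 k ((?fr'(0 := z)) i)" for i
      using ez[OF \<open>k < m\<close>] eS[OF \<open>k < m\<close>] by (cases i) auto
    show "dir_form (ev 2 k ?y) (ev 2 k (?fr i)) (ev 2 k (?fr j))
      = dir_form (ev 1 k ?y') (ev 1 k ((?fr'(0 := z)) i)) (ev 1 k ((?fr'(0 := z)) j))"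
      unfolding * e[OF \<open>k < m\<close>] ..
  qed
  also have "\<dots> = (\<Sum>j<2 * m. (case j of 0 \<Rightarrow> 1 | Suc i \<Rightarrow> snd z (cc ! i)) * W 1 ?y' (?fr'(0 := ?fr' j)))"
  proof (rule W_lincomb)
    have "snd z h0 = 0"
      using base_half[OF jd ne] dirn_univalent[of h0] by (auto simp: z_def horizontal_def inner_axis' inner_axis)
    note ev_frame_sum[where \<rho> = "snd z", OF this, of 1 _ 1 "(- a, - b)"]
    then show "ev 1 k z = (\<Sum>j<2 * m. (case j of 0 \<Rightarrow> 1 | Suc i \<Rightarrow> snd z (cc ! i)) *\<^sub>R ev 1 k (?fr' j))" for k
      by (simp add: z_def)
  qed (use chart_coordinates(4) in simp)
  also have "\<dots> = (\<Sum>j\<in>{0}. W 1 ?y' (?fr'(0 := ?fr' j)))"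
  proof (rule sum.mono_neutral_cong_right)
    show "\<forall>j\<in>{..<2 * m} - {0}. (case j of 0 \<Rightarrow> 1 | Suc i \<Rightarrow> snd z (cc ! i)) * W 1 ?y' (?fr'(0 := ?fr' j)) = 0"
    proof
      fix j assume "j \<in> {..<2 * m} - {0}"
      then have "W 1 ?y' (?fr'(0 := ?fr' j)) = 0" by (intro W_repeated[of 0 j]) auto
      then show "(case j of 0 \<Rightarrow> 1 | Suc i \<Rightarrow> snd z (cc ! i)) * W 1 ?y' (?fr'(0 := ?fr' j)) = 0" by simp
    qed
  qed (use chart_coordinates(4) in auto)
  finally show ?thesis by (simp add: config_density_def)
qed

end


section \<open>The integrand in the chart\<close>

context enumerated begin

lemma slice_conf_eq_place:
  "v \<in> verts \<Gamma> \<Longrightarrow> slice_conf \<Gamma> (\<theta>, x) v = place 2 ((cos \<theta>, sin \<theta>), x(h0 := 0)) v"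
  by (simp add: slice_conf_def conf_eq_place)

text \<open>In the chart every component of \<open>\<Psi>\<close> is a normalised vector, and the vector is affine in
  \<open>cos \<theta>\<close>, \<open>sin \<theta>\<close> and each of the other coordinates.\<close>

lemma dPsi_chart:
  assumes inj: "inj_on (slice_conf \<Gamma> (\<theta>, x)) (verts \<Gamma>)" and j: "j < 2 * m" and k: "k < m"
  defines "y \<equiv> ((cos \<theta>, sin \<theta>), x(h0 := 0))"
  defines "d \<equiv> ev 2 k y" and "w \<equiv> ev 2 k (chart_frame (cos \<theta>, sin \<theta>) j)"
  shows "Psi \<Gamma> es (slice_conf \<Gamma> (\<theta>, x)) k = sgn d" "d \<noteq> 0"
    "dPsi \<Gamma> es (\<theta>, x) j k = (w - (sgn d \<bullet> w) *\<^sub>R sgn d) /\<^sub>R norm d"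
proof -
  note H = es_nth_H[OF k, THEN vtx_verts]
  have P: "Psi \<Gamma> es (slice_conf \<Gamma> (\<theta>', x')) k = sgn (ev 2 k ((cos \<theta>', sin \<theta>'), x'(h0 := 0)))" for \<theta>' x'
    by (simp add: Psi_def edge_vec_def slice_conf_eq_place H)
  show "Psi \<Gamma> es (slice_conf \<Gamma> (\<theta>, x)) k = sgn d"
    by (simp add: P d_def y_def)
  show nz: "d \<noteq> 0"
    using inj_onD[OF inj _ H(2) H(1)] opp_H(3)[OF es_nth_H(1)[OF k]] H
    by (auto simp: d_def y_def edge_vec_def slice_conf_eq_place)
  show "dPsi \<Gamma> es (\<theta>, x) j k = (w - (sgn d \<bullet> w) *\<^sub>R sgn d) /\<^sub>R norm d"
  proof (cases j)
    case 0
    have "((\<lambda>r. cos r *\<^sub>R ev 2 k unit_x + sin r *\<^sub>R ev 2 k unit_y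
          + (\<Sum>h\<in>H. (x(h0 := 0)) h *\<^sub>R ev 2 k (unit_half h))) has_vector_derivative
        (- sin \<theta>) *\<^sub>R ev 2 k unit_x + cos \<theta> *\<^sub>R ev 2 k unit_y) (at \<theta>)"
      by (auto intro!: derivative_eq_intros)
    moreover have "w = (- sin \<theta>) *\<^sub>R ev 2 k unit_x + cos \<theta> *\<^sub>R ev 2 k unit_y"
      using edge_vec_linear[of 2 k "(- sin \<theta>, cos \<theta>)" "\<lambda>_. 0"] by (simp add: w_def frame_0 0)
    ultimately have "((\<lambda>r. ev 2 k ((cos r, sin r), x(h0 := 0))) has_vector_derivative w) (at \<theta>)"
      by (simp only: edge_vec_linear[of 2 k _ "x(h0 := 0)"] fst_conv snd_conv)
    from has_vector_derivative_sgn[OF this] nz show ?thesis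
      by (simp add: 0 dPsi_def P vector_derivative_at d_def y_def)
  next
    case (Suc i)
    define h where "h = cc ! i"
    have i: "i < length cc" using Suc j chart_coordinates(3) by simp
    then have h: "h \<in> H" "h \<noteq> h0" using nth_mem[OF i] chart_coordinates(2) by (auto simp: h_def)
    have e: "ev 2 k ((cos \<theta>, sin \<theta>), (x(h := r))(h0 := 0)) = ev 2 k ((cos \<theta>, sin \<theta>), x(h := 0, h0 := 0))
        + r *\<^sub>R w" for r
    proof -
      have "(x(h := r))(h0 := 0) = (\<lambda>i. (x(h := 0, h0 := 0)) i + r * (if i = h then 1 else 0))"
        using h by (auto simp: fun_eq_iff)
      then show ?thesis
        using ev_add[of 2 k "cos \<theta>" 0 "sin \<theta>" 0 "x(h := 0, h0 := 0)" "\<lambda>i. r * (if i = h then 1 else 0)"]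
          ev_scale[of 2 k r 0 0 "\<lambda>i. if i = h then 1 else 0"]
        by (simp add: w_def Suc frame_Suc h_def)
    qed
    have *: "((\<lambda>r. ev 2 k ((cos \<theta>, sin \<theta>), (x(h := r))(h0 := 0))) has_vector_derivative w) (at (x h))"
      by (subst ext[where f = "\<lambda>r. ev 2 k ((cos \<theta>, sin \<theta>), (x(h := r))(h0 := 0))", OF e])
        (auto intro!: derivative_eq_intros)
    have "(\<lambda>r. ev 2 k ((cos \<theta>, sin \<theta>), (x(h := r))(h0 := 0))) (x h) = d"
      by (simp add: d_def y_def)
    with has_vector_derivative_sgn[OF *] nz show ?thesis
      by (simp add: Suc dPsi_def P vector_derivative_at Let_def flip: h_def)
  qed
qed

lemma integrand_eq_config_density:
  assumes "inj_on (slice_conf \<Gamma> (\<theta>, x)) (verts \<Gamma>)"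
  shows "product_sphere_form m (Psi \<Gamma> es (slice_conf \<Gamma> (\<theta>, x))) (dPsi \<Gamma> es (\<theta>, x))
    = config_density 2 ((cos \<theta>, sin \<theta>), x(h0 := 0))"
proof -
  have "product_sphere_form m (Psi \<Gamma> es (slice_conf \<Gamma> (\<theta>, x))) (dPsi \<Gamma> es (\<theta>, x))
      = W 2 ((cos \<theta>, sin \<theta>), x(h0 := 0)) (chart_frame (cos \<theta>, sin \<theta>))"
    unfolding product_sphere_form_def edge_wedge_def
  proof (rule wedge_two_forms_cong)
    fix k i j assume "k < m" "i < 2 * m" "j < 2 * m"
    then show "sphere_form (Psi \<Gamma> es (slice_conf \<Gamma> (\<theta>, x)) k) (dPsi \<Gamma> es (\<theta>, x) i k) (dPsi \<Gamma> es (\<theta>, x) j k)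
      = dir_form (ev 2 k ((cos \<theta>, sin \<theta>), x(h0 := 0))) (ev 2 k (chart_frame (cos \<theta>, sin \<theta>) i))
          (ev 2 k (chart_frame (cos \<theta>, sin \<theta>) j))"
      using dPsi_chart[OF assms, of i k] dPsi_chart[OF assms, of j k]
      by (simp add: sphere_form_tangent_part)
  qed
  then show ?thesis by (simp add: config_density_def)
qed

section \<open>Strands with at most one leg\<close>

text \<open>A nonzero value of the form on a frame forces the frame to be independent modulo the radical.\<close>

lemma no_radical_combination:
  assumes W: "W s y f \<noteq> 0" and j: "j < 2 * m"
    and rad: "\<And>k. k < m \<Longrightarrow> \<exists>c. ev s k z = c *\<^sub>R ev s k y"
    and z: "\<And>k. k < m \<Longrightarrow> ev s k z = (\<Sum>i<2 * m. a i *\<^sub>R ev s k (f i))"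
  shows "a j = 0"
proof -
  have "a j * W s y f = - 0 * W s y (f(j := f j))"
  proof (rule W_exchange[where I = "{..<2 * m} - {j}", OF j order_refl W_radical[OF j rad]])
    show "ev s k z = a j *\<^sub>R ev s k (f j) + 0 *\<^sub>R ev s k (f j) + (\<Sum>i\<in>{..<2 * m} - {j}. a i *\<^sub>R ev s k (f i))"
      if "k < m" for k
      using z[OF that] j by (simp add: sum.remove[of _ j])
  qed
  then show ?thesis using W by simp
qed

text \<open>With no leg on the moving strand, \<open>\<Psi>\<close> does not depend on the position of the strand. With
  one leg, that leg may slide along its edge without changing \<open>\<Psi>\<close>; combined with a dilation and a
  vertical translation this is a direction in the chart along which \<open>\<Psi>\<close> is constant.\<close>

lemma config_density_few_legs:
  assumes few: "card (legs_on \<Gamma> s) < 2" and many: "card (verts \<Gamma>) > 2"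
    and inj: "inj_on (place s y) (verts \<Gamma>)"
  shows "config_density s y = 0"
proof (rule ccontr)
  define p where "p = fst y"
  define x where "x = snd y"
  have y: "y = (p, x)" by (simp add: p_def x_def)
  define n2 where "n2 = (fst p)\<^sup>2 + (snd p)\<^sup>2"
  let ?fr = "chart_frame p"
  assume "config_density s y \<noteq> 0"
  then have W: "W s y ?fr \<noteq> 0" and n2: "n2 \<noteq> 0"
    by (auto simp: config_density_def n2_def y)
  have finlegs: "finite (legs_on \<Gamma> s)" by (simp add: legs_on_def)
  have legsU: "legs_on \<Gamma> s \<subseteq> U" by (auto simp: legs_on_def)
  consider "legs_on \<Gamma> s = {}" | u where "legs_on \<Gamma> s = {u}"
  proof -
    have "card (legs_on \<Gamma> s) = 0 \<or> card (legs_on \<Gamma> s) = 1" using few by auto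
    then show thesis using that finlegs by (metis card_0_eq card_1_singletonE)
  qed
  then show False
  proof cases
    case 1
    then have "ev s k (?fr 0) = 0 *\<^sub>R ev s k y" for k
      by (simp add: frame_0 edge_vec_def place_def)
    then have "W s y (?fr(0 := ?fr 0)) = 0"
      using chart_coordinates(4) by (intro W_radical) (simp, rule exI[of _ 0], simp)
    then show False using W by simp
  next
    case 2
    then have u: "u \<in> U" using legsU by auto
    define l where "l = first_half \<Gamma> u"
    note l = star_first_half[OF u, folded l_def]
    define v where "v = vtx \<Gamma> (opp \<Gamma> l)"
    have v: "v \<in> verts \<Gamma>" "v \<noteq> u" "u \<in> verts \<Gamma>"
      using l opp_H[OF l(1)] vtx_verts by (auto simp: v_def)
    define d where "d = place s y v - place s y u"
    have d: "d \<noteq> 0" using inj_onD[OF inj _ v(1,3)] v(2) by (auto simp: d_def)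
    have dl: "dirn l \<bullet> axis 3 1 * (dirn l \<bullet> axis 3 1) = 1" "dirn l = (dirn l \<bullet> axis 3 1) *\<^sub>R axis 3 1"
      using dirn_univalent[of l] l u by (auto simp: inner_axis)
    \<comment> \<open>the motion in which the leg \<open>u\<close> slides along its edge, by the whole edge vector\<close>
    define X :: "nat \<Rightarrow> real" where "X h = (if h = l then d $ 3 * (dirn l \<bullet> axis 3 1) else 0)" for h
    have place_X: "place s ((d $ 1, d $ 2), X) w = (if w = u then d else 0)" for w
    proof (cases "w = u")
      case True
      have "X l *\<^sub>R dirn l = (d $ 3) *\<^sub>R axis 3 1"
        by (subst dl(2)) (use dl(1) in \<open>simp add: X_def\<close>)
      then show ?thesis
        using True 2 place_univalent[OF l(1), unfolded l(2), OF u]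
        by (intro vec3_eqI) simp_all
    next
      case False
      then have "(\<Sum>h\<in>star w. X h *\<^sub>R dirn h) = 0"
        using l by (intro sum.neutral) (auto simp: X_def)
      then show ?thesis using False 2 by (simp add: place_def)
    qed
    \<comment> \<open>\<open>\<alpha>\<close> removes the component of this motion along \<open>p\<close>, for which the chart has no coordinate,
      by a dilation; \<open>\<kappa>\<close> removes the coordinate of \<open>base_half\<close> by a vertical translation\<close>
    define \<alpha> where "\<alpha> = (d $ 1 * fst p + d $ 2 * snd p) / n2"
    define \<gamma> where "\<gamma> = (d $ 2 * fst p - d $ 1 * snd p) / n2"
    define \<kappa> where "\<kappa> = (X h0 - \<alpha> * x h0) * (axis 3 1 \<bullet> dirn h0)"
    define \<rho> where "\<rho> h = X h - \<alpha> * x h - \<kappa> * (axis 3 1 \<bullet> dirn h)" for h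
    have d12: "d $ 1 - \<alpha> * fst p = - \<gamma> * snd p" "d $ 2 - \<alpha> * snd p = \<gamma> * fst p"
      using n2 unfolding \<alpha>_def \<gamma>_def by (simp_all add: field_simps n2_def power2_eq_square)
    define R where "R = ((- \<gamma> * snd p, \<gamma> * fst p), \<rho>)"
    have place_R: "place s R w = (if w = u then d else 0) - \<alpha> *\<^sub>R place s y w - \<kappa> *\<^sub>R axis 3 1"
      if w: "w \<in> verts \<Gamma>" for w
    proof -
      have "place s R w = place s ((- \<gamma> * snd p, \<gamma> * fst p), \<lambda>h. X h - \<alpha> * x h) w - \<kappa> *\<^sub>R axis 3 1"
        using place_shift[of s "(- \<gamma> * snd p, \<gamma> * fst p)" "\<lambda>h. X h - \<alpha> * x h" "(- \<kappa>) *\<^sub>R axis 3 1" w] w verts_cases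
        by (auto simp: R_def \<rho>_def[abs_def])
      also have "place s ((- \<gamma> * snd p, \<gamma> * fst p), \<lambda>h. X h - \<alpha> * x h) w
          = place s ((d $ 1, d $ 2), X) w - \<alpha> *\<^sub>R place s y w"
        unfolding d12[symmetric] place_linear[of s _ X] place_linear[of s _ "\<lambda>h. X h - \<alpha> * x h"] y
          place_linear[of s p x]
        by (simp add: scaleR_diff_left sum_subtractf scaleR_sum_right algebra_simps)
      finally show ?thesis by (simp add: place_X)
    qed
    have h0U: "vtx \<Gamma> h0 \<in> U" "h0 \<in> H" using base_half[OF jd ne] by auto
    have "(axis 3 1 \<bullet> dirn h0) * (axis 3 1 \<bullet> dirn h0) = 1"
      using dirn_univalent[OF h0U(1)] by (auto simp: inner_axis inner_axis')
    then have \<rho>0: "\<rho> h0 = 0" by (simp add: \<rho>_def \<kappa>_def mult.assoc)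
    have rad: "\<exists>c. ev s k R = c *\<^sub>R ev s k y" if k: "k < m" for k
    proof -
      note H = es_nth_H[OF k]
      have ne': "vtx \<Gamma> (es ! k) \<noteq> vtx \<Gamma> (opp \<Gamma> (es ! k))" using opp_H(3)[OF H(1)] by simp
      consider "vtx \<Gamma> (es ! k) = u" | "vtx \<Gamma> (opp \<Gamma> (es ! k)) = u"
        | "vtx \<Gamma> (es ! k) \<noteq> u" "vtx \<Gamma> (opp \<Gamma> (es ! k)) \<noteq> u" by blast
      then show ?thesis
      proof cases
        case 1
        then have "es ! k = l" using H l by blast
        then have "ev s k R = (- 1 - \<alpha>) *\<^sub>R ev s k y"
          using ne' 1 H v(3) by (simp add: edge_vec_def place_R vtx_verts d_def v_def algebra_simps)
        then show ?thesis by blast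
      next
        case 2
        then have "opp \<Gamma> (es ! k) = l" using H l by blast
        then have "es ! k = opp \<Gamma> l" using opp_H(2)[OF H(1)] by simp
        then have "vtx \<Gamma> (es ! k) = v" by (simp add: v_def)
        then have e: "ev s k z = place s z u - place s z v" for z
          unfolding edge_vec_def 2 by simp
        have "ev s k R = (- 1 - \<alpha>) *\<^sub>R ev s k y"
          unfolding e place_R[OF v(1)] place_R[OF v(3)] using v(2) by (simp add: d_def algebra_simps)
        then show ?thesis by blast
      next
        case 3
        then have "ev s k R = (- \<alpha>) *\<^sub>R ev s k y"
          using H by (simp add: edge_vec_def place_R vtx_verts algebra_simps)
        then show ?thesis by blast
      qed
    qed
    let ?a = "\<lambda>j. case j of 0 \<Rightarrow> \<gamma> | Suc i \<Rightarrow> \<rho> (cc ! i)"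
    have a0: "?a j = 0" if "j < 2 * m" for j
      using no_radical_combination[OF W that rad, where a = ?a] ev_frame_sum[where \<rho> = \<rho>, OF \<rho>0, where c = \<gamma> and p = p]
      unfolding R_def by blast
    have "\<gamma> = 0" using a0[of 0] chart_coordinates(4) by simp
    have "\<rho> h = 0" if "h \<in> H" for h
    proof (cases "h = h0")
      case False
      then have "h \<in> set cc" using that chart_coordinates(2) by simp
      then obtain i where "i < length cc" "cc ! i = h" by (auto simp: in_set_conv_nth)
      then show ?thesis using a0[of "Suc i"] chart_coordinates(3) by simp
    qed (simp add: \<rho>0)
    then have R0: "place s R w = 0" for w
      by (simp add: R_def place_def \<open>\<gamma> = 0\<close>)
    \<comment> \<open>The combination \<open>R\<close> is trivial, so the dilation is compensated by a translation at all
      vertices other than \<open>u\<close>; there are two of them, at distinct points, so both are zero.\<close>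
    have "\<not> verts \<Gamma> - {u} \<subseteq> {v}"
    proof
      assume "verts \<Gamma> - {u} \<subseteq> {v}"
      then have "verts \<Gamma> \<subseteq> {u, v}" by auto
      then have "card (verts \<Gamma>) \<le> card {u, v}" by (intro card_mono) auto
      then show False using many by (simp add: card_insert_if split: if_splits)
    qed
    then obtain w where w: "w \<in> verts \<Gamma>" "w \<noteq> u" "w \<noteq> v" by auto
    have "\<alpha> *\<^sub>R (place s y v - place s y w) = 0"
      using place_R[OF v(1)] place_R[OF w(1)] v(2) w(2) by (auto simp: R0 scaleR_diff_right algebra_simps)
    moreover have "place s y v \<noteq> place s y w" using inj_onD[OF inj _ v(1) w(1)] w(3) by auto
    ultimately have "\<alpha> = 0" by simp
    then have "\<kappa> *\<^sub>R (axis 3 1 :: real^3) = 0" using place_R[OF v(1)] v(2) by (simp add: R0)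
    then have "d = 0" using place_R[OF v(3)] \<open>\<alpha> = 0\<close> by (simp add: R0)
    then show False using d by simp
  qed
qed

end


section \<open>The reflection of two legs\<close>

context enumerated begin

text \<open>On the slice where the coordinate of \<open>hz\<close> vanishes, the density can be computed in a frame that
  contains both horizontal motions of the strand and omits two coordinates \<open>hx\<close>, \<open>hz\<close>: the vertical
  translation exchanges \<open>hz\<close> for \<open>base_half\<close>, and then the dilation, which is the configuration itself,
  exchanges \<open>hx\<close> for the motion of the strand along \<open>p\<close>. The frame no longer depends on the
  configuration.\<close>

lemma config_density_exchanged:
  assumes hx: "hx \<in> H - {h0}" and hz: "hz \<in> H - {h0}" and hxz: "hx \<noteq> hz"
    and z1: "axis 3 1 \<bullet> dirn hz = 1"
    and xz: "x hz = 0" and xx: "x hx \<noteq> 0" and p: "(a, b) \<noteq> (0, 0)"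
    and j1: "0 < j1" "j1 < 2 * m" "cc ! (j1 - 1) = hz" and j2: "0 < j2" "j2 < 2 * m" "cc ! (j2 - 1) = hx"
  shows "config_density s ((a, b), x) = - (axis 3 1 \<bullet> dirn h0) *
    W s ((a, b), x) ((chart_frame (0, 0))(j1 := unit_half h0, 0 := unit_x, j2 := unit_y)) / x hx"
proof -
  let ?y = "((a, b), x)" and ?fr = "chart_frame (a, b)"
  define Z where "Z h = axis 3 1 \<bullet> dirn h" for h
  define n2 where "n2 = a\<^sup>2 + b\<^sup>2"
  have n2: "n2 \<noteq> 0" using p by (auto simp: n2_def sum_power2_eq_zero_iff)
  have h0: "h0 \<in> H" using base_half[OF jd ne] by simp
  have fr1: "?fr j1 = unit_half hz" and fr2: "?fr j2 = unit_half hx"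
    using frame_Suc[of "(a, b)" "j1 - 1"] frame_Suc[of "(a, b)" "j2 - 1"] j1 j2 by simp_all
  have j12: "j1 \<noteq> j2" using j1 j2 hxz by auto
  define I where "I = {1..<2 * m}"
  have fins: "finite I" by (simp add: I_def)
  have j1I: "j1 \<in> I" "j2 \<in> I" using j1 j2 by (auto simp: I_def)
  have sumI: "(\<Sum>h\<in>H. f h *\<^sub>R ev s k (unit_half h)) = f h0 *\<^sub>R ev s k (unit_half h0)
      + (\<Sum>j\<in>I. f (cc ! (j - 1)) *\<^sub>R ev s k (?fr j))" for f k
  proof -
    have "(\<Sum>j\<in>I. f (cc ! (j - 1)) *\<^sub>R ev s k (?fr j))
        = (\<Sum>i<2 * m - 1. f (cc ! i) *\<^sub>R ev s k (?fr (Suc i)))"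
    proof -
      have "I = Suc ` {..<2 * m - 1}"
        unfolding image_Suc_lessThan I_def by auto
      then show ?thesis by (simp add: sum.reindex)
    qed
    also have "\<dots> = (\<Sum>h\<in>H - {h0}. f h *\<^sub>R ev s k (unit_half h))"
      using sum_chart_coordinates[of "\<lambda>h. f h *\<^sub>R ev s k (unit_half h)"] by (simp add: frame_Suc)
    finally show ?thesis using h0 by (simp add: sum.remove[of H h0])
  qed
  define f1 where "f1 = ?fr(j1 := unit_half h0)"
  have Wfr: "W s ?y ?fr = - Z h0 * W s ?y f1"
  proof -
    have "1 * W s ?y ?fr = - Z h0 * W s ?y (?fr(j1 := unit_half h0))"
    proof (rule W_exchange[where I = "I - {j1}" and z = "((0, 0), Z)", OF j1(2)])
      show "I - {j1} \<subseteq> {..<2 * m} - {j1}" by (auto simp: I_def)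
      have "ev s k ((0, 0), Z) = 0 *\<^sub>R ev s k ?y" if "k < m" for k
      proof -
        have "place s ((0, 0), Z) v = axis 3 1" if "v \<in> verts \<Gamma>" for v
          using place_shift[of s "(0, 0)" "\<lambda>_. 0" "axis 3 1" v] that verts_cases
          by (auto simp: Z_def[abs_def] place_def)
        then show ?thesis using es_nth_H[OF that] by (simp add: edge_vec_def vtx_verts)
      qed
      then show "W s ?y (?fr(j1 := ((0, 0), Z))) = 0"
        using j1 by (intro W_radical) blast+
      show "ev s k ((0, 0), Z) = 1 *\<^sub>R ev s k (?fr j1) + Z h0 *\<^sub>R ev s k (unit_half h0)
          + (\<Sum>j\<in>I - {j1}. Z (cc ! (j - 1)) *\<^sub>R ev s k (?fr j))" for k
        using edge_vec_linear[of s k "(0, 0)" Z] z1 j1 j1I fins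
        by (simp add: sumI sum.remove[of I j1] Z_def)
    qed
    then show ?thesis by (simp add: f1_def)
  qed
  have Wf1: "x hx * W s ?y f1 = - 1 * W s ?y (f1(j2 := ((a, b), \<lambda>_. 0)))"
  proof (rule W_exchange[where I = "I - {j2}" and z = ?y, OF j2(2)])
    show "I - {j2} \<subseteq> {..<2 * m} - {j2}" by (auto simp: I_def)
    show "W s ?y (f1(j2 := ?y)) = 0"
      using j2 by (intro W_radical) (simp, rule exI[of _ 1], simp)
    show "ev s k ?y = x hx *\<^sub>R ev s k (f1 j2) + 1 *\<^sub>R ev s k ((a, b), \<lambda>_. 0)
        + (\<Sum>j\<in>I - {j2}. (if j = j1 then x h0 else x (cc ! (j - 1))) *\<^sub>R ev s k (f1 j))" for k
    proof -
      have r: "(\<Sum>j\<in>I - {j1} - {j2}. (if j = j1 then x h0 else x (cc ! (j - 1))) *\<^sub>R ev s k (f1 j))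
          = (\<Sum>j\<in>I - {j1} - {j2}. x (cc ! (j - 1)) *\<^sub>R ev s k (?fr j))"
        by (intro sum.cong refl) (auto simp: f1_def)
      have c: "I - {j2} - {j1} = I - {j1} - {j2}" by auto
      have "(\<Sum>j\<in>I. x (cc ! (j - 1)) *\<^sub>R ev s k (?fr j))
          = x hx *\<^sub>R ev s k (unit_half hx) + (\<Sum>j\<in>I - {j1} - {j2}. x (cc ! (j - 1)) *\<^sub>R ev s k (?fr j))"
        using j1I j12 fins j1 j2 xz fr1 fr2 by (simp add: sum.remove[of I j1] sum.remove[of "I - {j1}" j2])
      moreover have "(\<Sum>j\<in>I - {j2}. (if j = j1 then x h0 else x (cc ! (j - 1))) *\<^sub>R ev s k (f1 j))
          = x h0 *\<^sub>R ev s k (unit_half h0) + (\<Sum>j\<in>I - {j1} - {j2}. x (cc ! (j - 1)) *\<^sub>R ev s k (?fr j))"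
        using j1I j12 fins by (simp add: sum.remove[of "I - {j2}" j1] r c) (simp add: f1_def)
      moreover have "f1 j2 = unit_half hx" using j12 fr2 by (simp add: f1_def)
      ultimately show ?thesis
        using edge_vec_linear[of s k "(a, b)" x] edge_vec_linear[of s k "(a, b)" "\<lambda>_. 0"]
        by (simp add: sumI algebra_simps)
    qed
  qed
  define f2 where "f2 = (chart_frame (0, 0))(j1 := unit_half h0, 0 := unit_x, j2 := unit_y)"
  have "W s ?y (f1(j2 := ((a, b), \<lambda>_. 0))) = - n2 * W s ?y f2"
  proof -
    let ?g = "chart_frame (0, 0)"
    define g where "g u v = ?g(j1 := unit_half h0, 0 := u, j2 := v)" for u v
    have m0: "0 < 2 * m" using chart_coordinates(4) by simp
    have e: "ev s k ((c, d), \<lambda>_. 0) = c *\<^sub>R ev s k unit_x + d *\<^sub>R ev s k unit_y" for k c d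
      using edge_vec_linear[of s k "(c, d)" "\<lambda>_. 0"] by simp
    have g0: "g u v = (g u' v)(0 := u)" and g2: "g u v = (g u v')(j2 := v)" for u v u' v'
      using j2 by (auto simp: g_def)
    have start: "f1(j2 := ((a, b), \<lambda>_. 0)) = g ((- b, a), \<lambda>_. 0) ((a, b), \<lambda>_. 0)"
      using j1 j2 by (auto simp: f1_def g_def fun_eq_iff chart_frame_def split: nat.split)
    have s0: "W s ?y (g ((- b, a), \<lambda>_. 0) v) = - b * W s ?y (g unit_x v) + a * W s ?y (g unit_y v)" for v
      using W_two[OF m0 e[of _ "- b" a], of ?y "g unit_x v"] by (simp only: g0[of _ v unit_x, symmetric])
    have s2: "W s ?y (g u ((a, b), \<lambda>_. 0)) = a * W s ?y (g u unit_x) + b * W s ?y (g u unit_y)" for u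
      using W_two[OF j2(2) e[of _ a b], of ?y "g u unit_x"] by (simp only: g2[of u _ unit_x, symmetric])
    have rep: "W s ?y (g u u) = 0" for u
      using j2 m0 by (intro W_repeated[of 0 j2]) (auto simp: g_def)
    have "g unit_y unit_x = (g unit_x unit_y)(0 := g unit_x unit_y j2, j2 := g unit_x unit_y 0)"
      using j2 by (auto simp: g_def fun_eq_iff)
    then have swap: "W s ?y (g unit_y unit_x) = - W s ?y (g unit_x unit_y)"
      unfolding edge_wedge_def using wedge_two_forms_swap[of 0 m j2] j2 m0 by simp
    have "W s ?y (f1(j2 := ((a, b), \<lambda>_. 0))) = - n2 * W s ?y (g unit_x unit_y)"
      unfolding start s0 s2 rep swap by (simp add: n2_def power2_eq_square algebra_simps)
    then show ?thesis by (simp only: f2_def g_def)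
  qed
  with Wf1 have "W s ?y f1 = n2 * W s ?y f2 / x hx" using xx by (simp add: field_simps)
  then show ?thesis
    using n2 unfolding config_density_def fst_conv snd_conv Wfr
    by (simp add: f2_def Z_def flip: n2_def)
qed

end

text \<open>Since the neighbours of the legs \<open>l1\<close>, \<open>l2\<close> are trivalent, they stay in place when the two legs of
  the strand \<open>s\<close> are moved.\<close>

locale two_legs = enumerated +
  fixes s l1 l2 :: nat
  assumes l: "l1 \<in> halves \<Gamma>" "l2 \<in> halves \<Gamma>" "l1 \<noteq> l2"
    and legs_s: "legs_on \<Gamma> s = {vtx \<Gamma> l1, vtx \<Gamma> l2}"
    and tri: "vtx \<Gamma> (opp \<Gamma> l1) \<in> trivalent \<Gamma>" "vtx \<Gamma> (opp \<Gamma> l2) \<in> trivalent \<Gamma>"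
begin

abbreviation "v1 \<equiv> vtx \<Gamma> (opp \<Gamma> l1)"
abbreviation "v2 \<equiv> vtx \<Gamma> (opp \<Gamma> l2)"

definition neighbours :: "param \<Rightarrow> real^3"
  where "neighbours y = place s y v1 + place s y v2"

text \<open>In the coordinates \<open>(p, x)\<close>, the map that replaces the legs \<open>u\<^sub>1\<close>, \<open>u\<^sub>2\<close> by \<open>v\<^sub>1 + v\<^sub>2 - u\<^sub>2\<close> and
  \<open>v\<^sub>1 + v\<^sub>2 - u\<^sub>1\<close>.\<close>

definition reflect :: "param \<Rightarrow> param"
  where "reflect y = ((neighbours y $ 1 - fst (fst y), neighbours y $ 2 - snd (fst y)),
    (snd y)(l1 := neighbours y \<bullet> dirn l1 - snd y l2, l2 := neighbours y \<bullet> dirn l2 - snd y l1))"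

lemma legs_U: "vtx \<Gamma> l1 \<in> U" "vtx \<Gamma> l2 \<in> U" "strand_of \<Gamma> (vtx \<Gamma> l1) = s" "strand_of \<Gamma> (vtx \<Gamma> l2) = s"
  using legs_s by (auto simp: legs_on_def)

lemma dirn_legs: "dirn l2 = dirn l1" "dirn l1 = axis 3 1 \<or> dirn l1 = - axis 3 1"
  using legs_U dirn_univalent[of l1] dirn_univalent[of l2] by auto

lemma vtx_legs: "h \<in> H \<Longrightarrow> vtx \<Gamma> h = vtx \<Gamma> l1 \<longleftrightarrow> h = l1" "h \<in> H \<Longrightarrow> vtx \<Gamma> h = vtx \<Gamma> l2 \<longleftrightarrow> h = l2"
    "vtx \<Gamma> l1 \<noteq> vtx \<Gamma> l2"
  using star_univalent[OF l(1) legs_U(1)] star_univalent[OF l(2) legs_U(2)] l by blast+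

lemma tri_legs: "v1 \<notin> {vtx \<Gamma> l1, vtx \<Gamma> l2}" "v2 \<notin> {vtx \<Gamma> l1, vtx \<Gamma> l2}"
  using legs_U(1,2) tri verts_cases(2) unfolding disjoint_iff by auto

lemma place_reflect:
  "v \<notin> {vtx \<Gamma> l1, vtx \<Gamma> l2} \<Longrightarrow> place s (reflect y) v = place s y v"
  "place s (reflect y) (vtx \<Gamma> l1) = neighbours y - place s y (vtx \<Gamma> l2)"
  "place s (reflect y) (vtx \<Gamma> l2) = neighbours y - place s y (vtx \<Gamma> l1)"
proof -
  show "place s (reflect y) v = place s y v" if "v \<notin> {vtx \<Gamma> l1, vtx \<Gamma> l2}"
  proof -
    have "(\<Sum>h\<in>star v. snd (reflect y) h *\<^sub>R dirn h) = (\<Sum>h\<in>star v. snd y h *\<^sub>R dirn h)"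
      by (intro sum.cong refl) (use that in \<open>auto simp: reflect_def\<close>)
    moreover have "v \<notin> legs_on \<Gamma> s" using that legs_s by simp
    ultimately show ?thesis by (simp add: place_def)
  qed
  have q: "(q \<bullet> dirn l1) *\<^sub>R dirn l1 = (q $ 3) *\<^sub>R axis 3 1" for q
    using dirn_legs(2) by (auto simp: inner_axis)
  show "place s (reflect y) (vtx \<Gamma> l1) = neighbours y - place s y (vtx \<Gamma> l2)"
    unfolding place_univalent[OF l(1) legs_U(1)] place_univalent[OF l(2) legs_U(2)]
    by (simp add: reflect_def dirn_legs(1) legs_s l(3) scaleR_diff_left q)
      (rule vec3_eqI; simp)
  show "place s (reflect y) (vtx \<Gamma> l2) = neighbours y - place s y (vtx \<Gamma> l1)"
    unfolding place_univalent[OF l(1) legs_U(1)] place_univalent[OF l(2) legs_U(2)]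
    by (simp add: reflect_def dirn_legs(1) legs_s scaleR_diff_left q)
      (rule vec3_eqI; simp)
qed

text \<open>The reflection turns the vector of the first edge into the opposite of that of the second one, up
  to the orientations of the edges, and conversely. So two factors of the wedge product are exchanged,
  and the two signs cancel.\<close>

lemma edge_wedge_reflect: "W s (reflect y) f = W s y (reflect \<circ> f)"
proof -
  obtain k1 where k1: "k1 < m" "es ! k1 = l1 \<or> es ! k1 = opp \<Gamma> l1 \<and> es ! k1 \<noteq> l1"
    using edge_index[OF l(1)] .
  obtain k2 where k2: "k2 < m" "es ! k2 = l2 \<or> es ! k2 = opp \<Gamma> l2 \<and> es ! k2 \<noteq> l2"
    using edge_index[OF l(2)] .
  define o1 :: real where "o1 = (if es ! k1 = l1 then 1 else - 1)"
  define o2 :: real where "o2 = (if es ! k2 = l2 then 1 else - 1)"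
  define e where "e = - (o1 * o2)"
  have e: "e = 1 \<or> e = - 1" by (simp add: e_def o1_def o2_def)
  have opps: "opp \<Gamma> (opp \<Gamma> l1) = l1" "opp \<Gamma> (opp \<Gamma> l2) = l2" using opp_H l by auto
  have d1: "ev s k1 z = o1 *\<^sub>R (place s z v1 - place s z (vtx \<Gamma> l1))" for z
    using k1 opps by (auto simp: edge_vec_def o1_def)
  have d2: "ev s k2 z = o2 *\<^sub>R (place s z v2 - place s z (vtx \<Gamma> l2))" for z
    using k2 opps by (auto simp: edge_vec_def o2_def)
  have o: "o1 * (o2 * o2) = o1" "o1 * (o1 * o2) = o2" by (simp_all add: o1_def o2_def)
  have r1: "ev s k1 (reflect z) = e *\<^sub>R ev s k2 z" for z
    unfolding d1 d2 place_reflect(1)[OF tri_legs(1)] place_reflect(2)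
    by (simp add: neighbours_def e_def o mult.assoc algebra_simps)
  have r2: "ev s k2 (reflect z) = e *\<^sub>R ev s k1 z" for z
    unfolding d1 d2 place_reflect(1)[OF tri_legs(2)] place_reflect(3)
    by (simp add: neighbours_def e_def o mult.assoc mult.left_commute algebra_simps)
  have r: "ev s k (reflect z) = ev s k z" if k: "k < m" "k \<noteq> k1" "k \<noteq> k2" for k z
  proof -
    note H = es_nth_H[OF k(1)]
    have es: "distinct es" "set es \<inter> opp \<Gamma> ` set es = {}" using en by (auto simp: edge_enumeration_def)
    have neq: "es ! k \<noteq> es ! k1" "es ! k \<noteq> es ! k2" using es(1) k k1 k2 by (simp_all add: nth_eq_iff_index_eq)
    have neq': "es ! k \<noteq> opp \<Gamma> (es ! k1)" "es ! k \<noteq> opp \<Gamma> (es ! k2)"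
      using es(2) nth_mem[OF k(1)] nth_mem[OF k1(1)] nth_mem[OF k2(1)] by blast+
    have "es ! k \<notin> {l1, opp \<Gamma> l1, l2, opp \<Gamma> l2}"
      using neq neq' k1(2) k2(2) opps by auto
    moreover from this have "opp \<Gamma> (es ! k) \<notin> {l1, l2}" using opp_H(2)[OF H(1)] by auto
    ultimately have "vtx \<Gamma> (es ! k) \<notin> {vtx \<Gamma> l1, vtx \<Gamma> l2}" "vtx \<Gamma> (opp \<Gamma> (es ! k)) \<notin> {vtx \<Gamma> l1, vtx \<Gamma> l2}"
      using vtx_legs(1,2) H by auto
    then show ?thesis by (simp add: edge_vec_def place_reflect(1))
  qed
  have k12: "k1 \<noteq> k2"
  proof
    assume "k1 = k2"
    then have "l1 = opp \<Gamma> l2 \<or> l2 = opp \<Gamma> l1" using k1(2) k2(2) l(3) opps by metis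
    then show False using opps tri_legs by auto
  qed
  define c where "c k = (if k = k1 \<or> k = k2 then e else 1)" for k
  define \<eta> where "\<eta> k v w = dir_form (ev s k y) (ev s k (reflect v)) (ev s k (reflect w))" for k v w
  have "W s (reflect y) f = wedge_two_forms m (\<lambda>k v w. c k * \<eta> (Transposition.transpose k1 k2 k) v w) f"
    unfolding edge_wedge_def
  proof (rule wedge_two_forms_cong)
    fix k i j assume "k < m"
    consider "k = k1" | "k = k2" | "k \<noteq> k1" "k \<noteq> k2" by blast
    then show "dir_form (ev s k (reflect y)) (ev s k (f i)) (ev s k (f j))
        = c k * \<eta> (Transposition.transpose k1 k2 k) (f i) (f j)"
    proof cases
      case 1
      then show ?thesis using e k12
        by (auto simp: c_def \<eta>_def r1 r2 dir_form_minus linear_neg[OF linear_dir_form(1)]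
            linear_neg[OF linear_dir_form(2)])
    next
      case 2
      then show ?thesis using e k12
        by (auto simp: c_def \<eta>_def r1 r2 dir_form_minus linear_neg[OF linear_dir_form(1)]
            linear_neg[OF linear_dir_form(2)])
    next
      case 3
      then show ?thesis using r[OF \<open>k < m\<close>] by (simp add: c_def \<eta>_def)
    qed
  qed
  also have "\<dots> = (\<Prod>k<m. c k) * wedge_two_forms m (\<lambda>k. \<eta> (Transposition.transpose k1 k2 k)) f"
    by (rule wedge_two_forms_smult)
  also have "(\<Prod>k<m. c k) = (\<Prod>k\<in>{k1, k2}. c k)"
    using k1 k2 by (intro prod.mono_neutral_right) (auto simp: c_def)
  also have "\<dots> = 1" using k12 e by (auto simp: c_def)
  also have "wedge_two_forms m (\<lambda>k. \<eta> (Transposition.transpose k1 k2 k)) f = wedge_two_forms m \<eta> f"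
    by (rule wedge_two_forms_swap_factors[OF k1(1) k2(1)])
  also have "\<dots> = W s y (reflect \<circ> f)"
    unfolding edge_wedge_def by (rule wedge_two_forms_cong) (simp add: \<eta>_def)
  finally show ?thesis by simp
qed

lemma neighbours_zero: "neighbours ((a, b), \<lambda>_. 0) = 0" "neighbours (unit_half l1) = 0"
    "neighbours (unit_half l2) = 0"
proof -
  have "place s (unit_half h) v = 0" if "v \<in> trivalent \<Gamma>" "h = l1 \<or> h = l2" for v h
    unfolding place_trivalent[OF that(1)] using that legs_U verts_cases(2)
    by (intro sum.neutral) auto
  then show "neighbours (unit_half l1) = 0" "neighbours (unit_half l2) = 0"
    using tri by (simp_all add: neighbours_def)
  show "neighbours ((a, b), \<lambda>_. 0) = 0"
    using tri by (simp add: neighbours_def place_trivalent)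
qed

text \<open>The determinant of the reflection is \<open>-1\<close>. On the two horizontal motions and the two leg
  coordinates it is \<open>-1\<close> times the exchange of the last two; to every other basis vector it adds a
  combination of these four.\<close>

lemma edge_wedge_reflected_frame:
  assumes i: "i1 < 2 * m" "i2 < 2 * m" "i3 < 2 * m" "i4 < 2 * m" "distinct [i1, i2, i3, i4]"
    and f: "f i1 = unit_x" "f i2 = unit_y" "f i3 = unit_half l1" "f i4 = unit_half l2"
    and fj: "\<And>j. j < 2 * m \<Longrightarrow> j \<notin> {i1, i2, i3, i4} \<Longrightarrow> \<exists>h\<in>H - {l1, l2}. f j = unit_half h"
  shows "W s y (reflect \<circ> f) = - W s y f"
proof -
  define Q where "Q = {i1, i2, i3, i4}"
  define g where "g = f(i1 := reflect unit_x, i2 := reflect unit_y, i3 := reflect (unit_half l1),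
    i4 := reflect (unit_half l2))"
  have neg: "ev s k ((- a, - b), \<lambda>h. - x h) = - ev s k ((a, b), x)" for k a b x
    using ev_scale[of s k "- 1" a b x] by simp
  have ux: "ev s k (reflect unit_x) = - ev s k unit_x" and uy: "ev s k (reflect unit_y) = - ev s k unit_y" for k
    using neg[of k 1 0 "\<lambda>_. 0"] neg[of k 0 1 "\<lambda>_. 0"]
    by (simp_all add: reflect_def neighbours_zero fun_upd_idem)
  have "reflect (unit_half l1) = ((- 0, - 0), \<lambda>h. - (if h = l2 then 1 else 0))"
    "reflect (unit_half l2) = ((- 0, - 0), \<lambda>h. - (if h = l1 then 1 else 0))"
    using l(3) by (auto simp: reflect_def neighbours_zero fun_eq_iff)
  then have ul: "ev s k (reflect (unit_half l1)) = - ev s k (unit_half l2)"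
    "ev s k (reflect (unit_half l2)) = - ev s k (unit_half l1)" for k
    by (simp_all only: neg)
  define c where "c j i = (let q = neighbours (f j) in if i = i1 then - (q $ 1) else
    if i = i2 then - (q $ 2) else if i = i3 then - (q \<bullet> dirn l2) else - (q \<bullet> dirn l1))" for j i
  have "W s y (reflect \<circ> f) = W s y g"
  proof (rule W_shear[where a = c])
    show "Q \<subseteq> {..<2 * m}" using i by (auto simp: Q_def)
    show "(reflect \<circ> f) j = g j" if "j \<in> Q" for j
      using that i(5) f by (auto simp: Q_def g_def)
    fix j k assume j: "j < 2 * m" "j \<notin> Q"
    obtain h where h: "h \<in> H - {l1, l2}" "f j = unit_half h" using fj[OF j(1)] j(2) by (auto simp: Q_def)
    define q where "q = neighbours (unit_half h)"
    have R: "reflect (unit_half h) = ((0 + q $ 1, 0 + q $ 2), \<lambda>i. (if i = h then 1 else 0)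
        + ((q \<bullet> dirn l1) * (if i = l1 then 1 else 0) + (q \<bullet> dirn l2) * (if i = l2 then 1 else 0)))"
      using h l(3) by (auto simp: reflect_def q_def fun_eq_iff)
    have "(\<Sum>i\<in>Q. c j i *\<^sub>R ev s k (g i))
      = (q $ 1) *\<^sub>R ev s k unit_x + (q $ 2) *\<^sub>R ev s k unit_y
        + ((q \<bullet> dirn l2) *\<^sub>R ev s k (unit_half l2) + (q \<bullet> dirn l1) *\<^sub>R ev s k (unit_half l1))"
      using i(5) by (simp add: Q_def g_def ux uy ul c_def h(2) flip: q_def)
    moreover have "ev s k (reflect (unit_half h)) = ev s k (unit_half h) + ev s k ((q $ 1, q $ 2), \<lambda>i. 
        (q \<bullet> dirn l1) * (if i = l1 then 1 else 0) + (q \<bullet> dirn l2) * (if i = l2 then 1 else 0))"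
      unfolding R by (rule ev_add)
    moreover have "ev s k ((q $ 1, q $ 2), \<lambda>i. 
        (q \<bullet> dirn l1) * (if i = l1 then 1 else 0) + (q \<bullet> dirn l2) * (if i = l2 then 1 else 0))
       = (q $ 1) *\<^sub>R ev s k unit_x + (q $ 2) *\<^sub>R ev s k unit_y
        + ((q \<bullet> dirn l1) *\<^sub>R ev s k (unit_half l1) + (q \<bullet> dirn l2) *\<^sub>R ev s k (unit_half l2))"
      using l by (subst edge_vec_linear) (simp add: scaleR_add_left sum.distrib if_distrib[of "\<lambda>c. c *\<^sub>R _"]
        if_distrib[of "\<lambda>c. _ * c"] if_distribR cong: if_cong)
    ultimately show "ev s k ((reflect \<circ> f) j) = ev s k (g j) + (\<Sum>i\<in>Q. c j i *\<^sub>R ev s k (g i))"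
      using j(2) h(2) by (simp add: Q_def g_def)
  qed
  also have "W s y g = W s y (f(i3 := unit_half l2, i4 := unit_half l1))"
  proof -
    have "W s y g = - W s y (f(i1 := reflect unit_x, i2 := reflect unit_y, i3 := reflect (unit_half l1),
        i4 := unit_half l1))"
      unfolding g_def using i(4) ul(2) by (intro W_neg)
    also have "f(i1 := reflect unit_x, i2 := reflect unit_y, i3 := reflect (unit_half l1), i4 := unit_half l1)
        = f(i1 := reflect unit_x, i2 := reflect unit_y, i4 := unit_half l1, i3 := reflect (unit_half l1))"
      using i(5) by (auto simp: fun_eq_iff)
    also have "W s y \<dots> = - W s y (f(i1 := reflect unit_x, i2 := reflect unit_y, i4 := unit_half l1,
        i3 := unit_half l2))"
      using i(3) ul(1) by (intro W_neg)
    also have "f(i1 := reflect unit_x, i2 := reflect unit_y, i4 := unit_half l1, i3 := unit_half l2)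
        = f(i4 := unit_half l1, i3 := unit_half l2, i1 := reflect unit_x, i2 := reflect unit_y)"
      using i(5) by (auto simp: fun_eq_iff)
    also have "W s y \<dots> = - W s y (f(i4 := unit_half l1, i3 := unit_half l2, i1 := reflect unit_x, i2 := unit_y))"
      using i(2) uy by (intro W_neg)
    also have "f(i4 := unit_half l1, i3 := unit_half l2, i1 := reflect unit_x, i2 := unit_y)
        = f(i4 := unit_half l1, i3 := unit_half l2, i2 := unit_y, i1 := reflect unit_x)"
      using i(5) by (auto simp: fun_eq_iff)
    also have "W s y \<dots> = - W s y (f(i4 := unit_half l1, i3 := unit_half l2, i2 := unit_y, i1 := unit_x))"
      using i(1) ux by (intro W_neg)
    also have "f(i4 := unit_half l1, i3 := unit_half l2, i2 := unit_y, i1 := unit_x)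
        = f(i3 := unit_half l2, i4 := unit_half l1)"
      using i(5) f by (auto simp: fun_eq_iff)
    finally show ?thesis by (simp only: minus_minus)
  qed
  also have "\<dots> = - W s y f"
  proof -
    have "f(i3 := unit_half l2, i4 := unit_half l1) = f(i3 := f i4, i4 := f i3)" by (simp only: f)
    then show ?thesis
      unfolding edge_wedge_def by (simp only:) (rule wedge_two_forms_swap, use i in auto)
  qed
  finally show ?thesis .
qed

lemma neighbour_coordinates:
  obtains hx hz where "hx \<in> H - {h0, l1, l2}" "hz \<in> H - {h0, l1, l2}" "hx \<noteq> hz"
    "vtx \<Gamma> hx = v1" "vtx \<Gamma> hz = v1" "dirn hz = axis 3 1"
proof -
  obtain a b c where *: "star v1 = {a, b, c}" "distinct [a, b, c]" "dirn c = axis 3 1"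
    by (rule trivalent_halves[OF tri(1)])
  then have ac: "a \<in> star v1" "c \<in> star v1" by auto
  have "h \<notin> {h0, l1, l2}" if "h \<in> star v1" for h
    using that tri(1) verts_cases(2) legs_U base_half[OF jd ne] by auto
  with ac * show thesis using that[of a c] by auto
qed

text \<open>With \<open>hx\<close> and \<open>hz\<close> coordinates that the reflection fixes, both densities are values of the form on
  the same frame, divided by the same coordinate.\<close>

lemma config_density_reflect:
  assumes hx: "hx \<in> H - {h0, l1, l2}" and hz: "hz \<in> H - {h0, l1, l2}" and ne': "hx \<noteq> hz"
    and z1: "dirn hz = axis 3 1"
    and x: "snd y hz = 0" "snd y hx \<noteq> 0" and p: "fst y \<noteq> (0, 0)" "fst (reflect y) \<noteq> (0, 0)"
  shows "config_density s (reflect y) = - config_density s y"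
proof -
  obtain j1 where j1: "0 < j1" "j1 < 2 * m" "cc ! (j1 - 1) = hz" using chart_index[of hz] hz by auto
  obtain j2 where j2: "0 < j2" "j2 < 2 * m" "cc ! (j2 - 1) = hx" using chart_index[of hx] hx by auto
  define f where "f = (chart_frame (0, 0))(j1 := unit_half h0, 0 := unit_x, j2 := unit_y)"
  have j12: "j1 \<noteq> j2" using j1 j2 ne' by auto
  have fS: "f j = unit_half (cc ! (j - 1))" if "0 < j" "j \<noteq> j1" "j \<noteq> j2" for j
    using that frame_Suc[of _ "j - 1"] by (simp add: f_def)
  have fj1: "f j1 = unit_half h0" using j1 j12 by (simp add: f_def)
  have f0: "f 0 = unit_x" "f j2 = unit_y" using j2 j1 by (auto simp: f_def)
  have cci: "cc ! (j - 1) = cc ! (j' - 1) \<Longrightarrow> j = j'" if "0 < j" "0 < j'" "j < 2 * m" "j' < 2 * m" for j j'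
    using that chart_coordinates(1,3) by (simp add: nth_eq_iff_index_eq)
  have idx: "\<exists>i. 0 < i \<and> i < 2 * m \<and> i \<noteq> j2 \<and> f i = unit_half h"
    if h: "h \<in> H" "h \<noteq> hx" "h \<noteq> hz" for h
  proof (cases "h = h0")
    case True
    then show ?thesis using j1 j12 fj1 by blast
  next
    case False
    obtain i where "0 < i" "i < 2 * m" "cc ! (i - 1) = h" using chart_index[of h] h False by auto
    then show ?thesis using fS[of i] j1(3) j2(3) h by metis
  qed
  obtain i3 where i3: "0 < i3" "i3 < 2 * m" "i3 \<noteq> j2" "f i3 = unit_half l1" using idx[of l1] l hx hz by auto
  obtain i4 where i4: "0 < i4" "i4 < 2 * m" "i4 \<noteq> j2" "f i4 = unit_half l2" using idx[of l2] l hx hz by auto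
  have uinj: "unit_half h = unit_half h' \<longleftrightarrow> h = h'" for h h'
    by (auto simp: fun_eq_iff split: if_splits)
  have fother: "\<exists>h\<in>H - {l1, l2}. f j = unit_half h" if j: "j < 2 * m" "j \<notin> {0, j2, i3, i4}" for j
  proof -
    have code: "\<exists>h\<in>H. f i = unit_half h \<and> (i \<noteq> j1 \<longrightarrow> h = cc ! (i - 1) \<and> h \<noteq> h0) \<and> (i = j1 \<longrightarrow> h = h0)"
      if "0 < i" "i < 2 * m" "i \<noteq> j2" for i
    proof (cases "i = j1")
      case False
      have "cc ! (i - 1) \<in> set cc" using that chart_coordinates(3) by (intro nth_mem) auto
      then show ?thesis using fS[of i] that False chart_coordinates(2) by auto
    qed (use fj1 base_half[OF jd ne] in auto)
    have inj: "i = i'" if "f i = f i'" "0 < i" "i < 2 * m" "i \<noteq> j2" "0 < i'" "i' < 2 * m" "i' \<noteq> j2" for i i'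
      using code[OF that(2-4)] code[OF that(5-7)] that(1) cci[OF that(2,5,3,6)] uinj by metis
    have j': "0 < j" "j \<noteq> j2" using j by auto
    obtain h where h: "h \<in> H" "f j = unit_half h" using code[OF j'(1) j(1) j'(2)] by blast
    have "h \<noteq> l1" "h \<noteq> l2" using inj[of j i3] inj[of j i4] h i3 i4 j j' by auto
    then show ?thesis using h by auto
  qed
  have dist: "distinct [0, j2, i3, i4]" using i3 i4 j2 l(3) uinj[of l1 l2] by auto
  have m0: "0 < 2 * m" using chart_coordinates(4) by simp
  have Wneg: "W s (reflect y) f = - W s y f"
    unfolding edge_wedge_reflect
    by (rule edge_wedge_reflected_frame[OF m0 j2(2) i3(2) i4(2) dist f0 i3(4) i4(4) fother])
  have sx: "snd (reflect y) hx = snd y hx" "snd (reflect y) hz = snd y hz"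
    using hx hz by (auto simp: reflect_def)
  have D: "config_density s z = - (axis 3 1 \<bullet> dirn h0) * W s z f / snd z hx"
    if "fst z \<noteq> (0, 0)" "snd z hz = 0" "snd z hx \<noteq> 0" for z
    using config_density_exchanged[OF _ _ ne' _ _ _ _ j1 j2, where x = "snd z" and a = "fst (fst z)" and b = "snd (fst z)" and s = s]
      hx hz z1 that by (simp add: f_def inner_axis)
  show ?thesis
    using D[OF p(1) x] D[OF p(2)] x sx Wneg by simp
qed

end


section \<open>Integration over products of lines\<close>

abbreviation LB :: "nat set \<Rightarrow> (nat \<Rightarrow> real) measure"
  where "LB I \<equiv> Pi\<^sub>M I (\<lambda>_. lborel)"

abbreviation plane :: "(real \<times> real) measure" where "plane \<equiv> lborel \<Otimes>\<^sub>M lborel"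

abbreviation par :: "nat set \<Rightarrow> ((real \<times> real) \<times> (nat \<Rightarrow> real)) measure"
  where "par I \<equiv> plane \<Otimes>\<^sub>M LB I"

lemma product_sigma_finite_lborel: "product_sigma_finite (\<lambda>_::nat. lborel :: real measure)"
  by standard

lemma sigma_finite_LB: "finite I \<Longrightarrow> sigma_finite_measure (LB I)"
  by (rule product_sigma_finite.sigma_finite[OF product_sigma_finite_lborel])

lemma sigma_finite_plane: "sigma_finite_measure plane"
  by (simp add: lborel_prod lborel.sigma_finite_measure_axioms)

lemma pair_sigma_finite_par: "finite I \<Longrightarrow> pair_sigma_finite plane (LB I)"
  by (simp add: pair_sigma_finite_def sigma_finite_LB sigma_finite_plane)

lemma sigma_finite_par: "finite I \<Longrightarrow> sigma_finite_measure (par I)"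
  by (intro sigma_finite_pair_measure sigma_finite_plane sigma_finite_LB)

lemma nn_integral_par:
  assumes "finite I" "f \<in> borel_measurable (par I)"
  shows "(\<integral>\<^sup>+y. f y \<partial>par I) = (\<integral>\<^sup>+p. \<integral>\<^sup>+x. f (p, x) \<partial>LB I \<partial>plane)"
  by (rule sigma_finite_measure.nn_integral_fst[OF sigma_finite_LB[OF assms(1)] assms(2), symmetric])

lemma nn_integral_par_swap:
  assumes "finite I" "f \<in> borel_measurable (par I)"
  shows "(\<integral>\<^sup>+y. f y \<partial>par I) = (\<integral>\<^sup>+x. \<integral>\<^sup>+p. f (p, x) \<partial>plane \<partial>LB I)"
  by (rule pair_sigma_finite.nn_integral_snd[OF pair_sigma_finite_par[OF assms(1)], symmetric])
    (use assms(2) in \<open>simp add: split_beta'\<close>)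

lemma nn_integral_plane:
  assumes "f \<in> borel_measurable plane"
  shows "(\<integral>\<^sup>+p. f p \<partial>plane) = (\<integral>\<^sup>+a. \<integral>\<^sup>+b. f (a, b) \<partial>lborel \<partial>lborel)"
  by (rule lborel.nn_integral_fst[OF assms, symmetric])

lemma nn_integral_PiM_affine:
  assumes "finite I" "f \<in> borel_measurable (LB I)" "c \<noteq> 0"
  shows "(\<integral>\<^sup>+x. f x \<partial>LB I) = ennreal (\<bar>c\<bar> ^ card I) * (\<integral>\<^sup>+x. f (\<lambda>i\<in>I. t i + c * x i) \<partial>LB I)"
  using assms(1,2)
proof (induction I arbitrary: f rule: finite_induct)
  case empty
  have e: "(\<integral>\<^sup>+x. g x \<partial>LB {}) = g (\<lambda>_. undefined)" for g
    by (rule product_sigma_finite.nn_integral_empty[OF product_sigma_finite_lborel]) simp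
  show ?case unfolding e by (simp add: restrict_def)
next
  case (insert i I)
  interpret product_sigma_finite "\<lambda>_::nat. lborel :: real measure"
    by (rule product_sigma_finite_lborel)
  note [measurable] = insert.prems
  have f': "(\<lambda>(x, a). f (x(i := a))) \<in> borel_measurable (LB I \<Otimes>\<^sub>M lborel)"
    by measurable
  have r[measurable]: "(\<lambda>x. \<lambda>j\<in>I. t j + c * x j) \<in> measurable (LB I) (LB I)" by measurable
  have r'[measurable]: "(\<lambda>x. \<lambda>j\<in>insert i I. t j + c * x j) \<in> measurable (LB (insert i I)) (LB (insert i I))"
    by measurable
  have "(\<integral>\<^sup>+x. f x \<partial>LB (insert i I)) = (\<integral>\<^sup>+x. \<integral>\<^sup>+a. f (x(i := a)) \<partial>lborel \<partial>LB I)"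
    using insert.hyps by (intro product_nn_integral_insert) auto
  also have "\<dots> = (\<integral>\<^sup>+x. ennreal \<bar>c\<bar> * (\<integral>\<^sup>+a. f (x(i := t i + c * a)) \<partial>lborel) \<partial>LB I)"
  proof (rule nn_integral_cong)
    fix x assume x: "x \<in> space (LB I)"
    have "(\<lambda>a. f (x(i := a))) \<in> borel_measurable lborel"
      using measurable_compose[OF measurable_Pair1'[OF x] f'] by simp
    then show "(\<integral>\<^sup>+a. f (x(i := a)) \<partial>lborel) = ennreal \<bar>c\<bar> * (\<integral>\<^sup>+a. f (x(i := t i + c * a)) \<partial>lborel)"
      using assms(3) by (intro nn_integral_real_affine) auto
  qed
  also have "\<dots> = ennreal \<bar>c\<bar> * (\<integral>\<^sup>+x. \<integral>\<^sup>+a. f (x(i := t i + c * a)) \<partial>lborel \<partial>LB I)"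
    by (intro nn_integral_cmult) measurable
  also have "(\<integral>\<^sup>+x. \<integral>\<^sup>+a. f (x(i := t i + c * a)) \<partial>lborel \<partial>LB I) = ennreal (\<bar>c\<bar> ^ card I) *
      (\<integral>\<^sup>+x. \<integral>\<^sup>+a. f ((\<lambda>j\<in>I. t j + c * x j)(i := t i + c * a)) \<partial>lborel \<partial>LB I)"
    by (rule insert.IH) measurable
  also have "(\<integral>\<^sup>+x. \<integral>\<^sup>+a. f ((\<lambda>j\<in>I. t j + c * x j)(i := t i + c * a)) \<partial>lborel \<partial>LB I)
      = (\<integral>\<^sup>+x. \<integral>\<^sup>+a. f (\<lambda>j\<in>insert i I. t j + c * (x(i := a)) j) \<partial>lborel \<partial>LB I)"
  proof (intro nn_integral_cong arg_cong[where f = f])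
    fix x a
    show "(\<lambda>j\<in>I. t j + c * x j)(i := t i + c * a) = (\<lambda>j\<in>insert i I. t j + c * (x(i := a)) j)"
      using insert.hyps by (auto simp: fun_eq_iff)
  qed
  also have "\<dots> = (\<integral>\<^sup>+x. f (\<lambda>j\<in>insert i I. t j + c * x j) \<partial>LB (insert i I))"
    using insert.hyps by (intro product_nn_integral_insert[symmetric]) measurable
  finally have *: "(\<integral>\<^sup>+x. f x \<partial>LB (insert i I)) = ennreal \<bar>c\<bar> * (ennreal (\<bar>c\<bar> ^ card I) *
      (\<integral>\<^sup>+x. f (\<lambda>j\<in>insert i I. t j + c * x j) \<partial>LB (insert i I)))" .
  have "\<bar>c\<bar> ^ card (insert i I) = \<bar>c\<bar> * \<bar>c\<bar> ^ card I" using insert.hyps by simp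
  then show ?case
    unfolding * by (simp only: ennreal_mult abs_ge_zero zero_le_power mult.assoc)
qed

section \<open>Dilations\<close>

definition scale_par :: "nat set \<Rightarrow> real \<Rightarrow> (real \<times> real) \<times> (nat \<Rightarrow> real) \<Rightarrow> (real \<times> real) \<times> (nat \<Rightarrow> real)"
  where "scale_par I r y = ((r * fst (fst y), r * snd (fst y)), \<lambda>i\<in>I. r * snd y i)"

lemma measurable_scale_par [measurable]: "scale_par I r \<in> measurable (par I) (par I)"
  unfolding scale_par_def by measurable

lemma nn_integral_plane_affine:
  assumes f[measurable]: "f \<in> borel_measurable plane" and c: "c \<noteq> 0"
  shows "(\<integral>\<^sup>+p. f p \<partial>plane) = ennreal (c\<^sup>2) * (\<integral>\<^sup>+p. f (s + c * fst p, t + c * snd p) \<partial>plane)"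
proof -
  have "(\<integral>\<^sup>+p. f p \<partial>plane) = (\<integral>\<^sup>+a. \<integral>\<^sup>+b. f (a, b) \<partial>lborel \<partial>lborel)"
    by (rule nn_integral_plane) fact
  also have "\<dots> = (\<integral>\<^sup>+a. ennreal \<bar>c\<bar> * \<integral>\<^sup>+b. f (a, t + c * b) \<partial>lborel \<partial>lborel)"
    using c by (intro nn_integral_cong nn_integral_real_affine) measurable
  also have "\<dots> = ennreal \<bar>c\<bar> * (\<integral>\<^sup>+a. ennreal \<bar>c\<bar> * \<integral>\<^sup>+b. f (s + c * a, t + c * b) \<partial>lborel \<partial>lborel)"
    using c by (intro nn_integral_real_affine) measurable
  also have "\<dots> = ennreal (c\<^sup>2) * (\<integral>\<^sup>+a. \<integral>\<^sup>+b. f (s + c * a, t + c * b) \<partial>lborel \<partial>lborel)"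
    by (subst nn_integral_cmult) (measurable, simp add: mult.assoc[symmetric] ennreal_mult[symmetric] power2_eq_square)
  also have "(\<integral>\<^sup>+a. \<integral>\<^sup>+b. f (s + c * a, t + c * b) \<partial>lborel \<partial>lborel)
      = (\<integral>\<^sup>+p. f (s + c * fst p, t + c * snd p) \<partial>plane)"
    by (subst nn_integral_plane) simp_all
  finally show ?thesis .
qed

lemma nn_integral_scale_par:
  assumes I: "finite I" and f[measurable]: "f \<in> borel_measurable (par I)" and r: "r > 0"
  shows "(\<integral>\<^sup>+y. f y \<partial>par I) = ennreal (r ^ (card I + 2)) * (\<integral>\<^sup>+y. f (scale_par I r y) \<partial>par I)"
proof -
  interpret sigma_finite_measure "LB I" using I by (rule sigma_finite_LB)
  have [measurable]: "(\<lambda>x. \<lambda>i\<in>I. r * x i) \<in> measurable (LB I) (LB I)" by measurable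
  have "(\<integral>\<^sup>+y. f y \<partial>par I) = (\<integral>\<^sup>+p. \<integral>\<^sup>+x. f (p, x) \<partial>LB I \<partial>plane)"
    by (rule nn_integral_par[OF I f])
  also have "\<dots> = (\<integral>\<^sup>+p. ennreal (r ^ card I) * (\<integral>\<^sup>+x. f (p, \<lambda>i\<in>I. r * x i) \<partial>LB I) \<partial>plane)"
  proof (rule nn_integral_cong)
    fix p :: "real \<times> real"
    have "p \<in> space plane" by (simp add: space_pair_measure)
    from measurable_compose[OF measurable_Pair1'[OF this] f]
    have "(\<lambda>x. f (p, x)) \<in> borel_measurable (LB I)" .
    from nn_integral_PiM_affine[OF I this, of r "\<lambda>_. 0"] r
    show "(\<integral>\<^sup>+x. f (p, x) \<partial>LB I) = ennreal (r ^ card I) * (\<integral>\<^sup>+x. f (p, \<lambda>i\<in>I. r * x i) \<partial>LB I)"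
      by simp
  qed
  also have "\<dots> = ennreal (r ^ card I) * (\<integral>\<^sup>+p. \<integral>\<^sup>+x. f (p, \<lambda>i\<in>I. r * x i) \<partial>LB I \<partial>plane)"
    by (rule nn_integral_cmult) measurable
  also have "(\<integral>\<^sup>+p. \<integral>\<^sup>+x. f (p, \<lambda>i\<in>I. r * x i) \<partial>LB I \<partial>plane)
    = ennreal (r\<^sup>2) * (\<integral>\<^sup>+p. \<integral>\<^sup>+x. f ((0 + r * fst p, 0 + r * snd p), \<lambda>i\<in>I. r * x i) \<partial>LB I \<partial>plane)"
    using r by (intro nn_integral_plane_affine) measurable
  also have "(\<integral>\<^sup>+p. \<integral>\<^sup>+x. f ((0 + r * fst p, 0 + r * snd p), \<lambda>i\<in>I. r * x i) \<partial>LB I \<partial>plane)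
      = (\<integral>\<^sup>+y. f (scale_par I r y) \<partial>par I)"
    by (subst nn_integral_par[OF I]) (measurable, simp add: scale_par_def)
  finally have *: "(\<integral>\<^sup>+y. f y \<partial>par I)
      = ennreal (r ^ card I) * (ennreal (r\<^sup>2) * (\<integral>\<^sup>+y. f (scale_par I r y) \<partial>par I))" .
  show ?thesis
    unfolding * power_add using r by (simp only: ennreal_mult zero_le_power less_imp_le mult.assoc)
qed

text \<open>The logarithmic length of the interval \<open>[1, 2]\<close> is invariant under dilations.\<close>

lemma nn_integral_log_window:
  assumes c: "c > (0::real)"
  shows "(\<integral>\<^sup>+t. indicator {1..2} (c * exp t) \<partial>lborel) = ennreal (ln 2)"
    and "(\<integral>\<^sup>+t. indicator {1..2} (exp (- t) * c) \<partial>lborel) = ennreal (ln 2)"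
proof -
  have "1 \<le> c * exp t \<longleftrightarrow> - ln c \<le> t" "c * exp t \<le> 2 \<longleftrightarrow> t \<le> ln 2 - ln c" for t
  proof -
    have e: "c * exp t = exp (ln c + t)" using c by (simp add: exp_add)
    show "1 \<le> c * exp t \<longleftrightarrow> - ln c \<le> t" unfolding e by auto
    show "c * exp t \<le> 2 \<longleftrightarrow> t \<le> ln 2 - ln c"
      unfolding e by (subst ln_ge_iff[symmetric]) auto
  qed
  note * = this
  then have "indicator {1..2} (c * exp t) = (indicator {- ln c..ln 2 - ln c} t :: ennreal)" for t
    by (simp add: indicator_def)
  then show "(\<integral>\<^sup>+t. indicator {1..2} (c * exp t) \<partial>lborel) = ennreal (ln 2)" by simp
  have "indicator {1..2} (exp (- t) * c) = (indicator {ln c - ln 2..ln c} t :: ennreal)" for t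
    using *[of "- t"] by (auto simp: indicator_def mult.commute)
  then show "(\<integral>\<^sup>+t. indicator {1..2} (exp (- t) * c) \<partial>lborel) = ennreal (ln 2)" by simp
qed

text \<open>If \<open>f\<close> is homogeneous of the degree opposite to the dimension, \<open>f\<close> times the volume is invariant
  under dilations, and the integral over a fundamental domain does not depend on the positive
  function \<open>a\<close> of degree 1 that cuts the domain out. The proof inserts the window for \<open>b\<close>, averaged over
  all dilations, and then moves the dilations over to \<open>a\<close>. Writing them as \<open>exp t\<close> makes the inversion
  of a dilation the measure preserving map \<open>t \<mapsto> - t\<close>.\<close>

lemma size_function_irrelevant:
  assumes I: "finite I" and f[measurable]: "f \<in> borel_measurable (par I)"
    and a[measurable]: "a \<in> borel_measurable (par I)" and b[measurable]: "b \<in> borel_measurable (par I)"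
    and hf: "\<And>r y. r > 0 \<Longrightarrow> y \<in> space (par I) \<Longrightarrow> f (scale_par I r y) = ennreal (1 / r ^ (card I + 2)) * f y"
    and ha: "\<And>r y. r > 0 \<Longrightarrow> y \<in> space (par I) \<Longrightarrow> a (scale_par I r y) = r * a y"
    and hb: "\<And>r y. r > 0 \<Longrightarrow> y \<in> space (par I) \<Longrightarrow> b (scale_par I r y) = r * b y"
    and a0: "AE y in par I. a y > (0::real)" and b0: "AE y in par I. b y > (0::real)"
  shows "(\<integral>\<^sup>+y. f y * indicator {1..2} (a y) \<partial>par I) = (\<integral>\<^sup>+y. f y * indicator {1..2} (b y) \<partial>par I)"
proof -
  interpret sigma_finite_measure "par I" by (rule sigma_finite_par[OF I])
  interpret pair_sigma_finite "lborel :: real measure" "par I"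
    by (simp add: pair_sigma_finite_def sigma_finite_measure_axioms lborel.sigma_finite_measure_axioms)
  define w :: "real \<Rightarrow> ennreal" where "w = indicator {1..2}"
  have [measurable]: "w \<in> borel_measurable borel" by (simp add: w_def)
  have "ennreal (ln 2) * (\<integral>\<^sup>+y. f y * w (a y) \<partial>par I) = (\<integral>\<^sup>+y. ennreal (ln 2) * (f y * w (a y)) \<partial>par I)"
    by (rule nn_integral_cmult[symmetric]) measurable
  also have "\<dots> = (\<integral>\<^sup>+y. \<integral>\<^sup>+t. f y * w (a y) * w (b y * exp t) \<partial>lborel \<partial>par I)"
  proof (rule nn_integral_cong_AE, use b0 in \<open>elim eventually_mono\<close>)
    fix y assume "b y > 0"
    then show "ennreal (ln 2) * (f y * w (a y)) = (\<integral>\<^sup>+t. f y * w (a y) * w (b y * exp t) \<partial>lborel)"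
      using nn_integral_log_window(1)[of "b y", folded w_def]
      by (subst nn_integral_cmult) (simp_all add: mult_ac)
  qed
  also have "\<dots> = (\<integral>\<^sup>+t. \<integral>\<^sup>+y. f y * w (a y) * w (b y * exp t) \<partial>par I \<partial>lborel)"
    by (rule Fubini') measurable
  also have "\<dots> = (\<integral>\<^sup>+t. \<integral>\<^sup>+y. f y * w (exp (- t) * a y) * w (b y) \<partial>par I \<partial>lborel)"
  proof (rule nn_integral_cong)
    fix t :: real
    let ?r = "exp (- t)" let ?n = "card I + 2"
    have "(\<integral>\<^sup>+y. f y * w (a y) * w (b y * exp t) \<partial>par I) = ennreal (?r ^ ?n) *
        (\<integral>\<^sup>+y. f (scale_par I ?r y) * w (a (scale_par I ?r y)) * w (b (scale_par I ?r y) * exp t) \<partial>par I)"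
      by (rule nn_integral_scale_par[OF I]) simp_all
    also have "\<dots> = ennreal (?r ^ ?n) * (\<integral>\<^sup>+y. ennreal (1 / ?r ^ ?n) * (f y * w (?r * a y) * w (b y)) \<partial>par I)"
    proof (rule arg_cong[where f = "\<lambda>v. ennreal (?r ^ ?n) * v"], rule nn_integral_cong)
      fix y assume y: "y \<in> space (par I)"
      have "?r * b y * exp t = b y" by (simp add: exp_minus)
      then show "f (scale_par I ?r y) * w (a (scale_par I ?r y)) * w (b (scale_par I ?r y) * exp t)
          = ennreal (1 / ?r ^ ?n) * (f y * w (?r * a y) * w (b y))"
        using hf[OF _ y, of ?r] ha[OF _ y, of ?r] hb[OF _ y, of ?r] by (simp only: exp_gt_zero mult.assoc)
    qed
    also have "\<dots> = ennreal (?r ^ ?n) * (ennreal (1 / ?r ^ ?n) * (\<integral>\<^sup>+y. f y * w (?r * a y) * w (b y) \<partial>par I))"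
      by (subst nn_integral_cmult) measurable
    also have "\<dots> = (\<integral>\<^sup>+y. f y * w (?r * a y) * w (b y) \<partial>par I)"
      by (simp only: mult.assoc[symmetric] ennreal_mult[symmetric] zero_le_power exp_ge_zero zero_le_divide_1_iff)
        simp
    finally show "(\<integral>\<^sup>+y. f y * w (a y) * w (b y * exp t) \<partial>par I)
        = (\<integral>\<^sup>+y. f y * w (?r * a y) * w (b y) \<partial>par I)" .
  qed
  also have "\<dots> = (\<integral>\<^sup>+y. \<integral>\<^sup>+t. f y * w (exp (- t) * a y) * w (b y) \<partial>lborel \<partial>par I)"
    by (rule Fubini'[symmetric]) measurable
  also have "\<dots> = (\<integral>\<^sup>+y. ennreal (ln 2) * (f y * w (b y)) \<partial>par I)"
  proof (rule nn_integral_cong_AE, use a0 in \<open>elim eventually_mono\<close>)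
    fix y assume "a y > 0"
    have "(\<integral>\<^sup>+t. f y * w (exp (- t) * a y) * w (b y) \<partial>lborel) = (\<integral>\<^sup>+t. f y * w (b y) * w (exp (- t) * a y) \<partial>lborel)"
      by (simp add: mult_ac)
    also have "\<dots> = ennreal (ln 2) * (f y * w (b y))"
      using nn_integral_log_window(2)[OF \<open>a y > 0\<close>, folded w_def]
      by (subst nn_integral_cmult) (auto simp: mult.commute)
    finally show "(\<integral>\<^sup>+t. f y * w (exp (- t) * a y) * w (b y) \<partial>lborel) = ennreal (ln 2) * (f y * w (b y))" .
  qed
  also have "\<dots> = ennreal (ln 2) * (\<integral>\<^sup>+y. f y * w (b y) \<partial>par I)"
    by (rule nn_integral_cmult) measurable
  finally show ?thesis
    by (simp add: w_def ennreal_mult_cancel_left)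
qed


section \<open>Changes of coordinates\<close>

lemma measurable_LB_upd [measurable]:
  assumes "i \<in> I"
  shows "(\<lambda>x. x(i := (0::real))) \<in> measurable (LB (I - {i})) (LB I)"
proof -
  have "(\<lambda>x. x(i := (0::real))) \<in> measurable (LB (I - {i})) (LB (insert i (I - {i})))"
    by (rule measurable_fun_upd[where J = "I - {i}"]) auto
  then show ?thesis using assms by (simp add: insert_absorb)
qed

text \<open>The two slices meet every orbit of the translations along \<open>z\<close> exactly once. Translating by the
  coordinate of \<open>h1\<close> moves the point of one slice to the other one, where it appears as the coordinate of
  \<open>h0\<close>, up to sign.\<close>

lemma translation_slice_irrelevant:
  assumes H: "finite H" and h: "h0 \<in> H" "h1 \<in> H" "h0 \<noteq> h1"
    and g[measurable]: "g \<in> borel_measurable (LB H)"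
    and z: "\<bar>z h0\<bar> = (1::real)" "\<bar>z h1\<bar> = 1"
    and inv: "\<And>x \<tau>. g (\<lambda>h\<in>H. x h + \<tau> * z h) = g (\<lambda>h\<in>H. x h)"
  shows "(\<integral>\<^sup>+x. g (x(h0 := 0)) \<partial>LB (H - {h0})) = (\<integral>\<^sup>+x. g (x(h1 := 0)) \<partial>LB (H - {h1}))"
proof -
  interpret product_sigma_finite "\<lambda>_::nat. lborel :: real measure"
    by (rule product_sigma_finite_lborel)
  define R where "R = H - {h0, h1}"
  have R: "finite R" "h0 \<notin> R" "h1 \<notin> R" "H - {h0} = insert h1 R" "H - {h1} = insert h0 R"
    "insert h0 (insert h1 R) = H" using H h by (auto simp: R_def)
  have upd: "(\<lambda>x. x(h0 := a, h1 := b)) \<in> measurable (LB R) (LB H)" for a b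
  proof -
    have "(\<lambda>x. x(h0 := a, h1 := b)) \<in> measurable (LB R) (LB (insert h1 (insert h0 R)))"
      by measurable
    then show ?thesis using R(6) by (simp add: insert_commute)
  qed
  have m0: "(\<lambda>x. g (x(h0 := 0))) \<in> borel_measurable (LB (insert h1 R))"
    using measurable_compose[OF measurable_LB_upd[OF h(1)] g] R by simp
  have m1: "(\<lambda>x. g (x(h1 := 0))) \<in> borel_measurable (LB (insert h0 R))"
    using measurable_compose[OF measurable_LB_upd[OF h(2)] g] R by simp
  define s where "s = - (z h1 * z h0)"
  have s: "\<bar>s\<bar> = 1" "s \<noteq> 0" using z by (auto simp: s_def abs_mult)
  have z1: "z h1 * z h1 = 1" using z(2) by (metis abs_mult_self_eq mult_1)
  have "(\<integral>\<^sup>+x. g (x(h0 := 0)) \<partial>LB (H - {h0})) = (\<integral>\<^sup>+a. \<integral>\<^sup>+x. g (x(h1 := a, h0 := 0)) \<partial>LB R \<partial>lborel)"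
    unfolding R(4) using R by (subst product_nn_integral_insert_rev[OF _ _ m0]) auto
  also have "\<dots> = (\<integral>\<^sup>+a. \<integral>\<^sup>+x. g (x(h0 := s * a, h1 := 0)) \<partial>LB R \<partial>lborel)"
  proof (rule nn_integral_cong)
    fix a :: real
    let ?t = "\<lambda>h. - (a * z h1) * z h"
    have "(\<integral>\<^sup>+x. g (x(h1 := a, h0 := 0)) \<partial>LB R)
        = (\<integral>\<^sup>+x. g ((\<lambda>h\<in>R. ?t h + 1 * x h)(h0 := s * a, h1 := 0)) \<partial>LB R)"
    proof (rule nn_integral_cong)
      fix x assume x: "x \<in> space (LB R)"
      have "g (x(h1 := a, h0 := 0)) = g (\<lambda>h\<in>H. (x(h1 := a, h0 := 0)) h)"
        using x R(6) h by (intro arg_cong[where f = g]) (auto simp: space_PiM PiE_def extensional_def fun_eq_iff)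
      also have "\<dots> = g (\<lambda>h\<in>H. (x(h1 := a, h0 := 0)) h + (- (a * z h1)) * z h)"
        by (rule inv[symmetric])
      also have "(\<lambda>h\<in>H. (x(h1 := a, h0 := 0)) h + (- (a * z h1)) * z h)
          = (\<lambda>h\<in>R. ?t h + 1 * x h)(h0 := s * a, h1 := 0)"
      proof
        fix k
        consider "k = h1" | "k = h0" | "k \<in> R" "k \<noteq> h0" "k \<noteq> h1" "k \<in> H" | "k \<notin> H"
          using h by (auto simp: R_def)
        then show "(\<lambda>h\<in>H. (x(h1 := a, h0 := 0)) h + (- (a * z h1)) * z h) k
            = ((\<lambda>h\<in>R. ?t h + 1 * x h)(h0 := s * a, h1 := 0)) k"
        proof cases
          case 1
          then show ?thesis using h z1 by (simp add: mult.assoc)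
        next
          case 2
          then show ?thesis using h by (simp add: s_def)
        next
          case 3
          then show ?thesis by simp
        next
          case 4
          then show ?thesis using h by (auto simp: R_def)
        qed
      qed
      finally show "g (x(h1 := a, h0 := 0)) = g ((\<lambda>h\<in>R. ?t h + 1 * x h)(h0 := s * a, h1 := 0))" .
    qed
    also have "\<dots> = (\<integral>\<^sup>+x. g (x(h0 := s * a, h1 := 0)) \<partial>LB R)"
      using nn_integral_PiM_affine[OF R(1) measurable_compose[OF upd g], of 1 "s * a" 0 ?t] by simp
    finally show "(\<integral>\<^sup>+x. g (x(h1 := a, h0 := 0)) \<partial>LB R) = (\<integral>\<^sup>+x. g (x(h0 := s * a, h1 := 0)) \<partial>LB R)" .
  qed
  also have "\<dots> = (\<integral>\<^sup>+a. \<integral>\<^sup>+x. g (x(h0 := a, h1 := 0)) \<partial>LB R \<partial>lborel)"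
  proof -
    interpret sigma_finite_measure "LB R" by (rule sigma_finite_LB[OF R(1)])
    have "(\<lambda>(x, a). x(h0 := a)) \<in> measurable (LB R \<Otimes>\<^sub>M lborel) (LB (insert h0 R))"
      by (rule measurable_add_dim)
    from measurable_compose[OF this m1]
    have "(\<lambda>(a, x). g (x(h0 := a, h1 := 0))) \<in> borel_measurable (lborel \<Otimes>\<^sub>M LB R)"
      by (subst measurable_pair_swap_iff) (simp add: split_beta')
    then have "(\<lambda>a. \<integral>\<^sup>+x. g (x(h0 := a, h1 := 0)) \<partial>LB R) \<in> borel_measurable lborel"
      by (rule borel_measurable_nn_integral)
    then show ?thesis
      using nn_integral_real_affine[of "\<lambda>a. \<integral>\<^sup>+x. g (x(h0 := a, h1 := 0)) \<partial>LB R" s 0] s by simp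
  qed
  also have "\<dots> = (\<integral>\<^sup>+x. g (x(h1 := 0)) \<partial>LB (H - {h1}))"
    unfolding R(5) using R by (subst product_nn_integral_insert_rev[OF _ _ m1]) auto
  finally show ?thesis .
qed

text \<open>With the other coordinates fixed, the substitution is an exchange of two variables followed by a
  reflection in each of them.\<close>

lemma nn_integral_reflect_two:
  assumes I: "finite I" and l: "l1 \<in> I" "l2 \<in> I" "l1 \<noteq> l2"
    and G[measurable]: "G \<in> borel_measurable (LB I)"
    and q3: "\<And>x t1 t2. q3 (x(l1 := t1, l2 := t2)) = (q3 x :: real)"
    and q4: "\<And>x t1 t2. q4 (x(l1 := t1, l2 := t2)) = (q4 x :: real)"
    and m[measurable]: "(\<lambda>x. G (x(l1 := q3 x - x l2, l2 := q4 x - x l1))) \<in> borel_measurable (LB I)"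
  shows "(\<integral>\<^sup>+x. G x \<partial>LB I) = (\<integral>\<^sup>+x. G (x(l1 := q3 x - x l2, l2 := q4 x - x l1)) \<partial>LB I)"
proof -
  interpret product_sigma_finite "\<lambda>_::nat. lborel :: real measure"
    by (rule product_sigma_finite_lborel)
  define R where "R = I - {l1, l2}"
  have R: "finite R" "l1 \<notin> R" "l2 \<notin> insert l1 R" "I = insert l2 (insert l1 R)" using I l by (auto simp: R_def)
  have split: "(\<integral>\<^sup>+x. F x \<partial>LB I) = (\<integral>\<^sup>+x. \<integral>\<^sup>+s. \<integral>\<^sup>+t. F (x(l1 := s, l2 := t)) \<partial>lborel \<partial>lborel \<partial>LB R)"
    if F[measurable]: "F \<in> borel_measurable (LB I)" for F
  proof -
    have F': "F \<in> borel_measurable (LB (insert l2 (insert l1 R)))" using F R(4) by simp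
    note [measurable] = F'
    have "(\<integral>\<^sup>+x. F x \<partial>LB I) = (\<integral>\<^sup>+x. \<integral>\<^sup>+t. F (x(l2 := t)) \<partial>lborel \<partial>LB (insert l1 R))"
      unfolding R(4) using R by (intro product_nn_integral_insert[OF _ _ F']) auto
    also have "\<dots> = (\<integral>\<^sup>+x. \<integral>\<^sup>+s. \<integral>\<^sup>+t. F (x(l1 := s, l2 := t)) \<partial>lborel \<partial>lborel \<partial>LB R)"
      using R by (intro product_nn_integral_insert) measurable
    finally show ?thesis .
  qed
  have "(\<integral>\<^sup>+x. G (x(l1 := q3 x - x l2, l2 := q4 x - x l1)) \<partial>LB I)
    = (\<integral>\<^sup>+x. \<integral>\<^sup>+s. \<integral>\<^sup>+t. G (x(l1 := q3 x - t, l2 := q4 x - s)) \<partial>lborel \<partial>lborel \<partial>LB R)"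
    unfolding split[OF m] q3 q4 using l(3) by (simp add: fun_upd_twist)
  also have "\<dots> = (\<integral>\<^sup>+x. \<integral>\<^sup>+s. \<integral>\<^sup>+t. G (x(l1 := s, l2 := t)) \<partial>lborel \<partial>lborel \<partial>LB R)"
  proof (rule nn_integral_cong)
    fix x assume x: "x \<in> space (LB R)"
    have G': "(\<lambda>(s, t). G (x(l1 := s, l2 := t))) \<in> borel_measurable (lborel \<Otimes>\<^sub>M lborel)"
    proof -
      have "(\<lambda>p. x(l1 := fst p, l2 := snd p)) \<in> measurable (lborel \<Otimes>\<^sub>M lborel) (LB (insert l2 (insert l1 R)))"
        using x by measurable
      from measurable_compose[OF this, of G borel] show ?thesis using G R(4) by (simp add: split_beta')
    qed
    have [measurable]: "(\<lambda>t. G (x(l1 := s, l2 := t))) \<in> borel_measurable borel" for s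
      using measurable_compose[OF measurable_Pair1' G', of s] by simp
    have [measurable]: "(\<lambda>s. G (x(l1 := s, l2 := t))) \<in> borel_measurable borel" for t
      using measurable_compose[OF measurable_Pair2' G', of t] by simp
    have G2: "(\<lambda>(s, t). G (x(l1 := q3 x - t, l2 := s))) \<in> borel_measurable (lborel \<Otimes>\<^sub>M lborel)"
      using measurable_compose[OF _ G', of "\<lambda>p. (q3 x - snd p, fst p)" "lborel \<Otimes>\<^sub>M lborel"]
      by (simp add: split_beta')
    have "(\<integral>\<^sup>+s. \<integral>\<^sup>+t. G (x(l1 := q3 x - t, l2 := q4 x - s)) \<partial>lborel \<partial>lborel)
        = (\<integral>\<^sup>+s. \<integral>\<^sup>+t. G (x(l1 := q3 x - t, l2 := s)) \<partial>lborel \<partial>lborel)"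
      using nn_integral_real_affine[of "\<lambda>s. \<integral>\<^sup>+t. G (x(l1 := q3 x - t, l2 := s)) \<partial>lborel" "- 1" "q4 x"]
        lborel.borel_measurable_nn_integral[OF G2] by simp
    also have "\<dots> = (\<integral>\<^sup>+t. \<integral>\<^sup>+s. G (x(l1 := q3 x - t, l2 := s)) \<partial>lborel \<partial>lborel)"
      by (rule lborel_pair.Fubini'[OF G2, symmetric])
    also have "\<dots> = (\<integral>\<^sup>+t. \<integral>\<^sup>+s. G (x(l1 := t, l2 := s)) \<partial>lborel \<partial>lborel)"
      using nn_integral_real_affine[of "\<lambda>t. \<integral>\<^sup>+s. G (x(l1 := t, l2 := s)) \<partial>lborel" "- 1" "q3 x"]
        lborel.borel_measurable_nn_integral[OF G'] by simp
    finally show "(\<integral>\<^sup>+s. \<integral>\<^sup>+t. G (x(l1 := q3 x - t, l2 := q4 x - s)) \<partial>lborel \<partial>lborel)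
      = (\<integral>\<^sup>+s. \<integral>\<^sup>+t. G (x(l1 := s, l2 := t)) \<partial>lborel \<partial>lborel)" .
  qed
  also have "\<dots> = (\<integral>\<^sup>+x. G x \<partial>LB I)" by (rule split[OF G, symmetric])
  finally show ?thesis by simp
qed

text \<open>The set is the graph of a function of the other coordinates, hence null by Fubini.\<close>

lemma AE_coordinate_neq:
  assumes I: "finite I" "i \<in> I" and \<phi>[measurable]: "\<phi> \<in> borel_measurable (LB I)"
    and indep: "\<And>x t. \<phi> (x(i := t)) = (\<phi> x :: real)"
  shows "AE x in LB I. x i \<noteq> \<phi> x"
proof -
  interpret product_sigma_finite "\<lambda>_::nat. lborel :: real measure"
    by (rule product_sigma_finite_lborel)
  let ?N = "{x \<in> space (LB I). x i = \<phi> x}"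
  have N[measurable]: "?N \<in> sets (LB I)" using I by measurable
  have I': "I = insert i (I - {i})" using I by auto
  have "emeasure (LB I) ?N = (\<integral>\<^sup>+x. indicator ?N x \<partial>LB I)" by simp
  also have "\<dots> = (\<integral>\<^sup>+x. \<integral>\<^sup>+t. indicator ?N (x(i := t)) \<partial>lborel \<partial>LB (I - {i}))"
    using I product_nn_integral_insert[of "I - {i}" i "indicator ?N"] I' by simp
  also have "\<dots> = (\<integral>\<^sup>+x. 0 \<partial>LB (I - {i}))"
  proof (rule nn_integral_cong)
    fix x
    have "(\<integral>\<^sup>+t. indicator ?N (x(i := t)) \<partial>lborel) \<le> (\<integral>\<^sup>+t. indicator {\<phi> x} t \<partial>lborel)"
      by (intro nn_integral_mono) (auto simp: indicator_def indep)
    also have "\<dots> = 0" by simp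
    finally show "(\<integral>\<^sup>+t. indicator ?N (x(i := t)) \<partial>lborel) = 0" by simp
  qed
  finally have "emeasure (LB I) ?N = 0" by simp
  then show ?thesis by (intro AE_I[of _ _ ?N]) auto
qed

section \<open>Polar coordinates\<close>

text \<open>The substitution rule holds on compact intervals; the exhaustion of the real line by \<open>[-n, n]\<close>
  corresponds to that of \<open>(-\<pi>/2, \<pi>/2)\<close> by \<open>[- arctan n, arctan n]\<close>.\<close>

lemma nn_integral_tan_substitution:
  fixes g :: "real \<Rightarrow> ennreal"
  assumes g[measurable]: "g \<in> borel_measurable borel"
  shows "(\<integral>\<^sup>+b. g b \<partial>lborel)
    = (\<integral>\<^sup>+\<theta>. g (tan \<theta>) * ennreal (1 / (cos \<theta>)\<^sup>2) * indicator {- (pi/2)<..<pi/2} \<theta> \<partial>lborel)"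
proof -
  have [measurable]: "(\<lambda>\<theta>::real. tan \<theta>) \<in> borel_measurable borel" unfolding tan_def by measurable
  let ?A = "\<lambda>n. {- arctan (real (Suc n))..arctan (real (Suc n))}"
  let ?B = "\<lambda>n. {- real (Suc n)..real (Suc n)}"
  let ?F = "\<lambda>\<theta>. g (tan \<theta>) * ennreal (1 / (cos \<theta>)\<^sup>2)"
  have piece: "(\<integral>\<^sup>+b. g b * indicator (?B n) b \<partial>lborel)
    = (\<integral>\<^sup>+\<theta>. ?F \<theta> * indicator (?A n) \<theta> \<partial>lborel)" for n
  proof -
    let ?c = "arctan (real (Suc n))"
    have c: "0 < ?c" "?c < pi/2" "tan ?c = real (Suc n)"
      using arctan_ubound[of "real (Suc n)"] by (simp_all add: tan_arctan)
    have cos: "cos x \<noteq> 0" if "x \<in> {- ?c..?c}" for x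
      using that c cos_gt_zero_pi[of x] by auto
    have "(\<integral>\<^sup>+b. g b * indicator {tan (- ?c)..tan ?c} b \<partial>lborel)
      = (\<integral>\<^sup>+\<theta>. g (tan \<theta>) * ennreal (inverse ((cos \<theta>)\<^sup>2)) * indicator {- ?c..?c} \<theta> \<partial>lborel)"
      using c cos by (intro nn_integral_substitution_aux) (auto intro!: continuous_intros DERIV_tan)
    then show ?thesis by (simp only: tan_minus c(3) inverse_eq_divide)
  qed
  have "(\<integral>\<^sup>+b. g b \<partial>lborel) = (\<integral>\<^sup>+b. (SUP n. g b * indicator (?B n) b) \<partial>lborel)"
  proof (intro nn_integral_cong antisym)
    fix b
    obtain n where "\<bar>b\<bar> < real n" using reals_Archimedean2 by blast
    then have "g b = g b * indicator (?B n) b" by (auto simp: indicator_def)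
    also have "\<dots> \<le> (SUP n. g b * indicator (?B n) b)"
      by (rule SUP_upper) simp
    finally show "g b \<le> (SUP n. g b * indicator (?B n) b)" .
    show "(SUP n. g b * indicator (?B n) b) \<le> g b"
      by (intro SUP_least) (auto simp: indicator_def)
  qed
  also have "\<dots> = (SUP n. \<integral>\<^sup>+b. g b * indicator (?B n) b \<partial>lborel)"
    by (intro nn_integral_monotone_convergence_SUP)
      (auto simp: incseq_def le_fun_def indicator_def intro!: mult_left_mono)
  also have "\<dots> = (SUP n. \<integral>\<^sup>+\<theta>. ?F \<theta> * indicator (?A n) \<theta> \<partial>lborel)"
    by (simp only: piece)
  also have "\<dots> = (\<integral>\<^sup>+\<theta>. (SUP n. ?F \<theta> * indicator (?A n) \<theta>) \<partial>lborel)"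
  proof (intro nn_integral_monotone_convergence_SUP[symmetric])
    show "incseq (\<lambda>n \<theta>. ?F \<theta> * indicator (?A n) \<theta>)"
    proof (rule incseq_SucI, rule le_funI)
      fix n \<theta>
      have "arctan (real (Suc n)) \<le> arctan (real (Suc (Suc n)))" by (simp add: arctan_le_iff)
      then show "?F \<theta> * indicator (?A n) \<theta>
          \<le> ?F \<theta> * indicator (?A (Suc n)) \<theta>"
        by (intro mult_left_mono) (auto simp: indicator_def)
    qed
  qed measurable
  also have "\<dots> = (\<integral>\<^sup>+\<theta>. ?F \<theta> * indicator {- (pi/2)<..<pi/2} \<theta> \<partial>lborel)"
  proof (intro nn_integral_cong antisym)
    fix \<theta> :: real
    show "?F \<theta> * indicator {- (pi/2)<..<pi/2} \<theta>
        \<le> (SUP n. ?F \<theta> * indicator (?A n) \<theta>)"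
    proof (cases "\<theta> \<in> {- (pi/2)<..<pi/2}")
      case True
      obtain n where "\<bar>tan \<theta>\<bar> < real n" using reals_Archimedean2 by blast
      then have "- real (Suc n) \<le> tan \<theta>" "tan \<theta> \<le> real (Suc n)" by auto
      then have "arctan (- real (Suc n)) \<le> arctan (tan \<theta>)" "arctan (tan \<theta>) \<le> arctan (real (Suc n))"
        by (simp_all only: arctan_le_iff)
      moreover have "arctan (tan \<theta>) = \<theta>" using True by (intro arctan_tan) auto
      ultimately have "\<theta> \<in> (?A n)"
        using arctan_minus[of "real (Suc n)"] by simp
      then have "?F \<theta> * indicator {- (pi/2)<..<pi/2} \<theta>
          = ?F \<theta> * indicator (?A n) \<theta>" using True by simp
      also have "\<dots> \<le> (SUP n. ?F \<theta> * indicator (?A n) \<theta>)"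
        by (rule SUP_upper) simp
      finally show ?thesis .
    qed simp
    show "(SUP n. ?F \<theta> * indicator (?A n) \<theta>)
        \<le> ?F \<theta> * indicator {- (pi/2)<..<pi/2} \<theta>"
    proof (intro SUP_least mult_left_mono)
      fix n
      have "arctan (real (Suc n)) < pi/2" by (rule arctan_ubound)
      then show "indicator (?A n) \<theta>
          \<le> (indicator {- (pi/2)<..<pi/2} \<theta> :: ennreal)" by (auto simp: indicator_def)
    qed simp
  qed
  finally show ?thesis .
qed


text \<open>The integral of \<open>da / a\<close> over \<open>[1, 2]\<close>. It only serves as a common factor that can be cancelled,
  being neither zero nor infinite.\<close>

definition log_length :: ennreal
  where "log_length = (\<integral>\<^sup>+a. ennreal (1 / a) * indicator {0<..} a * indicator {1..2} a \<partial>lborel)"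

lemma log_length: "log_length \<noteq> 0" "log_length \<noteq> top"
proof -
  have "(\<integral>\<^sup>+a. ennreal (1 / 2) * indicator {1..2::real} a \<partial>lborel) \<le> log_length"
    unfolding log_length_def
  proof (rule nn_integral_mono)
    fix a :: real
    have "ennreal (1 / 2) \<le> ennreal (1 / a)" if "1 \<le> a" "a \<le> 2"
      using that by (intro ennreal_leI) (simp add: field_simps)
    then show "ennreal (1 / 2) * indicator {1..2} a \<le> ennreal (1 / a) * indicator {0<..} a * indicator {1..2} a"
      by (auto simp: indicator_def)
  qed
  moreover have "(\<integral>\<^sup>+a. ennreal (1 / 2) * indicator {1..2::real} a \<partial>lborel) > 0"
  proof -
    have "(\<integral>\<^sup>+a. ennreal (1 / 2) * indicator {1..2::real} a \<partial>lborel) = ennreal (1 / 2)"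
      by (subst nn_integral_cmult_indicator) simp_all
    then show ?thesis by (simp only: ennreal_less_zero_iff)
  qed
  ultimately show "log_length \<noteq> 0" by auto
  have "log_length \<le> (\<integral>\<^sup>+a. indicator {1..2::real} a \<partial>lborel)"
    unfolding log_length_def
    by (intro nn_integral_mono) (auto simp: indicator_def intro!: ennreal_leI[of _ 1, simplified])
  then show "log_length \<noteq> top" by (auto simp: top_unique)
qed

text \<open>For a fixed first coordinate \<open>a > 0\<close> the substitution \<open>b = a tan \<theta>\<close> introduces the angle. By
  homogeneity the remaining integral over \<open>a\<close> is that of \<open>da / a\<close> over \<open>a / cos \<theta> \<in> [1, 2]\<close>, whose
  value does not depend on the angle.\<close>

lemma nn_integral_half_plane:
  assumes h[measurable]: "h \<in> borel_measurable plane"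
    and hom: "\<And>r a b. r > 0 \<Longrightarrow> h (r * a, r * b) = ennreal (1 / r\<^sup>2) * h (a, b)"
  shows "(\<integral>\<^sup>+p. h p * indicator {1..2} (norm p) * indicator {0<..} (fst p) \<partial>plane)
    = log_length * (\<integral>\<^sup>+\<theta>. h (cos \<theta>, sin \<theta>) * indicator {- (pi/2)<..<pi/2} \<theta> \<partial>lborel)"
proof -
  define w :: "real \<Rightarrow> ennreal" where "w = indicator {1..2}"
  define k :: "real \<Rightarrow> ennreal" where "k a = ennreal (1 / a) * indicator {0<..} a" for a
  define S :: "real \<Rightarrow> ennreal" where "S = indicator {- (pi/2)<..<pi/2}"
  have [measurable]: "w \<in> borel_measurable borel" "k \<in> borel_measurable borel" "S \<in> borel_measurable borel"
    by (simp_all add: w_def k_def[abs_def] S_def)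
  let ?H = "\<lambda>\<theta>. h (cos \<theta>, sin \<theta>) * S \<theta>"
  have "(\<integral>\<^sup>+p. h p * w (norm p) * indicator {0<..} (fst p) \<partial>plane)
      = (\<integral>\<^sup>+a. \<integral>\<^sup>+b. h (a, b) * w (norm (a, b)) * indicator {0<..} a \<partial>lborel \<partial>lborel)"
  proof (subst nn_integral_plane)
    show "(\<lambda>p. h p * w (norm p) * indicator {0<..} (fst p)) \<in> borel_measurable plane"
      by (simp add: norm_prod_def) measurable
  qed simp
  also have "\<dots> = (\<integral>\<^sup>+a. \<integral>\<^sup>+\<theta>. k a * w (a / cos \<theta>) * ?H \<theta> \<partial>lborel \<partial>lborel)"
  proof (rule nn_integral_cong)
    fix a :: real
    show "(\<integral>\<^sup>+b. h (a, b) * w (norm (a, b)) * indicator {0<..} a \<partial>lborel)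
        = (\<integral>\<^sup>+\<theta>. k a * w (a / cos \<theta>) * ?H \<theta> \<partial>lborel)"
    proof (cases "a > 0")
      case False
      then show ?thesis by (simp add: k_def)
    next
      case a: True
      let ?f = "\<lambda>b. h (a, b) * w (sqrt (a\<^sup>2 + b\<^sup>2))"
      have [measurable]: "(\<lambda>b. h (a, b)) \<in> borel_measurable borel" by measurable
      have f[measurable]: "?f \<in> borel_measurable borel" by measurable
      have "(\<integral>\<^sup>+b. ?f b \<partial>lborel) = ennreal a * (\<integral>\<^sup>+b. ?f (a * b) \<partial>lborel)"
        using nn_integral_real_affine[OF f, of a 0] a by simp
      also have "(\<integral>\<^sup>+b. ?f (a * b) \<partial>lborel)
          = (\<integral>\<^sup>+\<theta>. ?f (a * tan \<theta>) * ennreal (1 / (cos \<theta>)\<^sup>2) * S \<theta> \<partial>lborel)"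
        unfolding S_def by (rule nn_integral_tan_substitution) measurable
      also have "ennreal a * \<dots> = (\<integral>\<^sup>+\<theta>. ennreal a * (?f (a * tan \<theta>) * ennreal (1 / (cos \<theta>)\<^sup>2) * S \<theta>) \<partial>lborel)"
        by (rule nn_integral_cmult[symmetric]) (simp add: tan_def)
      also have "\<dots> = (\<integral>\<^sup>+\<theta>. k a * w (a / cos \<theta>) * ?H \<theta> \<partial>lborel)"
      proof (rule nn_integral_cong)
        fix \<theta> :: real
        show "ennreal a * (?f (a * tan \<theta>) * ennreal (1 / (cos \<theta>)\<^sup>2) * S \<theta>) = k a * w (a / cos \<theta>) * ?H \<theta>"
        proof (cases "\<theta> \<in> {- (pi/2)<..<pi/2}")
          case False
          then show ?thesis by (simp add: S_def)
        next
          case True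
          then have c: "cos \<theta> > 0" by (intro cos_gt_zero_pi) auto
          define r where "r = a / cos \<theta>"
          have r: "r > 0" "a = r * cos \<theta>" "a * tan \<theta> = r * sin \<theta>"
            using a c by (simp_all add: r_def tan_def)
          have "a\<^sup>2 + (a * tan \<theta>)\<^sup>2 = r\<^sup>2 * ((cos \<theta>)\<^sup>2 + (sin \<theta>)\<^sup>2)"
            unfolding r(3) by (subst r(2)) (simp only: power_mult_distrib distrib_left)
          then have s: "sqrt (a\<^sup>2 + (a * tan \<theta>)\<^sup>2) = r" using r(1) by simp
          have "h (a, a * tan \<theta>) = ennreal (1 / r\<^sup>2) * h (cos \<theta>, sin \<theta>)"
            unfolding r(3) by (subst r(2)) (rule hom[OF r(1)])
          then have "ennreal a * (?f (a * tan \<theta>) * ennreal (1 / (cos \<theta>)\<^sup>2) * S \<theta>)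
            = (ennreal a * ennreal (1 / r\<^sup>2) * ennreal (1 / (cos \<theta>)\<^sup>2)) * (w r * ?H \<theta>)"
            unfolding s by (simp only: mult_ac)
          also have "ennreal a * ennreal (1 / r\<^sup>2) * ennreal (1 / (cos \<theta>)\<^sup>2) = k a"
          proof -
            have "a * (1 / r\<^sup>2) * (1 / (cos \<theta>)\<^sup>2) = 1 / a"
              using a c by (simp add: r_def field_simps power2_eq_square)
            then show ?thesis using a by (simp add: k_def ennreal_mult[symmetric])
          qed
          finally show ?thesis by (simp add: r_def mult.assoc)
        qed
      qed
      finally show ?thesis using a by (simp add: norm_prod_def)
    qed
  qed
  also have "\<dots> = (\<integral>\<^sup>+\<theta>. \<integral>\<^sup>+a. k a * w (a / cos \<theta>) * ?H \<theta> \<partial>lborel \<partial>lborel)"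
    by (rule lborel_pair.Fubini') measurable
  also have "\<dots> = (\<integral>\<^sup>+\<theta>. log_length * ?H \<theta> \<partial>lborel)"
  proof (rule nn_integral_cong)
    fix \<theta> :: real
    show "(\<integral>\<^sup>+a. k a * w (a / cos \<theta>) * ?H \<theta> \<partial>lborel) = log_length * ?H \<theta>"
    proof (cases "\<theta> \<in> {- (pi/2)<..<pi/2}")
      case False
      then show ?thesis by (simp add: S_def)
    next
      case True
      then have c: "cos \<theta> > 0" by (intro cos_gt_zero_pi) auto
      have "(\<integral>\<^sup>+a. k a * w (a / cos \<theta>) \<partial>lborel)
          = ennreal (cos \<theta>) * (\<integral>\<^sup>+a. k (cos \<theta> * a) * w (cos \<theta> * a / cos \<theta>) \<partial>lborel)"
        using nn_integral_real_affine[of "\<lambda>a. k a * w (a / cos \<theta>)" "cos \<theta>" 0] c by simp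
      also have "\<dots> = (\<integral>\<^sup>+a. ennreal (cos \<theta>) * (k (cos \<theta> * a) * w a) \<partial>lborel)"
        using c by (subst nn_integral_cmult) auto
      also have "\<dots> = (\<integral>\<^sup>+a. k a * w a \<partial>lborel)"
      proof (rule nn_integral_cong)
        fix a :: real
        have "ennreal (cos \<theta>) * k (cos \<theta> * a) = k a"
          using c by (auto simp: k_def indicator_def zero_less_mult_iff ennreal_mult[symmetric])
        then show "ennreal (cos \<theta>) * (k (cos \<theta> * a) * w a) = k a * w a" by (simp add: mult.assoc[symmetric])
      qed
      finally have "(\<integral>\<^sup>+a. k a * w (a / cos \<theta>) \<partial>lborel) = log_length"
        by (simp add: log_length_def k_def w_def)
      then show ?thesis by (subst nn_integral_multc) auto
    qed
  qed
  also have "\<dots> = log_length * (\<integral>\<^sup>+\<theta>. ?H \<theta> \<partial>lborel)"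
    by (rule nn_integral_cmult) measurable
  finally show ?thesis by (simp add: w_def S_def)
qed

text \<open>The left half-plane is the image of the right one under the central symmetry, which shifts the
  angle by \<open>\<pi>\<close>; finally the interval \<open>(-\<pi>/2, 3\<pi>/2)\<close> is rearranged to \<open>[0, 2\<pi>)\<close> by periodicity.\<close>

lemma nn_integral_annulus:
  assumes h[measurable]: "h \<in> borel_measurable plane"
    and hom: "\<And>r a b. r > 0 \<Longrightarrow> h (r * a, r * b) = ennreal (1 / r\<^sup>2) * h (a, b)"
  shows "(\<integral>\<^sup>+p. h p * indicator {1..2} (norm p) \<partial>plane)
    = log_length * (\<integral>\<^sup>+\<theta>. h (cos \<theta>, sin \<theta>) * indicator {0..<2 * pi} \<theta> \<partial>lborel)"
proof -
  define w :: "real \<Rightarrow> ennreal" where "w = indicator {1..2}"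
  have [measurable]: "w \<in> borel_measurable borel" by (simp add: w_def)
  have [measurable]: "(\<lambda>p::real\<times>real. w (norm p)) \<in> borel_measurable plane" by (simp add: norm_prod_def)
  define h' where "h' p = h (- fst p, - snd p)" for p
  have h'[measurable]: "h' \<in> borel_measurable plane" unfolding h'_def by measurable
  have hom': "h' (r * a, r * b) = ennreal (1 / r\<^sup>2) * h' (a, b)" if "r > 0" for r a b
    using hom[OF that, of "- a" "- b"] by (simp add: h'_def)
  let ?E = "\<lambda>\<theta>. h (cos \<theta>, sin \<theta>)"
  let ?J = "\<lambda>S. \<integral>\<^sup>+\<theta>. ?E \<theta> * indicator S \<theta> \<partial>lborel"
  let ?W = "\<lambda>h S. \<integral>\<^sup>+p. h p * w (norm p) * indicator S (fst p) \<partial>plane"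
  have [measurable]: "?E \<in> borel_measurable borel" by measurable
  have "(\<integral>\<^sup>+p. h p * w (norm p) \<partial>plane)
      = (\<integral>\<^sup>+p. h p * w (norm p) * indicator {0<..} (fst p) + h p * w (norm p) * indicator {..<0} (fst p) \<partial>plane)"
  proof (rule nn_integral_cong_AE)
    have "AE a in lborel. AE b in lborel. a \<noteq> (0::real)"
      using AE_lborel_singleton[of "0::real"] by (rule eventually_mono) simp
    then have "AE p in plane. fst p \<noteq> 0"
      by (intro lborel_pair.AE_pair_measure[OF borel_measurable_neq]) simp_all
    then show "AE p in plane. h p * w (norm p)
        = h p * w (norm p) * indicator {0<..} (fst p) + h p * w (norm p) * indicator {..<0} (fst p)"
      by (rule eventually_mono) (auto simp: indicator_def)
  qed
  also have "\<dots> = ?W h {0<..}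
      + ?W h {..<0}"
    by (rule nn_integral_add) measurable
  also have "?W h {..<0}
      = ?W h' {0<..}"
    by (subst nn_integral_plane_affine[where c = "- 1" and s = 0 and t = 0])
      (auto simp: h'_def norm_prod_def indicator_def intro!: nn_integral_cong)
  also have "\<dots> = log_length * (\<integral>\<^sup>+\<theta>. h' (cos \<theta>, sin \<theta>) * indicator {- (pi/2)<..<pi/2} \<theta> \<partial>lborel)"
    unfolding w_def by (rule nn_integral_half_plane[OF h' hom'])
  also have "(\<integral>\<^sup>+\<theta>. h' (cos \<theta>, sin \<theta>) * indicator {- (pi/2)<..<pi/2} \<theta> \<partial>lborel)
      = ?J {pi/2<..<3 * pi/2}"
    using nn_integral_real_affine[of "\<lambda>\<theta>. ?E \<theta> * indicator {pi/2<..<3 * pi/2} \<theta>" 1 pi]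
    by (auto simp: h'_def indicator_def intro!: nn_integral_cong)
  also have "?W h {0<..}
      = log_length * ?J {- (pi/2)<..<pi/2}"
    unfolding w_def by (rule nn_integral_half_plane[OF h hom])
  also have "?J {- (pi/2)<..<pi/2}
      = (\<integral>\<^sup>+\<theta>. ?E \<theta> * indicator {- (pi/2)<..<0} \<theta> + ?E \<theta> * indicator {0..<pi/2} \<theta> \<partial>lborel)"
    by (intro nn_integral_cong) (auto simp: indicator_def)
  also have "\<dots> = ?J {- (pi/2)<..<0}
      + ?J {0..<pi/2}"
    by (rule nn_integral_add) measurable
  also have "?J {- (pi/2)<..<0}
      = ?J {3 * pi/2<..<2 * pi}"
    using nn_integral_real_affine[of "\<lambda>\<theta>. ?E \<theta> * indicator {3 * pi/2<..<2 * pi} \<theta>" 1 "2 * pi"]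
    by (auto simp: indicator_def cos_add sin_add intro!: nn_integral_cong)
  also have "log_length * (?J {3 * pi/2<..<2 * pi}
      + ?J {0..<pi/2})
      + log_length * ?J {pi/2<..<3 * pi/2}
    = log_length * (?J {3 * pi/2<..<2 * pi}
      + ?J {0..<pi/2}
      + ?J {pi/2<..<3 * pi/2})"
    by (simp only: distrib_left)
  also have "?J {3 * pi/2<..<2 * pi}
      + ?J {0..<pi/2}
      + ?J {pi/2<..<3 * pi/2}
    = (\<integral>\<^sup>+\<theta>. ?E \<theta> * indicator {3 * pi/2<..<2 * pi} \<theta> + ?E \<theta> * indicator {0..<pi/2} \<theta>
        + ?E \<theta> * indicator {pi/2<..<3 * pi/2} \<theta> \<partial>lborel)"
    by (subst nn_integral_add; (subst nn_integral_add)?; simp)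
  also have "\<dots> = ?J {0..<2 * pi}"
  proof (rule nn_integral_cong_AE)
    have p: "pi / 2 < 3 * pi / 2" "3 * pi / 2 < 2 * pi" using pi_gt_zero by linarith+
    show "AE \<theta> in lborel. ?E \<theta> * indicator {3 * pi/2<..<2 * pi} \<theta> + ?E \<theta> * indicator {0..<pi/2} \<theta>
        + ?E \<theta> * indicator {pi/2<..<3 * pi/2} \<theta> = ?E \<theta> * indicator {0..<2 * pi} \<theta>"
      using AE_lborel_singleton[of "pi/2"] AE_lborel_singleton[of "3 * pi/2"]
      by eventually_elim (use p in \<open>auto simp: indicator_def\<close>)
  qed
  finally show ?thesis by (simp add: w_def)
qed


section \<open>The domain of integration\<close>

text \<open>Convex combinations preserve strict inequalities, so the linear homotopy is injective at all
  times.\<close>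

lemma isotopic_if_same_order:
  assumes i: "i \<in> U \<rightarrow>\<^sub>E strands" "inj_on i U" and j: "j \<in> U \<rightarrow>\<^sub>E strands"
    and st: "\<And>u. u \<in> U \<Longrightarrow> fst (j u) = fst (i u)"
    and ord: "\<And>u v. u \<in> U \<Longrightarrow> v \<in> U \<Longrightarrow> fst (i u) = fst (i v) \<Longrightarrow> snd (i u) < snd (i v) \<Longrightarrow> snd (j u) < snd (j v)"
  shows "homotopic_with (\<lambda>k. inj_on k U) (discrete_topology U) (top_of_set strands) i j" "inj_on j U"
proof -
  let ?X = "prod_topology (top_of_set {0..1::real}) (discrete_topology U)"
  define F where "F = (\<lambda>(t::real, u). if u \<in> U then (fst (i u), (1 - t) * snd (i u) + t * snd (j u)) else undefined)"
  have lt: "(1 - t) * a + t * b < (1 - t) * a' + t * b'" if "0 \<le> t" "t \<le> 1" "a < a'" "b < b'" for t a b a' b' :: real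
  proof (cases "t = 1")
    case False
    have "(1 - t) * a < (1 - t) * a'" using that False by (intro mult_strict_left_mono) auto
    moreover have "t * b \<le> t * b'" using that by (intro mult_left_mono) auto
    ultimately show ?thesis by simp
  qed (use that in simp)
  have inj: "inj_on (\<lambda>u. F (t, u)) U" if t: "0 \<le> t" "t \<le> 1" for t
  proof (rule inj_onI, rule ccontr)
    fix u v assume uv: "u \<in> U" "v \<in> U" "F (t, u) = F (t, v)" "u \<noteq> v"
    then have f: "fst (i u) = fst (i v)" by (simp add: F_def)
    have "i u \<noteq> i v" using inj_onD[OF i(2) _ uv(1,2)] uv(4) by blast
    then consider "snd (i u) < snd (i v)" | "snd (i v) < snd (i u)"
      using f by (metis linorder_less_linear prod.expand)
    then show False
    proof cases
      case 1
      from lt[OF t this ord[OF uv(1,2) f this]] uv show False by (simp add: F_def)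
    next
      case 2
      from lt[OF t this ord[OF uv(2,1) f[symmetric] this]] uv show False by (simp add: F_def)
    qed
  qed
  have F0: "F (0, u) = i u" and F1: "F (1, u) = j u" for u
    using i(1) j st[of u] by (auto simp: F_def PiE_def extensional_def prod_eq_iff)
  show "inj_on j U" using inj[of 1] by (simp add: F1)
  have cont: "continuous_on {0..1} (\<lambda>t. F (t, u))" if "u \<in> U" for u
    using that by (auto simp: F_def intro!: continuous_intros)
  have "continuous_map ?X (top_of_set strands) F"
    unfolding continuous_map_def
  proof (intro conjI allI impI)
    show "F \<in> topspace ?X \<rightarrow> topspace (top_of_set strands)"
      using i(1) by (auto simp: F_def strands_def PiE_def Pi_def)
    fix V assume "openin (top_of_set strands) V"
    then obtain T where T: "open T" "V = strands \<inter> T" by (auto simp: openin_open)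
    have s: "F (t, u) \<in> strands" if "u \<in> U" for t u
      using i(1) that by (auto simp: F_def strands_def PiE_def Pi_def)
    have "{y \<in> topspace ?X. F y \<in> V}
        = (\<Union>u\<in>U. {t \<in> {0..1}. F (t, u) \<in> T} \<times> {u})"
      using s T by auto
    also have "openin ?X \<dots>"
    proof (intro openin_Union ballI)
      fix S assume "S \<in> (\<lambda>u. {t \<in> {0..1}. F (t, u) \<in> T} \<times> {u}) ` U"
      then obtain u where u: "u \<in> U" "S = {t \<in> {0..1}. F (t, u) \<in> T} \<times> {u}" by auto
      have "openin (top_of_set {0..1}) ({0..1} \<inter> (\<lambda>t. F (t, u)) -` T)"
        using cont[OF u(1)] T(1) by (rule continuous_openin_preimage_gen)
      moreover have "{0..1} \<inter> (\<lambda>t. F (t, u)) -` T = {t \<in> {0..1}. F (t, u) \<in> T}" by blast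
      ultimately have "openin (top_of_set {0..1}) {t \<in> {0..1}. F (t, u) \<in> T}" by (simp only:)
      then show "openin ?X S"
        using u by (simp add: openin_prod_Times_iff)
    qed
    finally show "openin ?X
        {y \<in> topspace ?X. F y \<in> V}" .
  qed
  then show "homotopic_with (\<lambda>k. inj_on k U) (discrete_topology U) (top_of_set strands) i j"
    unfolding homotopic_with_def using F0 F1 inj by (intro exI[of _ F]) auto
qed

context diagram begin

definition legs_ordered :: "(nat \<Rightarrow> real) \<Rightarrow> bool"
  where "legs_ordered x \<longleftrightarrow>
    (\<lambda>u\<in>univalent \<Gamma>. (strand_of \<Gamma> u, x (first_half \<Gamma> u))) \<in> legs \<Gamma>"

lemma legs_same_order:
  assumes i: "i \<in> legs \<Gamma>" and j: "j \<in> U \<rightarrow>\<^sub>E strands"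
    and st: "\<And>u. u \<in> U \<Longrightarrow> fst (j u) = fst (i u)"
    and ord: "\<And>u v. u \<in> U \<Longrightarrow> v \<in> U \<Longrightarrow> fst (i u) = fst (i v) \<Longrightarrow> snd (i u) < snd (i v) \<Longrightarrow> snd (j u) < snd (j v)"
  shows "j \<in> legs \<Gamma>"
proof -
  obtain i0 where i0: "legs \<Gamma> = isotopy_class U i0" using jd by (auto simp: jacobi_diagram_def)
  have i': "i \<in> U \<rightarrow>\<^sub>E strands" "inj_on i U"
    "homotopic_with (\<lambda>k. inj_on k U) (discrete_topology U) (top_of_set strands) i0 i"
    using i i0 by (auto simp: isotopy_class_def)
  have "homotopic_with (\<lambda>k. inj_on k U) (discrete_topology U) (top_of_set strands) i j"
    using i'(1,2) j st ord by (rule isotopic_if_same_order(1))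
  then have "homotopic_with (\<lambda>k. inj_on k U) (discrete_topology U) (top_of_set strands) i0 j"
    by (rule homotopic_with_trans[OF i'(3)])
  moreover have "inj_on j U"
    using i'(1,2) j st ord by (rule isotopic_if_same_order(2))
  ultimately show ?thesis
    unfolding i0 isotopy_class_def using j by blast
qed

lemma legs_ordered_mono:
  assumes "legs_ordered x"
    and "\<And>u v. u \<in> U \<Longrightarrow> v \<in> U \<Longrightarrow> strand_of \<Gamma> u = strand_of \<Gamma> v \<Longrightarrow>
      x (first_half \<Gamma> u) < x (first_half \<Gamma> v) \<Longrightarrow> x' (first_half \<Gamma> u) < x' (first_half \<Gamma> v)"
  shows "legs_ordered x'"
  unfolding legs_ordered_def
  by (rule legs_same_order[OF assms(1)[unfolded legs_ordered_def]])
    (use assms(2) strand_of_cases in \<open>auto simp: strands_def\<close>)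

lemma legs_ordered_cong: "(\<And>h. h \<in> H \<Longrightarrow> x h = x' h) \<Longrightarrow> legs_ordered x \<longleftrightarrow> legs_ordered x'"
proof -
  assume "\<And>h. h \<in> H \<Longrightarrow> x h = x' h"
  then have "(\<lambda>u\<in>U. (strand_of \<Gamma> u, x (first_half \<Gamma> u))) = (\<lambda>u\<in>U. (strand_of \<Gamma> u, x' (first_half \<Gamma> u)))"
    using star_first_half by (intro restrict_ext) auto
  then show ?thesis by (simp add: legs_ordered_def)
qed

text \<open>Whether the legs are ordered as prescribed depends only on the set of pairs of legs that are in
  increasing order, and there are finitely many such sets.\<close>

lemma measurable_legs_ordered: "{x \<in> space (LB H). legs_ordered x} \<in> sets (LB H)"
proof -
  define pat where "pat x = {(u, v). u \<in> U \<and> v \<in> U \<and> strand_of \<Gamma> u = strand_of \<Gamma> v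
    \<and> x (first_half \<Gamma> u) < (x (first_half \<Gamma> v) :: real)}" for x
  define PT where "PT = {\<rho> \<in> Pow (U \<times> U). \<exists>x0. legs_ordered x0 \<and> pat x0 = \<rho>}"
  have pats: "pat x \<in> Pow (U \<times> U)" for x by (auto simp: pat_def)
  have "legs_ordered x \<longleftrightarrow> (\<exists>\<rho>\<in>PT. pat x = \<rho>)" for x
  proof
    assume "\<exists>\<rho>\<in>PT. pat x = \<rho>"
    then obtain x0 where x0: "legs_ordered x0" "pat x0 = pat x" by (auto simp: PT_def)
    show "legs_ordered x"
    proof (rule legs_ordered_mono[OF x0(1)])
      fix u v assume "u \<in> U" "v \<in> U" "strand_of \<Gamma> u = strand_of \<Gamma> v" "x0 (first_half \<Gamma> u) < x0 (first_half \<Gamma> v)"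
      then have "(u, v) \<in> pat x0" by (simp add: pat_def)
      then show "x (first_half \<Gamma> u) < x (first_half \<Gamma> v)" unfolding x0(2) by (simp add: pat_def)
    qed
  qed (use pats PT_def in blast)
  moreover have "{x \<in> space (LB H). \<exists>\<rho>\<in>PT. pat x = \<rho>} \<in> sets (LB H)"
  proof (rule sets.sets_Collect_finite_Ex)
    fix \<rho> assume \<rho>: "\<rho> \<in> PT"
    have e: "pat x = \<rho> \<longleftrightarrow> (\<forall>u\<in>U. \<forall>v\<in>U. (if strand_of \<Gamma> u = strand_of \<Gamma> v then
       (if (u, v) \<in> \<rho> then x (first_half \<Gamma> u) < x (first_half \<Gamma> v)
        else \<not> x (first_half \<Gamma> u) < x (first_half \<Gamma> v)) else (u, v) \<notin> \<rho>))" for x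
      using \<rho> unfolding PT_def by (auto simp: pat_def split: if_splits)
    have c: "(\<lambda>x. x (first_half \<Gamma> u)) \<in> borel_measurable (LB H)" if "u \<in> U" for u
      using measurable_component_singleton[OF star_first_half(1)[OF that], of "\<lambda>_. lborel :: real measure"] by simp
    show "{x \<in> space (LB H). pat x = \<rho>} \<in> sets (LB H)"
      unfolding e
    proof (intro sets.sets_Collect_finite_All)
      fix u v assume uv: "u \<in> U" "v \<in> U"
      have "{x \<in> space (LB H). x (first_half \<Gamma> u) < x (first_half \<Gamma> v)} \<in> sets (LB H)"
        by (rule borel_measurable_less[OF c[OF uv(1)] c[OF uv(2)]])
      moreover from sets.sets_Collect_neg[OF this]
      have "{x \<in> space (LB H). \<not> x (first_half \<Gamma> u) < x (first_half \<Gamma> v)} \<in> sets (LB H)" .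
      ultimately show "{x \<in> space (LB H). if strand_of \<Gamma> u = strand_of \<Gamma> v then
       (if (u, v) \<in> \<rho> then x (first_half \<Gamma> u) < x (first_half \<Gamma> v)
        else \<not> x (first_half \<Gamma> u) < x (first_half \<Gamma> v)) else (u, v) \<notin> \<rho>} \<in> sets (LB H)"
        by auto
    qed auto
  qed (auto simp: PT_def intro: finite_subset[of _ "Pow (U \<times> U)"])
  ultimately show ?thesis by (simp only:)
qed

lemma chart_domain_iff:
  assumes "(\<theta>, x) \<in> space (chart_measure \<Gamma>)"
  shows "(\<theta>, x) \<in> chart_domain \<Gamma> \<longleftrightarrow> \<theta> \<in> {0..<2 * pi} \<and> inj_on (slice_conf \<Gamma> (\<theta>, x)) (verts \<Gamma>)
    \<and> legs_ordered (x(h0 := 0))"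
proof -
  define x0 where "x0 = x(h0 := 0)"
  define c0 where "c0 = slice_conf \<Gamma> (\<theta>, x)"
  have c0: "c0 = conf \<Gamma> \<theta> x0" by (simp add: c0_def slice_conf_def x0_def)
  have c0_ext: "c0 \<in> extensional (verts \<Gamma>)" by (simp add: c0 conf_def)
  have c0U: "c0 u = two_lines (cos \<theta>, sin \<theta>) (strand_of \<Gamma> u, x0 (first_half \<Gamma> u))" if "u \<in> U" for u
    using that by (simp add: c0 conf_def univalent_def)
  have "(\<theta>, x) \<in> chart_domain \<Gamma> \<longleftrightarrow> \<theta> \<in> {0..<2 * pi} \<and>
      (\<exists>c\<in>config_space (two_lines (cos \<theta>, sin \<theta>)) \<Gamma>. vertical_orbit \<Gamma> c0 = vertical_orbit \<Gamma> c)"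
    using assms by (auto simp: chart_domain_def C_chart_def C_space_def C_theta_def c0_def)
  moreover have "(\<exists>c\<in>config_space (two_lines (cos \<theta>, sin \<theta>)) \<Gamma>. vertical_orbit \<Gamma> c0 = vertical_orbit \<Gamma> c)
      \<longleftrightarrow> inj_on c0 (verts \<Gamma>) \<and> legs_ordered x0" (is "?L \<longleftrightarrow> ?R")
  proof
    assume ?R
    then have "c0 \<in> config_space (two_lines (cos \<theta>, sin \<theta>)) \<Gamma>"
      unfolding config_space_def legs_ordered_def using c0_ext c0U
      by (auto intro!: bexI[of _ "\<lambda>u\<in>U. (strand_of \<Gamma> u, x0 (first_half \<Gamma> u))"])
    then show ?L by blast
  next
    assume ?L
    then obtain c where c: "c \<in> config_space (two_lines (cos \<theta>, sin \<theta>)) \<Gamma>"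
      "vertical_orbit \<Gamma> c0 = vertical_orbit \<Gamma> c" by auto
    have "c0 = (\<lambda>v\<in>verts \<Gamma>. c0 v + vector [0, 0, 0])"
      using c0_ext by (simp add: extensional_restrict)
    then have "c0 \<in> vertical_orbit \<Gamma> c0" unfolding vertical_orbit_def by blast
    then have "c0 \<in> vertical_orbit \<Gamma> c" using c(2) by (simp only:)
    then obtain z where z: "c0 = (\<lambda>v\<in>verts \<Gamma>. c v + vector [0, 0, z])"
      unfolding vertical_orbit_def by (rule imageE)
    obtain i where i: "i \<in> legs \<Gamma>" "\<And>u. u \<in> U \<Longrightarrow> c u = two_lines (cos \<theta>, sin \<theta>) (i u)"
      using c(1) by (auto simp: config_space_def)
    have "inj_on c0 (verts \<Gamma>)"
      using c(1) by (auto simp: config_space_def z inj_on_def)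
    moreover have "legs_ordered x0"
      unfolding legs_ordered_def
    proof (rule legs_same_order[OF i(1)])
      show "(\<lambda>u\<in>U. (strand_of \<Gamma> u, x0 (first_half \<Gamma> u))) \<in> U \<rightarrow>\<^sub>E strands"
        using strand_of_cases by (auto simp: strands_def)
      show "fst ((\<lambda>u\<in>U. (strand_of \<Gamma> u, x0 (first_half \<Gamma> u))) u) = fst (i u)" if "u \<in> U" for u
        using strand_of_eq[OF jd i(1) that] that by simp
      have xi: "x0 (first_half \<Gamma> u) = snd (i u) + (if fst (i u) = 1 then z else - z)" if u: "u \<in> U" for u
      proof -
        have "c0 u $ 3 = c u $ 3 + z" using z u by (simp add: univalent_def)
        then show ?thesis
          using c0U[OF u] i(2)[OF u] strand_of_eq[OF jd i(1) u]
          by (cases "i u") (auto simp: two_lines_def split: if_splits)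
      qed
      show "snd ((\<lambda>u\<in>U. (strand_of \<Gamma> u, x0 (first_half \<Gamma> u))) u) < snd ((\<lambda>u\<in>U. (strand_of \<Gamma> u, x0 (first_half \<Gamma> u))) v)"
        if "u \<in> U" "v \<in> U" "fst (i u) = fst (i v)" "snd (i u) < snd (i v)" for u v
        using that by (simp add: xi)
    qed
    ultimately show ?R by blast
  qed
  ultimately show ?thesis by (simp add: c0_def x0_def)
qed

lemma height:
  assumes "v \<in> verts \<Gamma>"
  obtains h \<epsilon> where "h \<in> star v" "\<epsilon> = 1 \<or> \<epsilon> = (- 1 :: real)" "\<forall>s y. place s y v $ 3 = \<epsilon> * snd y h"
proof (cases "v \<in> U")
  case True
  note F = star_first_half[OF True]
  have "place s y v $ 3 = (dirn (first_half \<Gamma> v) $ 3) * snd y (first_half \<Gamma> v)" for s y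
    using place_univalent[OF F(1), unfolded F(2), OF True] by simp
  moreover have "dirn (first_half \<Gamma> v) $ 3 = 1 \<or> dirn (first_half \<Gamma> v) $ 3 = - 1"
    using dirn_univalent[of "first_half \<Gamma> v"] F True by auto
  ultimately show thesis using that[of "first_half \<Gamma> v"] F by blast
next
  case False
  then have v: "v \<in> trivalent \<Gamma>" using assms verts_cases by auto
  obtain a b c where "star v = {a, b, c}" "distinct [a, b, c]"
    "dirn a = axis 1 1" "dirn b = axis 2 1" "dirn c = axis 3 1"
    by (rule trivalent_halves[OF v])
  then have "c \<in> star v" "place s y v $ 3 = 1 * snd y c" for s y
    by (simp_all add: place_trivalent[OF v])
  then show thesis using that by blast
qed

text \<open>For distinct vertices the heights are, up to sign, distinct coordinates, one of which may be the
  coordinate of \<open>base_half\<close>, fixed to zero. So the heights differ almost everywhere, for all angles at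
  once.\<close>

lemma AE_inj_place: "AE x in LB (H - {h0}). \<forall>\<theta>. inj_on (slice_conf \<Gamma> (\<theta>, x)) (verts \<Gamma>)"
proof -
  have "\<forall>v\<in>verts \<Gamma>. \<exists>he. fst he \<in> star v \<and> (snd he = 1 \<or> snd he = (- 1 :: real)) \<and>
      (\<forall>s y. place s y v $ 3 = snd he * snd y (fst he))"
  proof
    fix v assume v: "v \<in> verts \<Gamma>"
    obtain h \<epsilon> where "h \<in> star v" "\<epsilon> = 1 \<or> \<epsilon> = (- 1 :: real)" "\<forall>s y. place s y v $ 3 = \<epsilon> * snd y h"
      by (rule height[OF v])
    then show "\<exists>he. fst he \<in> star v \<and> (snd he = 1 \<or> snd he = (- 1 :: real)) \<and>
      (\<forall>s y. place s y v $ 3 = snd he * snd y (fst he))"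
      by (intro exI[of _ "(h, \<epsilon>)"]) simp
  qed
  from bchoice[OF this] obtain f where f: "\<forall>v\<in>verts \<Gamma>. fst (f v) \<in> star v \<and> (snd (f v) = 1 \<or> snd (f v) = (- 1 :: real)) \<and>
      (\<forall>s y. place s y v $ 3 = snd (f v) * snd y (fst (f v)))" ..
  define hh where "hh v = fst (f v)" for v
  define ee where "ee v = snd (f v)" for v
  have he: "hh v \<in> star v" "ee v = 1 \<or> ee v = (- 1 :: real)" "place s y v $ 3 = ee v * snd y (hh v)"
    if "v \<in> verts \<Gamma>" for v s y
    using bspec[OF f that] unfolding hh_def ee_def by blast+
  have one: "AE x in LB (H - {h0}). ee v * (x(h0 := 0)) (hh v) \<noteq> ee w * (x(h0 := 0)) (hh w)"
    if vw: "v \<in> verts \<Gamma>" "w \<in> verts \<Gamma>" "v \<noteq> w" "hh v \<noteq> h0" for v w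
  proof -
    have "hh v \<in> H" "vtx \<Gamma> (hh v) = v" "hh w \<in> H" "vtx \<Gamma> (hh w) = w"
      using he(1)[OF vw(1)] he(1)[OF vw(2)] by simp_all
    then have hv: "hh v \<in> H - {h0}" "hh w \<in> H" "hh v \<noteq> hh w" using vw by auto
    have "(\<lambda>x. (x(h0 := 0)) (hh w)) \<in> borel_measurable (LB (H - {h0}))"
      using measurable_compose[OF measurable_LB_upd[OF base_half(1)[OF jd ne]]
          measurable_component_singleton[OF hv(2), of "\<lambda>_. lborel :: real measure"]] by simp
    then have "AE x in LB (H - {h0}). x (hh v) \<noteq> ee v * ee w * (x(h0 := 0)) (hh w)"
      using hv by (intro AE_coordinate_neq) auto
    then show ?thesis
      by (rule eventually_mono) (use he(2)[OF vw(1)] he(2)[OF vw(2)] vw(4) in auto)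
  qed
  have both: "AE x in LB (H - {h0}). v \<noteq> w \<longrightarrow> ee v * (x(h0 := 0)) (hh v) \<noteq> ee w * (x(h0 := 0)) (hh w)"
    if vw: "v \<in> verts \<Gamma>" "w \<in> verts \<Gamma>" for v w
  proof (cases "v = w")
    case False
    have "hh v \<noteq> h0 \<or> hh w \<noteq> h0" using he(1)[OF vw(1)] he(1)[OF vw(2)] False by force
    then show ?thesis
    proof
      assume "hh v \<noteq> h0"
      from one[OF vw False this] show ?thesis by (rule eventually_mono) simp
    next
      assume "hh w \<noteq> h0"
      from one[OF vw(2,1) False[symmetric] this] show ?thesis by (rule eventually_mono) auto
    qed
  qed simp
  have "AE x in LB (H - {h0}). \<forall>v\<in>verts \<Gamma>. \<forall>w\<in>verts \<Gamma>. v \<noteq> w \<longrightarrow>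
      ee v * (x(h0 := 0)) (hh v) \<noteq> ee w * (x(h0 := 0)) (hh w)"
    using both by (intro AE_finite_allI finite_verts) auto
  then show ?thesis
  proof (rule eventually_mono)
    fix x :: "nat \<Rightarrow> real"
    assume *: "\<forall>v\<in>verts \<Gamma>. \<forall>w\<in>verts \<Gamma>. v \<noteq> w \<longrightarrow> ee v * (x(h0 := 0)) (hh v) \<noteq> ee w * (x(h0 := 0)) (hh w)"
    have "v = w" if vw: "v \<in> verts \<Gamma>" "w \<in> verts \<Gamma>" "slice_conf \<Gamma> (\<theta>, x) v = slice_conf \<Gamma> (\<theta>, x) w" for \<theta> v w
    proof (rule ccontr)
      assume "v \<noteq> w"
      have "place 2 ((cos \<theta>, sin \<theta>), x(h0 := 0)) v = place 2 ((cos \<theta>, sin \<theta>), x(h0 := 0)) w"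
        using vw by (simp add: slice_conf_def conf_eq_place)
      then have "ee v * snd ((cos \<theta>, sin \<theta>), x(h0 := 0)) (hh v) = ee w * snd ((cos \<theta>, sin \<theta>), x(h0 := 0)) (hh w)"
        unfolding he(3)[OF vw(1), of 2, symmetric] he(3)[OF vw(2), of 2, symmetric] by (simp only:)
      then show False using * vw \<open>v \<noteq> w\<close> by (simp only: snd_conv) blast
    qed
    then show "\<forall>\<theta>. inj_on (slice_conf \<Gamma> (\<theta>, x)) (verts \<Gamma>)" by (simp add: inj_on_def)
  qed
qed

end


section \<open>Vanishing of the integral\<close>

lemma borel_measurable_cross3 [measurable]:
  assumes "f \<in> borel_measurable M" "g \<in> borel_measurable M"
  shows "(\<lambda>x. cross3 (f x) (g x)) \<in> borel_measurable M"
  using assms by (rule borel_measurable_continuous_Pair) (intro continuous_on_cross continuous_on_fst continuous_on_snd continuous_on_id)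

lemma borel_measurable_dir_form [measurable]:
  assumes [measurable]: "d \<in> borel_measurable M" "f \<in> borel_measurable M" "g \<in> borel_measurable M"
  shows "(\<lambda>x. dir_form (d x) (f x) (g x)) \<in> borel_measurable M"
  unfolding dir_form_def by measurable

context enumerated begin

text \<open>For \<open>\<sigma> = 1\<close> and \<open>\<sigma> = -1\<close> the positive and the negative part of the integrand, extended to all
  positions of the moving strand.\<close>

definition signed_density :: "nat \<Rightarrow> real \<Rightarrow> param \<Rightarrow> ennreal"
  where "signed_density s \<sigma> y
    = ennreal (\<sigma> * config_density s y) * indicator {x. legs_ordered x} (snd y)"

text \<open>The integral over the configurations modulo vertical translations, for a fixed position of the
  moving strand; the slice on which the coordinate of \<open>i\<close> is zero represents the quotient.\<close>

definition fibre_integral :: "nat \<Rightarrow> nat \<Rightarrow> real \<Rightarrow> real \<times> real \<Rightarrow> ennreal"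
  where "fibre_integral s i \<sigma> p = (\<integral>\<^sup>+x. signed_density s \<sigma> (p, x(i := 0)) \<partial>LB (H - {i}))"

lemma measurable_coordinate: "h \<in> H \<Longrightarrow> (\<lambda>y. snd y h) \<in> borel_measurable (par H)"
  using measurable_compose[OF measurable_snd measurable_component_singleton[of h H "\<lambda>_. lborel"]] by simp

lemma measurable_place: "(\<lambda>y. place s y v) \<in> borel_measurable (par H)"
proof -
  have "(\<lambda>y. \<Sum>h\<in>star v. snd y h *\<^sub>R dirn h) \<in> borel_measurable (par H)"
    by (intro borel_measurable_sum borel_measurable_scaleR measurable_coordinate) auto
  then show ?thesis
    unfolding place_def horizontal_def by (cases "v \<in> legs_on \<Gamma> s") auto
qed

lemma measurable_edge_vec [measurable]: "(\<lambda>y. edge_vec s k y) \<in> borel_measurable (par H)"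
  unfolding edge_vec_def by (intro borel_measurable_diff measurable_place)

lemma measurable_edge_vec_frame [measurable]:
  "(\<lambda>y. edge_vec s k (chart_frame (fst y) i)) \<in> borel_measurable (par H)"
proof (cases i)
  case 0
  have "edge_vec s k (chart_frame p i)
      = (- snd p) *\<^sub>R edge_vec s k unit_x + fst p *\<^sub>R edge_vec s k unit_y" for p
    using edge_vec_linear[of s k "(- snd p, fst p)" "\<lambda>_. 0"] by (simp add: 0 frame_0)
  then show ?thesis by simp
qed (simp add: frame_Suc)

lemma measurable_config_density [measurable]: "config_density s \<in> borel_measurable (par H)"
  unfolding config_density_def[abs_def] edge_wedge_def wedge_two_forms_def by measurable

lemma measurable_signed_density [measurable]: "signed_density s \<sigma> \<in> borel_measurable (par H)"
proof -
  have "{x. legs_ordered x} \<inter> space (LB H) = {x \<in> space (LB H). legs_ordered x}" by blast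
  then have "(indicator {x. legs_ordered x} :: _ \<Rightarrow> ennreal) \<in> borel_measurable (LB H)"
    using measurable_legs_ordered by (simp only: borel_measurable_indicator_iff)
  note [measurable] = measurable_compose[OF measurable_snd this]
  show ?thesis unfolding signed_density_def[abs_def] by measurable
qed

lemma measurable_slice [measurable]:
  assumes "i \<in> H"
  shows "(\<lambda>y. signed_density s \<sigma> (fst y, (snd y)(i := 0))) \<in> borel_measurable (par (H - {i}))"
proof -
  note [measurable] = measurable_compose[OF measurable_snd measurable_LB_upd[OF assms]]
  have "(\<lambda>y. (fst y, (snd y)(i := 0))) \<in> measurable (par (H - {i})) (par H)" by measurable
  then show ?thesis by (rule measurable_compose) measurable
qed

lemma measurable_slice_at:
  assumes "i \<in> H"
  shows "(\<lambda>x. signed_density s \<sigma> (p, x(i := 0))) \<in> borel_measurable (LB (H - {i}))"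
proof -
  have "p \<in> space plane" by (simp add: space_pair_measure)
  from measurable_compose[OF measurable_Pair1'[OF this] measurable_slice[OF assms]] show ?thesis by simp
qed

lemma signed_density_cong:
  "(\<And>h. h \<in> H \<Longrightarrow> x h = x' h) \<Longrightarrow> signed_density s \<sigma> (p, x) = signed_density s \<sigma> (p, x')"
  using config_density_cong[of x x' s p] legs_ordered_cong[of x x'] by (simp add: signed_density_def indicator_def)

lemma legs_ordered_monotone_iff:
  assumes "\<And>u v. u \<in> U \<Longrightarrow> v \<in> U \<Longrightarrow> strand_of \<Gamma> u = strand_of \<Gamma> v \<Longrightarrow>
      x (first_half \<Gamma> u) < x (first_half \<Gamma> v) \<longleftrightarrow> x' (first_half \<Gamma> u) < x' (first_half \<Gamma> v)"
  shows "legs_ordered x \<longleftrightarrow> legs_ordered x'"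
  using legs_ordered_mono[of x x'] legs_ordered_mono[of x' x] assms by blast

lemma signed_density_scale:
  assumes r: "r > 0"
  shows "signed_density s \<sigma> ((r * a, r * b), \<lambda>h. r * x h)
    = ennreal (1 / r ^ (2 * m + 1)) * signed_density s \<sigma> ((a, b), x)"
proof -
  have "legs_ordered (\<lambda>h. r * x h) \<longleftrightarrow> legs_ordered x"
    using r by (intro legs_ordered_monotone_iff) auto
  moreover have "ennreal (\<sigma> * (d / r ^ (2 * m + 1))) = ennreal (1 / r ^ (2 * m + 1)) * ennreal (\<sigma> * d)" for d
    using r by (subst ennreal_mult'[symmetric]) auto
  ultimately show ?thesis
    by (simp only: signed_density_def config_density_scale[OF r] snd_conv mult.assoc) (simp add: indicator_def)
qed

lemma dirn_leg: "u \<in> U \<Longrightarrow> dirn (first_half \<Gamma> u) = (if strand_of \<Gamma> u = 1 then axis 3 1 else - axis 3 1)"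
  using dirn_univalent[of "first_half \<Gamma> u"] star_first_half(2)[of u] by simp

lemma signed_density_translate:
  "signed_density s \<sigma> (p, \<lambda>h. x h + \<tau> * (axis 3 1 \<bullet> dirn h)) = signed_density s \<sigma> (p, x)"
proof -
  have "legs_ordered (\<lambda>h. x h + \<tau> * (axis 3 1 \<bullet> dirn h)) \<longleftrightarrow> legs_ordered x"
    by (intro legs_ordered_monotone_iff) (auto simp: dirn_leg)
  then show ?thesis by (simp add: signed_density_def config_density_translate indicator_def)
qed

lemma signed_density_other_strand:
  "signed_density 2 \<sigma> ((a, b), x)
    = signed_density 1 \<sigma> ((- a, - b), \<lambda>h. x h - horizontal (a, b) \<bullet> dirn h)"
proof -
  have "legs_ordered (\<lambda>h. x h - horizontal (a, b) \<bullet> dirn h) \<longleftrightarrow> legs_ordered x"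
    by (intro legs_ordered_monotone_iff) (auto simp: dirn_leg inner_axis)
  then show ?thesis by (simp add: signed_density_def config_density_other_strand[of a b x] indicator_def)
qed

lemma card_H: "card H = 2 * m"
  using half_edge_order distinct_card by metis

lemma measurable_fibre_integral [measurable]: "i \<in> H \<Longrightarrow> fibre_integral s i \<sigma> \<in> borel_measurable plane"
  unfolding fibre_integral_def[abs_def]
  using sigma_finite_measure.borel_measurable_nn_integral_fst[OF sigma_finite_LB measurable_slice[of i s \<sigma>]]
  by simp

lemma fibre_integral_scale:
  assumes i: "i \<in> H" and r: "r > 0"
  shows "fibre_integral s i \<sigma> (r * a, r * b) = ennreal (1 / r\<^sup>2) * fibre_integral s i \<sigma> (a, b)"
proof -
  let ?I = "H - {i}" let ?f = "\<lambda>x. signed_density s \<sigma> ((r * a, r * b), x(i := 0))"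
  note f = measurable_slice_at[OF i]
  have c: "card ?I = 2 * m - 1" using i card_H by simp
  have "fibre_integral s i \<sigma> (r * a, r * b) = ennreal (r ^ (2 * m - 1)) * (\<integral>\<^sup>+x. ?f (\<lambda>h\<in>?I. 0 + r * x h) \<partial>LB ?I)"
    unfolding fibre_integral_def using nn_integral_PiM_affine[OF _ f, of r s \<sigma> "(r * a, r * b)" "\<lambda>_. 0"] r c by simp
  also have "(\<integral>\<^sup>+x. ?f (\<lambda>h\<in>?I. 0 + r * x h) \<partial>LB ?I)
      = (\<integral>\<^sup>+x. ennreal (1 / r ^ (2 * m + 1)) * signed_density s \<sigma> ((a, b), x(i := 0)) \<partial>LB ?I)"
  proof (rule nn_integral_cong)
    fix x
    have "?f (\<lambda>h\<in>?I. 0 + r * x h) = signed_density s \<sigma> ((r * a, r * b), \<lambda>h. r * (x(i := 0)) h)"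
      by (rule signed_density_cong) auto
    then show "?f (\<lambda>h\<in>?I. 0 + r * x h) = ennreal (1 / r ^ (2 * m + 1)) * signed_density s \<sigma> ((a, b), x(i := 0))"
      by (simp only: signed_density_scale[OF r])
  qed
  also have "\<dots> = ennreal (1 / r ^ (2 * m + 1)) * fibre_integral s i \<sigma> (a, b)"
    unfolding fibre_integral_def by (rule nn_integral_cmult[OF f])
  also have "ennreal (r ^ (2 * m - 1)) * (ennreal (1 / r ^ (2 * m + 1)) * fibre_integral s i \<sigma> (a, b))
      = ennreal (1 / r\<^sup>2) * fibre_integral s i \<sigma> (a, b)"
  proof -
    have "2 * m + 1 = (2 * m - 1) + 2" using chart_coordinates(4) by simp
    then have "r ^ (2 * m - 1) * (1 / r ^ (2 * m + 1)) = 1 / r\<^sup>2"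
      using r by (simp only: power_add) simp
    then have "ennreal (r ^ (2 * m - 1)) * ennreal (1 / r ^ (2 * m + 1)) = ennreal (1 / r\<^sup>2)"
      using r by (subst ennreal_mult[symmetric]) auto
    then show ?thesis by (simp only: mult.assoc[symmetric])
  qed
  finally show ?thesis .
qed

text \<open>If the integrand is not integrable, its Lebesgue integral is zero by convention; otherwise it is
  the difference of the two sides of the assumption.\<close>

lemma config_integral_zero:
  assumes eq: "(\<integral>\<^sup>+\<theta>. fibre_integral 2 h0 1 (cos \<theta>, sin \<theta>) * indicator {0..<2 * pi} \<theta> \<partial>lborel)
    = (\<integral>\<^sup>+\<theta>. fibre_integral 2 h0 (- 1) (cos \<theta>, sin \<theta>) * indicator {0..<2 * pi} \<theta> \<partial>lborel)"
  shows "config_integral \<Gamma> es = 0"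
proof -
  define P where "P y = product_sphere_form m (Psi \<Gamma> es (slice_conf \<Gamma> y)) (dPsi \<Gamma> es y)" for y
  define F where "F y = indicat_real (chart_domain \<Gamma>) y * P y" for y
  have "integral\<^sup>L (chart_measure \<Gamma>) F = 0"
  proof (cases "integrable (chart_measure \<Gamma>) F")
    case False
    then show ?thesis by (rule not_integrable_integral_eq)
  next
    case True
    then have [measurable]: "F \<in> borel_measurable (lborel \<Otimes>\<^sub>M LB (H - {h0}))"
      by (auto simp: chart_measure_def)
    have I: "(\<integral>\<^sup>+y. ennreal (\<sigma> * F y) \<partial>chart_measure \<Gamma>)
        = (\<integral>\<^sup>+\<theta>. fibre_integral 2 h0 \<sigma> (cos \<theta>, sin \<theta>) * indicator {0..<2 * pi} \<theta> \<partial>lborel)" for \<sigma>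
    proof -
      have "(\<integral>\<^sup>+y. ennreal (\<sigma> * F y) \<partial>chart_measure \<Gamma>)
          = (\<integral>\<^sup>+\<theta>. \<integral>\<^sup>+x. ennreal (\<sigma> * F (\<theta>, x)) \<partial>LB (H - {h0}) \<partial>lborel)"
        unfolding chart_measure_def
        by (rule sigma_finite_measure.nn_integral_fst[OF sigma_finite_LB, symmetric]) auto
      also have "\<dots> = (\<integral>\<^sup>+\<theta>. \<integral>\<^sup>+x. signed_density 2 \<sigma> ((cos \<theta>, sin \<theta>), x(h0 := 0)) *
          indicator {0..<2 * pi} \<theta> \<partial>LB (H - {h0}) \<partial>lborel)"
      proof (rule nn_integral_cong, rule nn_integral_cong_AE, use AE_inj_place AE_space in eventually_elim)
        fix \<theta> :: real and x
        assume inj: "\<forall>\<theta>. inj_on (slice_conf \<Gamma> (\<theta>, x)) (verts \<Gamma>)" and x: "x \<in> space (LB (H - {h0}))"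
        have sp: "(\<theta>, x) \<in> space (chart_measure \<Gamma>)" using x by (simp add: chart_measure_def space_pair_measure)
        have "P (\<theta>, x) = config_density 2 ((cos \<theta>, sin \<theta>), x(h0 := 0))"
          unfolding P_def by (rule integrand_eq_config_density) (use inj in blast)
        then show "ennreal (\<sigma> * F (\<theta>, x)) = signed_density 2 \<sigma> ((cos \<theta>, sin \<theta>), x(h0 := 0)) * indicator {0..<2 * pi} \<theta>"
          using chart_domain_iff[OF sp] inj by (simp add: F_def signed_density_def indicator_def)
      qed
      also have "\<dots> = (\<integral>\<^sup>+\<theta>. fibre_integral 2 h0 \<sigma> (cos \<theta>, sin \<theta>) * indicator {0..<2 * pi} \<theta> \<partial>lborel)"
        unfolding fibre_integral_def
        by (intro nn_integral_cong) (auto simp: indicator_def)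
      finally show ?thesis .
    qed
    show ?thesis
      using real_lebesgue_integral_def[OF True] I[of 1] I[of "- 1"] eq by simp
  qed
  then show ?thesis
    by (simp add: config_integral_def set_lebesgue_integral_def F_def[abs_def] P_def[abs_def])
qed

lemma config_integral_few_legs:
  assumes s: "s \<in> {1, 2}" and few: "card (legs_on \<Gamma> s) < 2" and many: "card (verts \<Gamma>) > 2"
  shows "config_integral \<Gamma> es = 0"
proof -
  have "product_sphere_form m (Psi \<Gamma> es (slice_conf \<Gamma> y)) (dPsi \<Gamma> es y) = 0" if y: "y \<in> chart_domain \<Gamma>" for y
  proof -
    obtain \<theta> x where yx: "y = (\<theta>, x)" by fastforce
    define a b where "a = cos \<theta>" and "b = sin \<theta>"
    have inj: "inj_on (slice_conf \<Gamma> (\<theta>, x)) (verts \<Gamma>)"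
      using y chart_domain_iff[of \<theta> x] by (auto simp: yx chart_domain_def)
    have sc: "slice_conf \<Gamma> (\<theta>, x) v = place 2 ((a, b), x(h0 := 0)) v" if "v \<in> verts \<Gamma>" for v
      using that by (simp add: slice_conf_eq_place a_def b_def)
    have inj2: "inj_on (place 2 ((a, b), x(h0 := 0))) (verts \<Gamma>)"
      using inj by (simp add: sc inj_on_def)
    have "config_density 2 ((a, b), x(h0 := 0)) = 0"
    proof (cases "s = 2")
      case True
      then show ?thesis using config_density_few_legs[OF _ many inj2] few by simp
    next
      case False
      then have s1: "s = 1" using s by simp
      have "inj_on (place 1 ((- a, - b), \<lambda>h. (x(h0 := 0)) h - horizontal (a, b) \<bullet> dirn h)) (verts \<Gamma>)"
        using inj2 by (simp add: inj_on_def place_other_strand del: fun_upd_apply)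
      then show ?thesis
        unfolding config_density_other_strand using few many s1 by (intro config_density_few_legs) auto
    qed
    then show ?thesis unfolding yx using integrand_eq_config_density[OF inj] by (simp add: a_def b_def)
  qed
  then have "(LINT y:chart_domain \<Gamma>|chart_measure \<Gamma>. product_sphere_form m (Psi \<Gamma> es (slice_conf \<Gamma> y)) (dPsi \<Gamma> es y)) = 0"
    unfolding set_lebesgue_integral_def
    by (intro integral_eq_zero_AE AE_I2) (auto simp: indicator_def)
  then show ?thesis by (simp add: config_integral_def)
qed

end


lemma AE_plane_fst_neq: "AE p in plane. fst p \<noteq> c"
proof -
  have "AE a in lborel. AE b in lborel. a \<noteq> c"
    using AE_lborel_singleton[of c] by (rule eventually_mono) simp
  then show ?thesis
    by (intro lborel_pair.AE_pair_measure[OF borel_measurable_neq]) simp_all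
qed

lemma AE_par_fst_neq:
  assumes I: "finite I" and \<phi>[measurable]: "\<phi> \<in> borel_measurable (LB I)"
  shows "AE y in par I. fst (fst y) \<noteq> (\<phi> (snd y) :: real)"
proof -
  interpret pair_sigma_finite plane "LB I" by (rule pair_sigma_finite_par[OF I])
  have S: "{y \<in> space (par I). fst (fst y) \<noteq> \<phi> (snd y)} \<in> sets (par I)"
    by (rule borel_measurable_neq) measurable
  have "AE x in LB I. AE p in plane. fst p \<noteq> \<phi> x"
    by (intro AE_I2 AE_plane_fst_neq)
  then have "AE p in plane. AE x in LB I. fst p \<noteq> \<phi> x"
    using AE_commute[where P = "\<lambda>p x. fst p \<noteq> \<phi> x"] S by blast
  then show ?thesis
    using AE_pair_iff[where P = "\<lambda>p x. fst p \<noteq> \<phi> x"] S by blast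
qed

context enumerated begin

lemma fibre_integral_other_strand: "fibre_integral 2 h0 \<sigma> (a, b) = fibre_integral 1 h0 \<sigma> (- a, - b)"
proof -
  let ?I = "H - {h0}" and ?f = "\<lambda>x. signed_density 1 \<sigma> ((- a, - b), x(h0 := 0))"
  let ?t = "\<lambda>h. - (horizontal (a, b) \<bullet> dirn h)"
  note h0 = base_half[OF jd ne]
  note f = measurable_slice_at[OF h0(1)]
  have t0: "horizontal (a, b) \<bullet> dirn h0 = 0"
    using dirn_univalent[OF h0(2)] by (simp add: inner_axis)
  have "fibre_integral 1 h0 \<sigma> (- a, - b) = (\<integral>\<^sup>+x. ?f (\<lambda>h\<in>?I. ?t h + 1 * x h) \<partial>LB ?I)"
    unfolding fibre_integral_def using nn_integral_PiM_affine[OF _ f, of 1 1 \<sigma> "(- a, - b)" ?t] by simp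
  also have "\<dots> = fibre_integral 2 h0 \<sigma> (a, b)"
    unfolding fibre_integral_def
  proof (rule nn_integral_cong)
    fix x
    have "?f (\<lambda>h\<in>?I. ?t h + 1 * x h)
        = signed_density 1 \<sigma> ((- a, - b), \<lambda>h. (x(h0 := 0)) h - horizontal (a, b) \<bullet> dirn h)"
      by (rule signed_density_cong) (use t0 in auto)
    then show "?f (\<lambda>h\<in>?I. ?t h + 1 * x h) = signed_density 2 \<sigma> ((a, b), x(h0 := 0))"
      by (simp only: signed_density_other_strand)
  qed
  finally show ?thesis by simp
qed

text \<open>The angle is replaced by the position of the strand in an annulus. Passing from one moving
  strand to the other one turns \<open>p\<close> into \<open>-p\<close>, which preserves the annulus.\<close>

lemma angular_integral:
  assumes "s \<in> {1, 2}"
  shows "log_length * (\<integral>\<^sup>+\<theta>. fibre_integral 2 h0 \<sigma> (cos \<theta>, sin \<theta>) * indicator {0..<2 * pi} \<theta> \<partial>lborel)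
    = (\<integral>\<^sup>+p. fibre_integral s h0 \<sigma> p * indicator {1..2} (norm p) \<partial>plane)"
proof -
  note h0 = base_half(1)[OF jd ne]
  have n: "(\<lambda>p::real\<times>real. indicator {1..2} (norm p) :: ennreal) \<in> borel_measurable plane"
    by (simp add: norm_prod_def)
  have "log_length * (\<integral>\<^sup>+\<theta>. fibre_integral 2 h0 \<sigma> (cos \<theta>, sin \<theta>) * indicator {0..<2 * pi} \<theta> \<partial>lborel)
    = (\<integral>\<^sup>+p. fibre_integral 2 h0 \<sigma> p * indicator {1..2} (norm p) \<partial>plane)"
    by (rule nn_integral_annulus[symmetric, OF measurable_fibre_integral[OF h0] fibre_integral_scale[OF h0]])
  also have "\<dots> = (\<integral>\<^sup>+p. fibre_integral s h0 \<sigma> p * indicator {1..2} (norm p) \<partial>plane)"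
  proof (cases "s = 2")
    case False
    then have s: "s = 1" using assms by simp
    have "(\<integral>\<^sup>+p. fibre_integral 1 h0 \<sigma> p * indicator {1..2} (norm p) \<partial>plane)
        = (\<integral>\<^sup>+p. fibre_integral 1 h0 \<sigma> (0 + - 1 * fst p, 0 + - 1 * snd p)
          * indicator {1..2} (norm (0 + - 1 * fst p, 0 + - 1 * snd p)) \<partial>plane)"
      using nn_integral_plane_affine[OF borel_measurable_times_ennreal[OF measurable_fibre_integral[OF h0, of 1 \<sigma>] n], of "- 1" 0 0]
      by simp
    also have "\<dots> = (\<integral>\<^sup>+p. fibre_integral 2 h0 \<sigma> p * indicator {1..2} (norm p) \<partial>plane)"
      by (intro nn_integral_cong) (auto simp: fibre_integral_other_strand norm_prod_def)
    finally show ?thesis by (simp add: s)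
  qed simp
  finally show ?thesis .
qed

lemma fibre_integral_base:
  assumes hz: "hz \<in> H - {h0}" "dirn hz = axis 3 1"
  shows "fibre_integral s h0 \<sigma> p = fibre_integral s hz \<sigma> p"
  unfolding fibre_integral_def
proof (rule translation_slice_irrelevant[where z = "\<lambda>h. axis 3 1 \<bullet> dirn h"])
  note h0 = base_half[OF jd ne]
  have "p \<in> space plane" by (simp add: space_pair_measure)
  from measurable_compose[OF measurable_Pair1'[OF this] measurable_signed_density]
  show "(\<lambda>x. signed_density s \<sigma> (p, x)) \<in> borel_measurable (LB H)" .
  show "\<bar>axis 3 1 \<bullet> dirn h0\<bar> = 1" using dirn_univalent[OF h0(2)] by (simp add: inner_axis)
  show "\<bar>axis 3 1 \<bullet> dirn hz\<bar> = 1" using hz by (simp add: inner_axis)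
  show "signed_density s \<sigma> (p, \<lambda>h\<in>H. x h + \<tau> * (axis 3 1 \<bullet> dirn h)) = signed_density s \<sigma> (p, \<lambda>h\<in>H. x h)" for x \<tau>
  proof -
    have "signed_density s \<sigma> (p, \<lambda>h\<in>H. x h + \<tau> * (axis 3 1 \<bullet> dirn h))
        = signed_density s \<sigma> (p, \<lambda>h. x h + \<tau> * (axis 3 1 \<bullet> dirn h))"
      by (rule signed_density_cong) simp
    also have "\<dots> = signed_density s \<sigma> (p, x)" by (rule signed_density_translate)
    also have "\<dots> = signed_density s \<sigma> (p, \<lambda>h\<in>H. x h)" by (rule signed_density_cong) simp
    finally show ?thesis .
  qed
qed (use hz base_half[OF jd ne] in auto)

end

context two_legs begin

lemma first_half_legs: "u \<in> U \<Longrightarrow> first_half \<Gamma> u = l1 \<longleftrightarrow> u = vtx \<Gamma> l1" "u \<in> U \<Longrightarrow> first_half \<Gamma> u = l2 \<longleftrightarrow> u = vtx \<Gamma> l2"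
  using star_first_half[of u] vtx_legs(1,2) by metis+

lemma signed_density_reflect:
  assumes hx: "hx \<in> H - {h0, l1, l2}" and hz: "hz \<in> H - {h0, l1, l2}" and ne': "hx \<noteq> hz"
    and z1: "dirn hz = axis 3 1"
    and x: "snd y hz = 0" "snd y hx \<noteq> 0" and p: "fst y \<noteq> (0, 0)" "fst (reflect y) \<noteq> (0, 0)"
  shows "signed_density s \<sigma> (reflect y) = signed_density s (- \<sigma>) y"
proof -
  have "legs_ordered (snd (reflect y)) \<longleftrightarrow> legs_ordered (snd y)"
  proof (rule legs_ordered_monotone_iff)
    fix u v assume uv: "u \<in> U" "v \<in> U" "strand_of \<Gamma> u = strand_of \<Gamma> v"
    have leg: "w \<in> {vtx \<Gamma> l1, vtx \<Gamma> l2} \<longleftrightarrow> strand_of \<Gamma> w = s" if "w \<in> U" for w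
      using legs_s that by (auto simp: legs_on_def)
    show "snd (reflect y) (first_half \<Gamma> u) < snd (reflect y) (first_half \<Gamma> v)
      \<longleftrightarrow> snd y (first_half \<Gamma> u) < snd y (first_half \<Gamma> v)"
    proof (cases "strand_of \<Gamma> u = s")
      case True
      then have "u \<in> {vtx \<Gamma> l1, vtx \<Gamma> l2}" "v \<in> {vtx \<Gamma> l1, vtx \<Gamma> l2}" using leg uv by auto
      then have "first_half \<Gamma> u \<in> {l1, l2}" "first_half \<Gamma> v \<in> {l1, l2}"
        using first_half_legs uv by auto
      then show ?thesis using l(3) by (auto simp: reflect_def dirn_legs(1))
    next
      case False
      then have "first_half \<Gamma> u \<notin> {l1, l2}" "first_half \<Gamma> v \<notin> {l1, l2}"
        using leg uv first_half_legs by auto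
      then show ?thesis by (simp add: reflect_def)
    qed
  qed
  then show ?thesis
    by (simp add: signed_density_def config_density_reflect[OF assms] indicator_def)
qed

lemma neighbours_eq: "neighbours (p, x) = (\<Sum>h\<in>star v1. x h *\<^sub>R dirn h) + (\<Sum>h\<in>star v2. x h *\<^sub>R dirn h)"
  using tri by (simp add: neighbours_def place_trivalent)

lemma star_neighbours: "h \<in> star v1 \<or> h \<in> star v2 \<Longrightarrow> h \<noteq> l1 \<and> h \<noteq> l2"
  using tri_legs by auto

text \<open>Substituting the reflection exchanges the two signs and turns the annulus for \<open>p\<close> into one for the
  reflected position, that is \<open>Q x - p\<close> with \<open>Q x\<close> the horizontal part of the sum of the two neighbours.
  Both cut out fundamental domains of the dilations. The slice at a vertical coordinate \<open>hz\<close> of the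
  first neighbour is used because the reflection preserves it.\<close>

lemma reflection_integral:
  assumes hx: "hx \<in> H - {h0, l1, l2}" and hz: "hz \<in> H - {h0, l1, l2}" and hxz: "hx \<noteq> hz"
    and z1: "dirn hz = axis 3 1"
  shows "(\<integral>\<^sup>+p. fibre_integral s hz \<sigma> p * indicator {1..2} (norm p) \<partial>plane)
    = (\<integral>\<^sup>+p. fibre_integral s hz (- \<sigma>) p * indicator {1..2} (norm p) \<partial>plane)"
proof -
  define I where "I = H - {hz}"
  have I: "finite I" "l1 \<in> I" "l2 \<in> I" "hx \<in> I" "hz \<in> H" "card I + 2 = 2 * m + 1"
    using l hz hx hxz card_H chart_coordinates(4) by (auto simp: I_def)
  interpret pair_sigma_finite plane "LB I" by (rule pair_sigma_finite_par[OF I(1)])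
  define w :: "real \<Rightarrow> ennreal" where "w = indicator {1..2}"
  have w[measurable]: "w \<in> borel_measurable borel" by (simp add: w_def)
  have wn[measurable]: "(\<lambda>p::real\<times>real. w (norm p)) \<in> borel_measurable plane" by (simp add: norm_prod_def)
  define F where "F \<sigma> y = signed_density s \<sigma> (fst y, (snd y)(hz := 0))" for \<sigma> y
  have F[measurable]: "F \<sigma> \<in> borel_measurable (par I)" for \<sigma>
    unfolding F_def[abs_def] I_def using I(5) by (rule measurable_slice)
  define Q where "Q x = neighbours ((0, 0), x(hz := 0))" for x
  have Qp: "neighbours (p, x(hz := 0)) = Q x" for p x by (simp add: Q_def neighbours_eq)
  have Qm: "Q \<in> borel_measurable (LB I)"
  proof -
    note [measurable] = measurable_LB_upd[OF I(5), folded I_def]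
    have "(\<lambda>x. ((0, 0), x(hz := 0))) \<in> measurable (LB I) (par H)" by measurable
    moreover have "neighbours \<in> borel_measurable (par H)"
      unfolding neighbours_def[abs_def] by (intro borel_measurable_add measurable_place)
    ultimately show ?thesis unfolding Q_def[abs_def] by (rule measurable_compose)
  qed
  have Q1[measurable]: "(\<lambda>x. Q x $ 1) \<in> borel_measurable (LB I)" and Q2[measurable]: "(\<lambda>x. Q x $ 2) \<in> borel_measurable (LB I)"
    using borel_measurable_inner[OF Qm borel_measurable_const[of "axis 1 1"]]
      borel_measurable_inner[OF Qm borel_measurable_const[of "axis 2 1"]] by (simp_all add: inner_axis)
  have Qd[measurable]: "(\<lambda>x. Q x \<bullet> d) \<in> borel_measurable (LB I)" for d
    using borel_measurable_inner[OF Qm borel_measurable_const] .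
  have Qleg: "Q (x(l1 := t1, l2 := t2)) = Q x" for x t1 t2
    unfolding Q_def neighbours_eq using star_neighbours
    by (intro arg_cong2[where f = "(+)"] sum.cong) auto
  define swp where "swp x = x(l1 := Q x \<bullet> dirn l1 - x l2, l2 := Q x \<bullet> dirn l2 - x l1)" for x
  have Qswp: "Q (swp x) = Q x" for x by (simp add: swp_def Qleg)
  have c1: "(\<lambda>x. x l1) \<in> borel_measurable (LB I)" "(\<lambda>x. x l2) \<in> borel_measurable (LB I)"
    using measurable_component_singleton[OF I(2), of "\<lambda>_. lborel :: real measure"]
      measurable_component_singleton[OF I(3), of "\<lambda>_. lborel :: real measure"] by simp_all
  have swp[measurable]: "swp \<in> measurable (LB I) (LB I)"
  proof -
    have "(\<lambda>x. \<lambda>h\<in>I. swp x h) \<in> measurable (LB I) (LB I)"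
    proof (rule measurable_restrict)
      fix h assume "h \<in> I"
      note [measurable] = c1
      show "(\<lambda>x. swp x h) \<in> measurable (LB I) lborel"
        unfolding swp_def using measurable_component_singleton[OF \<open>h \<in> I\<close>, of "\<lambda>_. lborel :: real measure"]
        by (cases "h = l2"; cases "h = l1"; simp)
    qed
    moreover have "(\<lambda>h\<in>I. swp x h) = swp x" if "x \<in> space (LB I)" for x
      using that I(2,3) by (auto simp: space_PiM PiE_def extensional_def swp_def fun_eq_iff)
    ultimately show ?thesis by (simp cong: measurable_cong)
  qed
  define b where "b y = norm (Q (snd y) $ 1 - fst (fst y), Q (snd y) $ 2 - snd (fst y))" for y :: param
  have b[measurable]: "b \<in> borel_measurable (par I)"
    unfolding b_def[abs_def] norm_prod_def
    using measurable_compose[OF measurable_snd Q1] measurable_compose[OF measurable_snd Q2] by simp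
  define T where "T \<sigma> z = F \<sigma> ((Q (snd z) $ 1 - fst (fst z), Q (snd z) $ 2 - snd (fst z)), snd z) * w (b z)"
    for \<sigma> and z :: param
  have T[measurable]: "T \<sigma> \<in> borel_measurable (par I)" for \<sigma>
  proof -
    note [measurable] = measurable_compose[OF measurable_snd Q1] measurable_compose[OF measurable_snd Q2]
    have "(\<lambda>z. ((Q (snd z) $ 1 - fst (fst z), Q (snd z) $ 2 - snd (fst z)), snd z)) \<in> measurable (par I) (par I)"
      by measurable
    from measurable_compose[OF this F] show ?thesis unfolding T_def[abs_def] by measurable
  qed
  define G where "G \<sigma> x = (\<integral>\<^sup>+p. T \<sigma> (p, x) \<partial>plane)" for \<sigma> x
  have G[measurable]: "G \<sigma> \<in> borel_measurable (LB I)" for \<sigma>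
    unfolding G_def[abs_def]
    by (rule sigma_finite_measure.borel_measurable_nn_integral[OF sigma_finite_plane])
      (use T[of \<sigma>] in \<open>subst measurable_pair_swap_iff, simp add: split_beta'\<close>)
  have "(\<integral>\<^sup>+p. fibre_integral s hz \<sigma> p * indicator {1..2} (norm p) \<partial>plane)
      = (\<integral>\<^sup>+y. F \<sigma> y * w (norm (fst y)) \<partial>par I)" for \<sigma>
  proof -
    have "(\<integral>\<^sup>+y. F \<sigma> y * w (norm (fst y)) \<partial>par I) = (\<integral>\<^sup>+p. \<integral>\<^sup>+x. F \<sigma> (p, x) * w (norm p) \<partial>LB I \<partial>plane)"
      using measurable_compose[OF measurable_fst wn] by (subst nn_integral_par[OF I(1)]) auto
    also have "\<dots> = (\<integral>\<^sup>+p. fibre_integral s hz \<sigma> p * w (norm p) \<partial>plane)"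
    proof (rule nn_integral_cong)
      fix p :: "real \<times> real" assume p: "p \<in> space plane"
      have "(\<lambda>x. F \<sigma> (p, x)) \<in> borel_measurable (LB I)"
        by (rule measurable_compose[OF measurable_Pair1'[OF p] F])
      then show "(\<integral>\<^sup>+x. F \<sigma> (p, x) * w (norm p) \<partial>LB I) = fibre_integral s hz \<sigma> p * w (norm p)"
        by (subst nn_integral_multc) (simp_all add: fibre_integral_def F_def I_def)
    qed
    finally show ?thesis by (simp add: w_def)
  qed
  note fibre = this
  have "(\<integral>\<^sup>+y. F \<sigma> y * w (norm (fst y)) \<partial>par I) = (\<integral>\<^sup>+x. \<integral>\<^sup>+p. F \<sigma> (p, x) * w (norm p) \<partial>plane \<partial>LB I)"
    using measurable_compose[OF measurable_fst wn] by (subst nn_integral_par_swap[OF I(1)]) auto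
  also have "\<dots> = (\<integral>\<^sup>+x. G \<sigma> x \<partial>LB I)"
  proof (rule nn_integral_cong)
    fix x assume x: "x \<in> space (LB I)"
    have [measurable]: "(\<lambda>p. F \<sigma> (p, x)) \<in> borel_measurable plane"
      by (rule measurable_compose[OF measurable_Pair2'[OF x] F])
    have "(\<integral>\<^sup>+p. F \<sigma> (p, x) * w (norm p) \<partial>plane)
        = ennreal ((- 1)\<^sup>2) * (\<integral>\<^sup>+p. F \<sigma> ((Q x $ 1 + - 1 * fst p, Q x $ 2 + - 1 * snd p), x)
            * w (norm (Q x $ 1 + - 1 * fst p, Q x $ 2 + - 1 * snd p)) \<partial>plane)"
      by (rule nn_integral_plane_affine[where f = "\<lambda>p. F \<sigma> (p, x) * w (norm p)"]) simp_all
    then show "(\<integral>\<^sup>+p. F \<sigma> (p, x) * w (norm p) \<partial>plane) = G \<sigma> x"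
      by (simp add: G_def T_def b_def)
  qed
  also have "\<dots> = (\<integral>\<^sup>+x. G \<sigma> (swp x) \<partial>LB I)"
    using nn_integral_reflect_two[OF I(1,2,3) l(3) G, of "\<lambda>x. Q x \<bullet> dirn l1" "\<lambda>x. Q x \<bullet> dirn l2"]
      measurable_compose[OF swp G] by (simp add: Qleg swp_def[abs_def])
  also have "\<dots> = (\<integral>\<^sup>+x. \<integral>\<^sup>+p. F (- \<sigma>) (p, x) * w (b (p, x)) \<partial>plane \<partial>LB I)"
  proof (rule nn_integral_cong_AE)
    have "AE x in LB I. x hx \<noteq> 0"
      by (rule AE_coordinate_neq[OF I(1) I(4), of "\<lambda>_. 0"]) simp_all
    then show "AE x in LB I. G \<sigma> (swp x) = (\<integral>\<^sup>+p. F (- \<sigma>) (p, x) * w (b (p, x)) \<partial>plane)"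
    proof (rule eventually_mono)
      fix x :: "nat \<Rightarrow> real" assume x: "x hx \<noteq> 0"
      show "G \<sigma> (swp x) = (\<integral>\<^sup>+p. F (- \<sigma>) (p, x) * w (b (p, x)) \<partial>plane)"
        unfolding G_def
      proof (rule nn_integral_cong_AE)
        show "AE p in plane. T \<sigma> (p, swp x) = F (- \<sigma>) (p, x) * w (b (p, x))"
          using AE_plane_fst_neq[of 0] AE_plane_fst_neq[of "Q x $ 1"]
        proof eventually_elim
          case (elim p)
          define y where "y = (p, x(hz := 0))"
          have neq: "hz \<noteq> l1" "hz \<noteq> l2" using hz by auto
          have r: "reflect y = ((Q x $ 1 - fst p, Q x $ 2 - snd p), (swp x)(hz := 0))"
            using neq by (auto simp: reflect_def y_def Qp swp_def fun_eq_iff)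
          have "signed_density s \<sigma> (reflect y) = signed_density s (- \<sigma>) y"
            using elim x hxz
            by (intro signed_density_reflect[OF hx hz hxz z1]) (auto simp: y_def r[unfolded y_def])
          then have "signed_density s \<sigma> ((Q x $ 1 - fst p, Q x $ 2 - snd p), (swp x)(hz := 0))
              = signed_density s (- \<sigma>) (p, x(hz := 0))"
            unfolding r by (simp only: y_def)
          then show ?case by (simp add: T_def F_def Qswp b_def)
        qed
      qed
    qed
  qed
  also have "\<dots> = (\<integral>\<^sup>+y. F (- \<sigma>) y * w (b y) \<partial>par I)"
    by (rule nn_integral_par_swap[OF I(1), symmetric]) measurable
  also have "\<dots> = (\<integral>\<^sup>+y. F (- \<sigma>) y * w (norm (fst y)) \<partial>par I)"
    unfolding w_def
  proof (rule size_function_irrelevant[OF I(1) F b])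
    show "(\<lambda>y. norm (fst y)) \<in> borel_measurable (par I)" by (simp add: norm_prod_def)
    show "AE y in par I. 0 < b y"
      using AE_par_fst_neq[OF I(1) Q1] by (rule eventually_mono) (auto simp: b_def zero_prod_def)
    show "AE y in par I. 0 < norm (fst y)"
      using AE_par_fst_neq[OF I(1) borel_measurable_const[of 0]] by (rule eventually_mono) (auto simp: zero_prod_def)
    fix r :: real and y :: param assume r: "r > 0"
    obtain a c x where y: "y = ((a, c), x)" by (metis surj_pair)
    have sc: "scale_par I r y = ((r * a, r * c), \<lambda>i\<in>I. r * x i)" by (simp add: scale_par_def y)
    have "signed_density s (- \<sigma>) ((r * a, r * c), (\<lambda>i\<in>I. r * x i)(hz := 0))
        = signed_density s (- \<sigma>) ((r * a, r * c), \<lambda>h. r * (x(hz := 0)) h)"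
      by (rule signed_density_cong) (auto simp: I_def)
    then show "F (- \<sigma>) (scale_par I r y) = ennreal (1 / r ^ (card I + 2)) * F (- \<sigma>) y"
      unfolding sc I(6) by (simp only: F_def y fst_conv snd_conv signed_density_scale[OF r])
    show "norm (fst (scale_par I r y)) = r * norm (fst y)"
      unfolding sc using norm_scaleR[of r "(a, c)"] r by (simp add: y)
    have "Q (\<lambda>i\<in>I. r * x i) = r *\<^sub>R Q x"
      unfolding Q_def neighbours_eq scaleR_add_right scaleR_sum_right
      by (intro arg_cong2[where f = "(+)"] sum.cong refl) (auto simp: I_def)
    then show "b (scale_par I r y) = r * b y"
      unfolding sc using norm_scaleR[of r "(Q x $ 1 - a, Q x $ 2 - c)"] r
      by (simp add: b_def y right_diff_distrib)
  qed
  finally show ?thesis unfolding fibre .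
qed

theorem config_integral_two_legs:
  assumes s: "s \<in> {1, 2}"
  shows "config_integral \<Gamma> es = 0"
proof -
  obtain hx hz where h: "hx \<in> H - {h0, l1, l2}" "hz \<in> H - {h0, l1, l2}" "hx \<noteq> hz" "dirn hz = axis 3 1"
    by (rule neighbour_coordinates)
  have hz: "hz \<in> H - {h0}" using h by auto
  have "log_length * (\<integral>\<^sup>+\<theta>. fibre_integral 2 h0 1 (cos \<theta>, sin \<theta>) * indicator {0..<2 * pi} \<theta> \<partial>lborel)
    = log_length * (\<integral>\<^sup>+\<theta>. fibre_integral 2 h0 (- 1) (cos \<theta>, sin \<theta>) * indicator {0..<2 * pi} \<theta> \<partial>lborel)"
    unfolding angular_integral[OF s]
    unfolding fibre_integral_base[OF hz h(4)]
    by (rule reflection_integral[OF h])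
  then show ?thesis
    using log_length by (intro config_integral_zero) (simp add: ennreal_mult_cancel_left)
qed

end

section \<open>Diagrams with few legs on a strand\<close>

text \<open>A leg whose neighbour is univalent forms a component of its own, which a connected diagram of
  degree at least two does not have.\<close>

lemma few_legs_integral_zero:
  assumes jd: "jacobi_diagram \<Gamma>" and con: "jconnected \<Gamma>" and deg: "jdegree \<Gamma> > 1"
    and en: "edge_enumeration \<Gamma> es" and s: "s \<in> {1, 2}" and few: "card (legs_on \<Gamma> s) < 3"
  shows "config_integral \<Gamma> es = 0"
proof -
  have ne: "halves \<Gamma> \<noteq> {}" using con by (auto simp: jconnected_def verts_def)
  interpret enumerated \<Gamma> es using jd ne en by unfold_locales
  have many: "card (verts \<Gamma>) > 2" using deg by (simp add: jdegree_def)
  show ?thesis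
  proof (cases "card (legs_on \<Gamma> s) < 2")
    case True
    then show ?thesis using config_integral_few_legs[OF s _ many] by simp
  next
    case False
    then have "card (legs_on \<Gamma> s) = 2" using few by simp
    then obtain u1 u2 where u: "legs_on \<Gamma> s = {u1, u2}" "u1 \<noteq> u2" by (auto simp: card_2_iff)
    then have uU: "u1 \<in> U" "u2 \<in> U" by (auto simp: legs_on_def)
    have tri: "vtx \<Gamma> (opp \<Gamma> (first_half \<Gamma> u)) \<in> trivalent \<Gamma>" if "u \<in> U" for u
    proof (rule ccontr)
      define l where "l = first_half \<Gamma> u"
      define v where "v = vtx \<Gamma> (opp \<Gamma> l)"
      note L = star_first_half[OF that, folded l_def]
      have uv: "u \<in> verts \<Gamma>" "v \<in> verts \<Gamma>" using that vtx_verts[OF opp_H(1)[OF L(1)]] by (auto simp: v_def univalent_def)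
      assume "vtx \<Gamma> (opp \<Gamma> (first_half \<Gamma> u)) \<notin> trivalent \<Gamma>"
      then have "v \<in> U" using uv verts_cases by (auto simp: v_def l_def)
      then have sv: "star v = {opp \<Gamma> l}" using star_univalent[OF opp_H(1)[OF L(1)]] by (simp add: v_def)
      have "w \<in> {u, v}" if "(u, w) \<in> (adjacency \<Gamma>)\<^sup>*" for w
        using that
      proof (induction rule: rtrancl_induct)
        case (step w w')
        then obtain h where h: "h \<in> H" "w = vtx \<Gamma> h" "w' = vtx \<Gamma> (opp \<Gamma> h)" by (auto simp: adjacency_def)
        then have "h = l \<or> h = opp \<Gamma> l" using step.IH L(3) sv by blast
        then show ?case using h opp_H(2)[OF L(1)] L(2) by (auto simp: v_def)
      qed simp
      then have "verts \<Gamma> \<subseteq> {u, v}" using con uv by (auto simp: jconnected_def)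
      then have "card (verts \<Gamma>) \<le> card {u, v}" by (intro card_mono) auto
      then show False using many by (simp add: card_insert_if split: if_splits)
    qed
    have "two_legs \<Gamma> es s (first_half \<Gamma> u1) (first_half \<Gamma> u2)"
    proof unfold_locales
      show "legs_on \<Gamma> s = {vtx \<Gamma> (first_half \<Gamma> u1), vtx \<Gamma> (first_half \<Gamma> u2)}"
        using u star_first_half(2) uU by simp
      show "first_half \<Gamma> u1 \<noteq> first_half \<Gamma> u2" using u(2) star_first_half(2) uU by metis
    qed (use tri uU star_first_half(1) in auto)
    then show ?thesis using two_legs.config_integral_two_legs s by blast
  qed
qed

lemma edge_enumeration_exists:
  assumes "jacobi_diagram \<Gamma>"
  shows "\<exists>es. edge_enumeration \<Gamma> es"
proof -
  have opp: "opp \<Gamma> h \<in> halves \<Gamma>" "opp \<Gamma> (opp \<Gamma> h) = h" "opp \<Gamma> h \<noteq> h" if "h \<in> halves \<Gamma>" for h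
    using assms that by (force simp: jacobi_diagram_def)+
  define S where "S = {h \<in> halves \<Gamma>. h < opp \<Gamma> h}"
  have "finite S" using assms by (simp add: S_def jacobi_diagram_def)
  then obtain es where es: "set es = S" "distinct es" using finite_distinct_list by blast
  have "S \<inter> opp \<Gamma> ` S = {}" using opp by (auto simp: S_def)
  moreover have "S \<union> opp \<Gamma> ` S = halves \<Gamma>"
  proof
    show "halves \<Gamma> \<subseteq> S \<union> opp \<Gamma> ` S"
    proof
      fix h assume h: "h \<in> halves \<Gamma>"
      show "h \<in> S \<union> opp \<Gamma> ` S"
      proof (cases "h < opp \<Gamma> h")
        case False
        then have "opp \<Gamma> h \<in> S" using opp[OF h] by (simp add: S_def)
        then show ?thesis using opp(2)[OF h] by (metis UnI2 image_eqI)
      qed (use h in \<open>simp add: S_def\<close>)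
    qed
  qed (use opp in \<open>auto simp: S_def\<close>)
  ultimately have "edge_enumeration \<Gamma> es" using es by (simp add: edge_enumeration_def)
  then show ?thesis by blast
qed

theorem proposition7p2:
  fixes n :: nat
  assumes "n > 2"
  shows "(\<forall>\<Gamma> es. jacobi_diagram \<Gamma> \<longrightarrow> jconnected \<Gamma> \<longrightarrow> jdegree \<Gamma> = n \<longrightarrow> edge_enumeration \<Gamma> es \<longrightarrow>
            (\<exists>s\<in>{1, 2}. card (legs_on \<Gamma> s) < 3) \<longrightarrow> config_integral \<Gamma> es = 0)
       \<and> two_strand_anomaly n \<in>
           span (jclass ` {\<Gamma>. jacobi_diagram \<Gamma> \<and> jconnected \<Gamma> \<and> jdegree \<Gamma> = n \<and>
                              (\<forall>s\<in>{1, 2}. card (legs_on \<Gamma> s) \<ge> 3)})"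
proof
  have zero: "config_integral \<Gamma> es = 0"
    if "jacobi_diagram \<Gamma>" "jconnected \<Gamma>" "jdegree \<Gamma> = n" "edge_enumeration \<Gamma> es"
      "\<exists>s\<in>{1, 2}. card (legs_on \<Gamma> s) < 3" for \<Gamma> es
    using that assms few_legs_integral_zero[of \<Gamma> es] by (metis less_trans one_less_numeral_iff semiring_norm(76))
  then show "\<forall>\<Gamma> es. jacobi_diagram \<Gamma> \<longrightarrow> jconnected \<Gamma> \<longrightarrow> jdegree \<Gamma> = n \<longrightarrow> edge_enumeration \<Gamma> es \<longrightarrow>
            (\<exists>s\<in>{1, 2}. card (legs_on \<Gamma> s) < 3) \<longrightarrow> config_integral \<Gamma> es = 0"
    by blast
  show "two_strand_anomaly n \<in>
           span (jclass ` {\<Gamma>. jacobi_diagram \<Gamma> \<and> jconnected \<Gamma> \<and> jdegree \<Gamma> = n \<and>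
                              (\<forall>s\<in>{1, 2}. card (legs_on \<Gamma> s) \<ge> 3)})" (is "_ \<in> span ?B")
    unfolding two_strand_anomaly_def
  proof (rule span_sum)
    fix K assume "K \<in> connected_diagrams n // unoriented_iso_rel n"
    then obtain \<Gamma>0 where \<Gamma>0: "\<Gamma>0 \<in> connected_diagrams n" "K = unoriented_iso_rel n `` {\<Gamma>0}"
      by (rule quotientE)
    define \<Gamma> where "\<Gamma> = (SOME \<Gamma>. \<Gamma> \<in> K)"
    have "\<Gamma>0 \<in> K" using unoriented_iso_rel_refl \<Gamma>0 by blast
    then have "\<Gamma> \<in> K" unfolding \<Gamma>_def by (rule someI)
    then have \<Gamma>: "jacobi_diagram \<Gamma>" "jconnected \<Gamma>" "jdegree \<Gamma> = n"
      using \<Gamma>0(2) by (auto simp: unoriented_iso_rel_def connected_diagrams_def)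
    show "anomaly_term (SOME \<Gamma>. \<Gamma> \<in> K) \<in> span ?B"
    proof (cases "\<forall>s\<in>{1, 2}. card (legs_on \<Gamma> s) \<ge> 3")
      case True
      then show ?thesis
        unfolding \<Gamma>_def[symmetric] anomaly_term_def
        using \<Gamma> by (intro span_scale span_base imageI) simp
    next
      case False
      then have "\<exists>s\<in>{1, 2}. card (legs_on \<Gamma> s) < 3" by (auto simp: not_le)
      moreover have "edge_enumeration \<Gamma> (SOME es. edge_enumeration \<Gamma> es)"
        by (rule someI_ex[OF edge_enumeration_exists[OF \<Gamma>(1)]])
      ultimately have "anomaly_term \<Gamma> = 0"
        using zero[OF \<Gamma>] by (simp add: anomaly_term_def)
      then show ?thesis unfolding \<Gamma>_def[symmetric] by (simp add: span_zero)
    qed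
  qed
qed


end
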